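(* Let $(A(n))_{n\in\mathbb{N}}$ be a stationary and ergodic sequence of random matrices with values in $\mathbb{R}_{\max}^{d\times d}$ such that $\max_{ij}A^+_{ij}(0)$ is integrable (where $a^+=\max(a,0)$). Assume the following three hypotheses. 1. For every component $c_m$ of $\mathcal{G}(A)$, $A^{\{m\}}(0)$ has no line of $-\infty$. 2. For every dominating component $c_m$ of $\mathcal{G}(A)$, $\lim_n\frac1n y^{(m)}(n,0)=\gamma^{(m)}\mathbf{1}$ a.s. 3. For all disjoint nonempty subsets $I$ and $J$ of $\{1,\dots,d\}$ such that the random matrices $\tilde A(n)=(A_{ij}(n))_{i,j\in I\cup J}$ have no line of $-\infty$ and split along $I$ and $J$ as $$\tilde A(n)=\begin{pmatrix}B(n)&D(n)\\-\infty&C(n)\end{pmatrix}$$ (i.e. $B(n)=(A_{ij}(n))_{i,j\in I}$, $D(n)=(A_{ij}(n))_{i\in I,j\in J}$, $C(n)=(A_{ij}(n))_{i,j\in J}$, and $A_{ij}(n)=-\infty$ a.s. for $i\in J$, $j\in I$), with $\mathcal{G}(B)$ strongly connected and $D(n)$ not almost surely equal to $(-\infty)^{I\times J}$, we have $$\mathbb{P}\left(\left\{\exists i\in I,\ \forall n\in\mathbb{N},\ \big(B(-1)\cdots B(-n)D(-n-1)0\big)_i=-\infty\right\}\right)=0.$$ Then $$\forall m\in\{1,\dots,K\},\quad \lim_n\frac1n y^{c_m}(n,0)=\gamma^{[m]}\mathbf{1}\quad\text{a.s.}$$ If Hypothesis 1 is strengthened by demanding that, for every component $c_m$, the random vector $A^{\{m\}}(0)0$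 is integrable, then $\left(\frac1n x(n,0)\right)_{n\in\mathbb{N}}$ converges almost surely and its limit is given by $$\forall m\in\{1,\dots,K\},\quad \lim_n\frac1n x^{c_m}(n,0)=\gamma^{[m]}\mathbf{1}\quad\text{a.s.}$$
   Context: Max-plus conventions. $\mathbb{R}_{\max}=\mathbb{R}\cup\{-\infty\}$ is the semi-ring with addition $\max$ and multiplication $+$. Products are max-plus: $(Ax)_i=\max_j(A_{ij}+x_j)$, $(AB)_{ij}=\max_k(A_{ik}+B_{kj})$. $0$ denotes the vector with all coordinates $0$ (of the appropriate size) and $\mathbf{1}$ the vector with all coordinates $1$; $\gamma\mathbf 1$ is the vector with all coordinates equal to $\gamma\in\mathbb{R}_{\max}$. $\mathbb{N}=\{0,1,2,\dots\}$; for $n=0$ the product $B(-1)\cdots B(-n)$ is empty, so $B(-1)\cdots B(-n)D(-n-1)0$ is $D(-1)0$. Limits are taken in $\mathbb{R}_{\max}=[-\infty,+\infty)$. A random matrix has "no line of $-\infty$" if almost surely each of its rows contains an entry different from $-\infty$. A random vector is integrable if each coordinate is a.s. real and integrable. Sequences. $x(n,0):=A(n-1)A(n-2)\cdots A(0)\,0$. The stationary sequence is extended, up to a change of probability space, to a stationary sequence $(A(n))_{n\in\mathbb{Z}}$, and $y(n,0):=A(-1)A(-2)\cdots A(-n)\,0$. For $I\subset\{1,\dots,d\}$ and a vector $x$, $x^I:=(x_i)_{i\in I}$. Maximal Lyapunov exponent. For a stationary ergodic sequence of (square) random matrices $(M(n))$ with entries in $\mathbb{R}_{\max}$ (rows of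 $-\infty$ allowed) with $\max_{ij}M^+_{ij}(0)$ integrable, $\frac1n\max_{i,j}(M(n-1)\cdots M(0))_{ij}$ converges a.s. to a constant $\gamma(M)\in\mathbb{R}_{\max}$, the maximal Lyapunov exponent. Graph. $\mathcal{G}(A)$ is the directed graph with nodes $1,\dots,d$ and arcs the pairs $(i,j)$ with $\mathbb{P}(A_{ij}(0)\neq-\infty)>0$; $\mathcal{G}(B)$ is defined likewise for other stationary sequences of square matrices. Its strongly connected components (called components) are $c_1,\dots,c_K$ (a component may be a single node without loop; but the graph $\mathcal{G}(B)$ consisting of a single node without loop is not regarded as strongly connected in Hypothesis 3). Write $m\rightarrow l$ if $m=l$ or there is a path in $\mathcal{G}(A)$ from a node of $c_m$ to a node of $c_l$. For each $m$ define: $A^{(m)}(n):=(A_{ij}(n))_{i,j\in c_m}$; $\gamma^{(m)}:=\gamma(A^{(m)})$; $y^{(m)}(n,0):=A^{(m)}(-1)\cdots A^{(m)}(-n)0$; $E_m:=\{l: m\rightarrow l\}$; $\gamma^{[m]}:=\max_{l\in E_m}\gamma^{(l)}$; $G_m:=\{l\in E_m: \exists p,\ m\rightarrow l\rightarrow p,\ \gamma^{(p)}=\gamma^{[m]}\}$; $H_m:=\bigcup_{l\in G_m}c_l$; $A^{\{m\}}(n):=(A_{ij}(n))_{i,j\in H_m}$. The component $c_m$ is dominating if $G_m=\{m\}$, i.e. if $\gamma^{(m)}>\gamma^{(l)}$ for every $l\in E_m\setminus\{m\}$. *)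

theory Defs
  imports "HOL-Probability.Probability"
begin

text \<open>
  Elements of the max-plus semiring are \<^typ>\<open>ereal\<close>s different from \<^term>\<open>\<infinity>\<close>.  On these,
  \<^term>\<open>(+)\<close> is the max-plus product (with \<^term>\<open>-\<infinity>\<close> absorbing) and \<^const>\<open>sup\<close> the max-plus sum;
  all suprema below range over finite index sets, and the empty one is \<^term>\<open>-\<infinity>\<close>.
  Submatrices are not separate objects: the operations take the index set \<open>I\<close> of the rows and columns
  that are kept, and \<open>A\<close> restricted to \<open>I \<times> I\<close> is the intended matrix.
\<close>

type_synonym 'd rmat = "'d \<Rightarrow> 'd \<Rightarrow> ereal"
type_synonym 'd rvec = "'d \<Rightarrow> ereal"

definition mp_vec :: "'d set \<Rightarrow> 'd rmat \<Rightarrow> 'd rvec \<Rightarrow> 'd rvec" where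
  "mp_vec I A x = (\<lambda>i. SUP j\<in>I. A i j + x j)"

definition mp_mult :: "'d set \<Rightarrow> 'd rmat \<Rightarrow> 'd rmat \<Rightarrow> 'd rmat" where
  "mp_mult I A B = (\<lambda>i j. SUP k\<in>I. A i k + B k j)"

definition mp_id :: "'d rmat" where
  "mp_id = (\<lambda>i j. if i = j then 0 else -\<infinity>)"

text \<open>\<open>mp_prod I A n = A (n - 1) \<cdots> A 0\<close>\<close>

primrec mp_prod :: "'d set \<Rightarrow> (nat \<Rightarrow> 'd rmat) \<Rightarrow> nat \<Rightarrow> 'd rmat" where
  "mp_prod I A 0 = mp_id"
| "mp_prod I A (Suc n) = mp_mult I (A n) (mp_prod I A n)"

text \<open>\<open>mp_back_prod I A n = A (-1) \<cdots> A (-n)\<close>\<close>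

primrec mp_back_prod :: "'d set \<Rightarrow> (int \<Rightarrow> 'd rmat) \<Rightarrow> nat \<Rightarrow> 'd rmat" where
  "mp_back_prod I A 0 = mp_id"
| "mp_back_prod I A (Suc n) = mp_mult I (mp_back_prod I A n) (A (- int (Suc n)))"

definition mp_x :: "'d set \<Rightarrow> (nat \<Rightarrow> 'w \<Rightarrow> 'd rmat) \<Rightarrow> nat \<Rightarrow> 'w \<Rightarrow> 'd rvec" where
  "mp_x I A n \<omega> = mp_vec I (mp_prod I (\<lambda>k. A k \<omega>) n) (\<lambda>_. 0)"

definition mp_y :: "'d set \<Rightarrow> (int \<Rightarrow> 'w \<Rightarrow> 'd rmat) \<Rightarrow> nat \<Rightarrow> 'w \<Rightarrow> 'd rvec" where
  "mp_y I A n \<omega> = mp_vec I (mp_back_prod I (\<lambda>k. A k \<omega>) n) (\<lambda>_. 0)"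


text \<open>The index type of a sequence is \<^typ>\<open>nat\<close> or \<^typ>\<open>int\<close>.\<close>

definition path_law ::
  "'w measure \<Rightarrow> ('i \<Rightarrow> 'w \<Rightarrow> 'a::topological_space) \<Rightarrow> ('i \<Rightarrow> 'a) measure" where
  "path_law M X = distr M (Pi\<^sub>M UNIV (\<lambda>_. borel)) (\<lambda>\<omega> n. X n \<omega>)"

definition stationary ::
  "'w measure \<Rightarrow> ('i::{plus,one} \<Rightarrow> 'w \<Rightarrow> 'a::topological_space) \<Rightarrow> bool" where
  "stationary M X \<longleftrightarrow>
     (\<forall>n. X n \<in> borel_measurable M) \<and> path_law M (\<lambda>n. X (n + 1)) = path_law M X"

definition ergodic ::
  "'w measure \<Rightarrow> ('i::{plus,one} \<Rightarrow> 'w \<Rightarrow> 'a::topological_space) \<Rightarrow> bool" where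
  "ergodic M X \<longleftrightarrow>
     (\<forall>S \<in> sets (Pi\<^sub>M UNIV (\<lambda>_. borel)). {s. (\<lambda>n. s (n + 1)) \<in> S} = S \<longrightarrow>
        measure (path_law M X) S = 0 \<or> measure (path_law M X) S = 1)"

definition rmax_valued :: "'w measure \<Rightarrow> ('i \<Rightarrow> 'w \<Rightarrow> 'd rmat) \<Rightarrow> bool" where
  "rmax_valued M A \<longleftrightarrow> (\<forall>n. \<forall>\<omega>\<in>space M. \<forall>i j. A n \<omega> i j \<noteq> \<infinity>)"

definition no_line :: "'w measure \<Rightarrow> 'd set \<Rightarrow> ('w \<Rightarrow> 'd rmat) \<Rightarrow> bool" where
  "no_line M I B \<longleftrightarrow> (AE \<omega> in M. \<forall>i\<in>I. \<exists>j\<in>I. B \<omega> i j \<noteq> -\<infinity>)"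

definition integrable_vec :: "'w measure \<Rightarrow> 'd set \<Rightarrow> ('w \<Rightarrow> 'd rvec) \<Rightarrow> bool" where
  "integrable_vec M I X \<longleftrightarrow>
     (\<forall>i\<in>I. (AE \<omega> in M. \<bar>X \<omega> i\<bar> \<noteq> \<infinity>) \<and> integrable M (\<lambda>\<omega>. real_of_ereal (X \<omega> i)))"

text \<open>
  The maximal Lyapunov exponent of the submatrices indexed by \<open>I\<close>.  The description is proper
  for stationary ergodic sequences whose entries have integrable positive part.
\<close>

definition lyap :: "'w measure \<Rightarrow> (nat \<Rightarrow> 'w \<Rightarrow> 'd rmat) \<Rightarrow> 'd set \<Rightarrow> ereal" where
  "lyap M A I =
     (THE g. AE \<omega> in M.
        (\<lambda>n. (SUP i\<in>I. SUP j\<in>I. mp_prod I (\<lambda>k. A k \<omega>) n i j) / ereal (real n)) \<longlonglongrightarrow> g)"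


definition arcs_on :: "'w measure \<Rightarrow> (nat \<Rightarrow> 'w \<Rightarrow> 'd rmat) \<Rightarrow> 'd set \<Rightarrow> ('d \<times> 'd) set" where
  "arcs_on M A I = {(i, j). i \<in> I \<and> j \<in> I \<and> measure M {\<omega> \<in> space M. A 0 \<omega> i j \<noteq> -\<infinity>} > 0}"

text \<open>
  Paths of positive length are required, so that a single node without loop is excluded.
\<close>

definition strongly_connected_on :: "'w measure \<Rightarrow> (nat \<Rightarrow> 'w \<Rightarrow> 'd rmat) \<Rightarrow> 'd set \<Rightarrow> bool" where
  "strongly_connected_on M A I \<longleftrightarrow> (\<forall>i\<in>I. \<forall>j\<in>I. (i, j) \<in> (arcs_on M A I)\<^sup>+)"

text \<open>
  The components are the classes of mutual reachability; here a single node without loop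
  is admitted.  A component \<open>c\<^sub>m\<close> is represented by its node set rather than by its number \<open>m\<close>.
\<close>

definition components_of :: "'w measure \<Rightarrow> (nat \<Rightarrow> 'w \<Rightarrow> 'd rmat) \<Rightarrow> 'd set set" where
  "components_of M A =
     UNIV // {(i, j). (i, j) \<in> (arcs_on M A UNIV)\<^sup>* \<and> (j, i) \<in> (arcs_on M A UNIV)\<^sup>*}"

definition leads_to :: "'w measure \<Rightarrow> (nat \<Rightarrow> 'w \<Rightarrow> 'd rmat) \<Rightarrow> 'd set \<Rightarrow> 'd set \<Rightarrow> bool" where
  "leads_to M A c c' \<longleftrightarrow> c = c' \<or> (\<exists>i\<in>c. \<exists>j\<in>c'. (i, j) \<in> (arcs_on M A UNIV)\<^sup>+)"

text \<open>
  For a component \<open>c = c\<^sub>m\<close>, the next four constants are \<open>E\<^sub>m\<close>, \<open>\<gamma>\<^bsup>[m]\<^esup>\<close>, \<open>G\<^sub>m\<close> and \<open>H\<^sub>m\<close>,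
  while \<open>\<gamma>\<^bsup>(m)\<^esup>\<close> is \<open>lyap M A c\<close>.
\<close>

definition comp_E :: "'w measure \<Rightarrow> (nat \<Rightarrow> 'w \<Rightarrow> 'd rmat) \<Rightarrow> 'd set \<Rightarrow> 'd set set" where
  "comp_E M A c = {l \<in> components_of M A. leads_to M A c l}"

definition comp_gamma :: "'w measure \<Rightarrow> (nat \<Rightarrow> 'w \<Rightarrow> 'd rmat) \<Rightarrow> 'd set \<Rightarrow> ereal" where
  "comp_gamma M A c = Max (lyap M A ` comp_E M A c)"

definition comp_G :: "'w measure \<Rightarrow> (nat \<Rightarrow> 'w \<Rightarrow> 'd rmat) \<Rightarrow> 'd set \<Rightarrow> 'd set set" where
  "comp_G M A c =
     {l \<in> comp_E M A c. \<exists>p \<in> components_of M A.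
        leads_to M A c l \<and> leads_to M A l p \<and> lyap M A p = comp_gamma M A c}"

definition comp_H :: "'w measure \<Rightarrow> (nat \<Rightarrow> 'w \<Rightarrow> 'd rmat) \<Rightarrow> 'd set \<Rightarrow> 'd set" where
  "comp_H M A c = \<Union> (comp_G M A c)"

definition dominating :: "'w measure \<Rightarrow> (nat \<Rightarrow> 'w \<Rightarrow> 'd rmat) \<Rightarrow> 'd set \<Rightarrow> bool" where
  "dominating M A c \<longleftrightarrow> comp_G M A c = {c}"

text \<open>
  \<open>A'\<close> on \<open>M'\<close> is a stationary two-sided extension of \<open>A\<close>, after a change of probability space.
\<close>

definition two_sided_extension ::
  "'w measure \<Rightarrow> (nat \<Rightarrow> 'w \<Rightarrow> 'd rmat) \<Rightarrow> 'v measure \<Rightarrow> (int \<Rightarrow> 'v \<Rightarrow> 'd rmat) \<Rightarrow> bool" where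
  "two_sided_extension M A M' A' \<longleftrightarrow>
     prob_space M' \<and> rmax_valued M' A' \<and> stationary M' A' \<and>
     path_law M' (\<lambda>n::nat. A' (int n)) = path_law M A"

end

theory Submission
  imports Defs
begin

text \<open>
  On its law, the sequence is an ergodic dynamical system, and so is its two-sided extension with the
  backward shift.  For a subadditive process Kingman's theorem is proved in a form that is uniform in
  the starting time: \<open>f\<^bsub>n-m\<^esub> \<circ> T\<^sup>m \<le> \<beta> (n - m) + \<epsilon> n + C\<close> for all \<open>m \<le> n\<close> whenever \<open>\<beta>\<close> exceeds the limit.
  A path in a block triangular matrix crosses from one block to the other once, so these bounds pass
  from the diagonal blocks to the whole matrix, which gives the upper bounds.

  The lower bound for \<open>y\<close> is an induction along the order of the components.  If \<open>c\<close> is not dominating,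
  then by Hypothesis 3 (or by Hypothesis 1, if \<open>c\<close> is a node without loop) almost surely some path of
  finite weight leads from every node of \<open>c\<close> to a component below it with the same exponent.

  Under the integrability condition \<open>- min\<^sub>i x\<^sub>i\<close>, taken over \<open>H\<^sub>m\<close>, is subadditive, hence divided by \<open>n\<close>
  it converges to a constant; it has the same law as \<open>- min\<^sub>i y\<^sub>i\<close>, which identifies the constant.
\<close>

text \<open>Entries may be -\<infinity> with positive probability, so the processes have no
  integrable lower bound and an argument through expectations of the products is not at hand; the
  limits are obtained as constants from the behaviour along orbits. Uniformity in the starting time
  is what a block decomposition asks for: the second diagonal block is entered at a time that varies
  with \<open>n\<close>, and convergence along each shifted orbit says nothing about all these
  starts at once. The two products behave differently. Equality of the laws of \<open>x\<close> and
  \<open>y\<close> at each \<open>n\<close> alone yields only convergence in probability of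
  \<open>x / n\<close>; that the minimum converges almost surely must come from elsewhere, and the
  integrability condition is what supplies it.\<close>

section \<open>Ergodic theorems\<close>

text \<open>One walks from \<open>m\<close> to \<open>n\<close>, by single steps from the bad times and otherwise by jumps of length
  at most \<open>L\<close> that cost at most \<open>\<beta>\<close> per unit of time; near the end of the interval, where a jump could
  overshoot \<open>n\<close>, single steps are used again.\<close>

lemma walk_bound:
  fixes F :: "nat \<Rightarrow> nat \<Rightarrow> ereal" and G :: "nat \<Rightarrow> real"
  assumes sub: "\<And>m k n. m \<le> k \<Longrightarrow> k \<le> n \<Longrightarrow> F m n \<le> F m k + F k n"
    and F0: "\<And>m. F m m \<le> 0"
    and F1: "\<And>m. F m (Suc m) \<le> ereal (G m - \<bar>\<beta>\<bar>)"
    and G0: "\<And>m. \<bar>\<beta>\<bar> \<le> G m"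
    and good: "\<And>m. m \<notin> bad \<Longrightarrow> \<exists>l\<in>{1..L}. F m (m + l) \<le> ereal (\<beta> * real l)"
  assumes "m \<le> n"
  shows "F m n \<le> ereal (\<beta> * real (n - m) + (\<Sum>k\<in>{m..<n} \<inter> bad. G k) + (\<Sum>k\<in>{m..<n} \<inter> {n-L..}. G k))"
  using \<open>m \<le> n\<close>
proof (induction "n - m" arbitrary: m rule: less_induct)
  case less
  have Gp: "0 \<le> G k" for k using G0[of k] by linarith
  \<comment> \<open>Single steps all the way. Since
    \<open>G k - \<bar>\<beta>\<bar> \<le> \<beta> + G k\<close>, a single step is covered by the
    rate \<beta> plus its own \<open>G\<close>, whatever the sign of \<beta>.\<close>
  have triv: "F m n \<le> ereal (\<Sum>k\<in>{m..<n}. G k - \<bar>\<beta>\<bar>)" if "m \<le> n" for m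
    using that
  proof (induction rule: inc_induct)
    case base show ?case using F0 by (simp add: zero_ereal_def)
  next
    case (step k)
    have "F k n \<le> F k (Suc k) + F (Suc k) n" using sub[of k "Suc k" n] step by auto
    also have "\<dots> \<le> ereal (G k - \<bar>\<beta>\<bar>) + ereal (\<Sum>k\<in>{Suc k..<n}. G k - \<bar>\<beta>\<bar>)"
      by (intro add_mono F1 step.IH)
    also have "\<dots> = ereal (\<Sum>k\<in>{k..<n}. G k - \<bar>\<beta>\<bar>)"
      using step by (simp add: sum.atLeast_Suc_lessThan)
    finally show ?case .
  qed
  have mono: "sum G (A \<inter> X) \<le> sum G B" if "A \<inter> X \<subseteq> B" "finite B" for A B X
    using that by (intro sum_mono2) (auto simp: Gp)
  show ?case
  proof (cases "n - L \<le> m \<or> m = n")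
    case True
    have "(\<Sum>k\<in>{m..<n}. G k - \<bar>\<beta>\<bar>) = (\<Sum>k\<in>{m..<n}. G k) - \<bar>\<beta>\<bar> * real (n - m)"
      by (simp add: sum_subtractf algebra_simps)
    moreover have "{m..<n} \<inter> {n-L..} = {m..<n}" using True by auto
    moreover have "- (\<bar>\<beta>\<bar> * real (n - m)) \<le> \<beta> * real (n - m)"
      using mult_right_mono[of "-\<bar>\<beta>\<bar>" \<beta> "real (n-m)"] by auto
    moreover have "0 \<le> (\<Sum>k\<in>{m..<n} \<inter> bad. G k)" by (simp add: Gp sum_nonneg)
    ultimately have "(\<Sum>k\<in>{m..<n}. G k - \<bar>\<beta>\<bar>) \<le> \<beta> * real (n - m) + (\<Sum>k\<in>{m..<n} \<inter> bad. G k) + (\<Sum>k\<in>{m..<n} \<inter> {n-L..}. G k)"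
      by simp
    then show ?thesis using triv[OF less.prems] by (meson ereal_less_eq(3) order_trans)
  next
    case False
    then have mn: "m < n - L" "m < n" using less.prems by auto
    show ?thesis
    proof (cases "m \<in> bad")
      case True
      have IH: "F (Suc m) n \<le> ereal (\<beta> * real (n - Suc m) + (\<Sum>k\<in>{Suc m..<n} \<inter> bad. G k) + (\<Sum>k\<in>{Suc m..<n} \<inter> {n-L..}. G k))"
        using mn by (intro less.hyps) auto
      have "F m n \<le> F m (Suc m) + F (Suc m) n" using sub[of m "Suc m" n] mn by auto
      also have "\<dots> \<le> ereal (G m - \<bar>\<beta>\<bar>) + ereal (\<beta> * real (n - Suc m) + (\<Sum>k\<in>{Suc m..<n} \<inter> bad. G k) + (\<Sum>k\<in>{Suc m..<n} \<inter> {n-L..}. G k))"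
        by (intro add_mono F1 IH)
      also have "\<dots> \<le> ereal (\<beta> * real (n - m) + (\<Sum>k\<in>{m..<n} \<inter> bad. G k) + (\<Sum>k\<in>{m..<n} \<inter> {n-L..}. G k))"
      proof -
        have e: "{m..<n} \<inter> bad = insert m ({Suc m..<n} \<inter> bad)" using True mn by auto
        have 1: "(\<Sum>k\<in>{m..<n} \<inter> bad. G k) = G m + (\<Sum>k\<in>{Suc m..<n} \<inter> bad. G k)"
          unfolding e by (subst sum.insert) auto
        have 2: "(\<Sum>k\<in>{Suc m..<n} \<inter> {n-L..}. G k) \<le> (\<Sum>k\<in>{m..<n} \<inter> {n-L..}. G k)"
          by (intro mono) auto
        have 3: "real (n - m) = real (n - Suc m) + 1" using mn by auto
        show ?thesis unfolding 1 3 using 2 by (simp add: algebra_simps)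
      qed
      finally show ?thesis .
    next
      case False
      then obtain l where l: "1 \<le> l" "l \<le> L" "F m (m + l) \<le> ereal (\<beta> * real l)"
        using good[of m] by (metis atLeastAtMost_iff)
      have IH: "F (m+l) n \<le> ereal (\<beta> * real (n - (m+l)) + (\<Sum>k\<in>{m+l..<n} \<inter> bad. G k) + (\<Sum>k\<in>{m+l..<n} \<inter> {n-L..}. G k))"
        using mn l by (intro less.hyps) auto
      have "F m n \<le> F m (m+l) + F (m+l) n" using sub[of m "m+l" n] mn l by auto
      also have "\<dots> \<le> ereal (\<beta> * real l) + ereal (\<beta> * real (n - (m+l)) + (\<Sum>k\<in>{m+l..<n} \<inter> bad. G k) + (\<Sum>k\<in>{m+l..<n} \<inter> {n-L..}. G k))"
        by (intro add_mono l(3) IH)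
      also have "\<dots> \<le> ereal (\<beta> * real (n - m) + (\<Sum>k\<in>{m..<n} \<inter> bad. G k) + (\<Sum>k\<in>{m..<n} \<inter> {n-L..}. G k))"
      proof -
        have 1: "(\<Sum>k\<in>{m+l..<n} \<inter> bad. G k) \<le> (\<Sum>k\<in>{m..<n} \<inter> bad. G k)"
          by (intro mono) auto
        have 2: "(\<Sum>k\<in>{m+l..<n} \<inter> {n-L..}. G k) \<le> (\<Sum>k\<in>{m..<n} \<inter> {n-L..}. G k)"
          by (intro mono) auto
        have 3: "real (n - m) = real (n - (m+l)) + real l" using mn l by auto
        show ?thesis unfolding 3 using 1 2 by (simp add: algebra_simps)
      qed
      finally show ?thesis .
    qed
  qed
qed

locale ergodic_system = prob_space M for M :: "'a measure" +
  fixes T :: "'a \<Rightarrow> 'a"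
  assumes T_measurable [measurable]: "T \<in> M \<rightarrow>\<^sub>M M"
    and T_distr: "distr M M T = M"
    and T_ergodic: "\<And>S. S \<in> sets M \<Longrightarrow> T -` S \<inter> space M = S \<Longrightarrow> prob S = 0 \<or> prob S = 1"
begin

lemma funpow_measurable [measurable]: "(T ^^ n) \<in> M \<rightarrow>\<^sub>M M"
  by (induction n) (simp_all add: measurable_comp[OF _ T_measurable] id_def)

lemma funpow_distr: "distr M M (T ^^ n) = M"
proof (induction n)
  case 0 then show ?case by (simp add: id_def distr_id)
next
  case (Suc n)
  have "distr M M (T ^^ Suc n) = distr (distr M M (T ^^ n)) M T"
    by (subst distr_distr) (simp_all add: o_def)
  also have "\<dots> = M" unfolding Suc by (rule T_distr)
  finally show ?case .
qed

lemma AE_funpow: "AE x in M. Q x \<Longrightarrow> AE x in M. Q ((T ^^ n) x)"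
  by (rule AE_distrD[OF funpow_measurable]) (simp only: funpow_distr)

lemma AE_orbit: "AE x in M. Q x \<Longrightarrow> AE x in M. \<forall>n. Q ((T ^^ n) x)"
  by (simp add: AE_all_countable AE_funpow)

lemma integrable_funpow:
  fixes u :: "'a \<Rightarrow> real" assumes "integrable M u" shows "integrable M (\<lambda>x. u ((T ^^ n) x))"
  using assms integrable_distr[OF funpow_measurable, of n u] by (simp add: funpow_distr)

lemma integral_funpow:
  fixes u :: "'a \<Rightarrow> real" assumes "integrable M u" shows "(\<integral>x. u ((T ^^ n) x) \<partial>M) = (\<integral>x. u x \<partial>M)"
  using assms integral_distr[OF funpow_measurable, of u n] by (simp add: funpow_distr)

text \<open>As \<open>T\<close> preserves the measure, \<open>S\<close> and its preimage have equal
  probability, so the inclusion between them is an equality up to a null set.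
  \<open>T_ergodic\<close> wants strict invariance; it is achieved by passing to the points that
  visit \<open>S\<close> infinitely often, a set that agrees with \<open>S\<close> almost
  surely.\<close>

lemma AE_zero_one:
  assumes S[measurable]: "S \<in> sets M" and sub: "AE x in M. x \<in> S \<longrightarrow> T x \<in> S"
  shows "(AE x in M. x \<in> S) \<or> (AE x in M. x \<notin> S)"
proof -
  define S' where "S' = T -` S \<inter> space M"
  have S'm[measurable]: "S' \<in> sets M" unfolding S'_def by measurable
  have pS': "prob S' = prob S"
    using measure_distr[OF T_measurable S] T_distr by (simp add: S'_def)
  have "prob (S' \<inter> S) = prob S"
    by (rule finite_measure_eq_AE) (use sub in \<open>auto simp: S'_def\<close>)
  then have "prob (S' - S) = 0"
    using finite_measure_Diff'[of S' S] pS' by auto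
  then have "AE x in M. x \<notin> S' - S"
    by (subst (asm) prob_eq_0) auto
  then have "AE x in M. x \<in> S \<longleftrightarrow> T x \<in> S"
    using sub AE_space by eventually_elim (auto simp: S'_def)
  from AE_orbit[OF this] have inv: "AE x in M. \<forall>n. (T ^^ n) x \<in> S \<longleftrightarrow> x \<in> S"
  proof eventually_elim
    case (elim x)
    have "(T ^^ n) x \<in> S \<longleftrightarrow> x \<in> S" for n by (induction n) (use elim in auto)
    then show ?case by auto
  qed
  define R where "R = (\<Inter>m. \<Union>n\<in>{m..}. (T ^^ n) -` S \<inter> space M)"
  have R[measurable]: "R \<in> sets M" unfolding R_def by measurable
  have R_iff: "x \<in> R \<longleftrightarrow> x \<in> space M \<and> (\<exists>\<^sub>\<infinity>n. (T ^^ n) x \<in> S)" for x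
    unfolding R_def INFM_nat_le by auto
  have "T -` R \<inter> space M = R"
  proof -
    have "(\<exists>\<^sub>\<infinity>n. (T ^^ n) (T x) \<in> S) \<longleftrightarrow> (\<exists>\<^sub>\<infinity>n. (T ^^ n) x \<in> S)" for x
    proof -
      have "(T ^^ n) (T x) = (T ^^ Suc n) x" for n by (simp only: funpow_Suc_right o_apply)
      then have "(\<exists>\<^sub>\<infinity>n. (T ^^ n) (T x) \<in> S) \<longleftrightarrow> (\<exists>\<^sub>\<infinity>n. (T ^^ Suc n) x \<in> S)" by (simp del: funpow.simps)
      also have "\<dots> \<longleftrightarrow> (\<exists>\<^sub>\<infinity>n. (T ^^ n) x \<in> S)"
        unfolding frequently_def cofinite_eq_sequentially
        by (subst eventually_sequentially_Suc) (rule refl)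
      finally show ?thesis .
    qed
    moreover have "x \<in> space M \<Longrightarrow> T x \<in> space M" for x
      using measurable_space[OF T_measurable] by auto
    ultimately show ?thesis by (auto simp: R_iff)
  qed
  from T_ergodic[OF R this] have "prob R = 0 \<or> prob R = 1" .
  moreover have "AE x in M. x \<in> R \<longleftrightarrow> x \<in> S"
    using inv AE_space by eventually_elim (auto simp: R_iff)
  ultimately show ?thesis
  proof (elim disjE)
    assume *: "AE x in M. x \<in> R \<longleftrightarrow> x \<in> S"
    { assume "prob R = 0"
      then have "AE x in M. x \<notin> R" using prob_eq_0[OF R] by auto
      with * have "AE x in M. x \<notin> S" by eventually_elim auto
      then show ?thesis by auto }
    { assume "prob R = 1"
      then have "AE x in M. x \<in> R" by (rule AE_prob_1)
      with * have "AE x in M. x \<in> S" by eventually_elim auto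
      then show ?thesis by auto }
  qed
qed

text \<open>Each superlevel set at a rational level is almost surely mapped into itself, hence has
  probability 0 or 1. The constant is the supremum of the rational levels exceeded almost
  surely.\<close>

lemma AE_const:
  fixes \<phi> :: "'a \<Rightarrow> ereal"
  assumes [measurable]: "\<phi> \<in> borel_measurable M" and sub: "AE x in M. \<phi> x \<le> \<phi> (T x)"
  shows "\<exists>c. AE x in M. \<phi> x = c"
proof -
  define Q where "Q = {q::rat. AE x in M. \<phi> x > ereal (of_rat q)}"
  have dich: "(AE x in M. \<phi> x > ereal (of_rat q)) \<or> (AE x in M. \<not> \<phi> x > ereal (of_rat q))" for q
  proof -
    have "AE x in M. x \<in> {x\<in>space M. \<phi> x > ereal (of_rat q)} \<longrightarrow> T x \<in> {x\<in>space M. \<phi> x > ereal (of_rat q)}"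
      using sub AE_space by eventually_elim (auto dest: measurable_space[OF T_measurable] intro: less_le_trans)
    from AE_zero_one[OF _ this]
    have "(AE x in M. x \<in> {x \<in> space M. ereal (real_of_rat q) < \<phi> x}) \<or> (AE x in M. x \<notin> {x \<in> space M. ereal (real_of_rat q) < \<phi> x})" by measurable
    then show ?thesis
    proof (elim disjE)
      assume "AE x in M. x \<in> {x \<in> space M. ereal (real_of_rat q) < \<phi> x}"
      then show ?thesis by (intro disjI1) (auto elim: eventually_mono)
    next
      assume "AE x in M. x \<notin> {x \<in> space M. ereal (real_of_rat q) < \<phi> x}"
      then have "AE x in M. \<not> ereal (real_of_rat q) < \<phi> x" using AE_space by eventually_elim auto
      then show ?thesis ..
    qed
  qed
  have "AE x in M. \<forall>q. \<phi> x > ereal (of_rat q) \<longleftrightarrow> q \<in> Q"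
    unfolding AE_all_countable
  proof (intro allI)
    fix q
    show "AE x in M. \<phi> x > ereal (of_rat q) \<longleftrightarrow> q \<in> Q"
    proof (cases "q \<in> Q")
      case True
      then have "AE x in M. \<phi> x > ereal (of_rat q)" by (simp add: Q_def)
      then show ?thesis using True by (auto elim: eventually_mono)
    next
      case False
      then have "AE x in M. \<not> \<phi> x > ereal (of_rat q)" using dich[of q] by (auto simp: Q_def)
      then show ?thesis using False by (auto elim: eventually_mono)
    qed
  qed
  then have "AE x in M. \<phi> x = (SUP q\<in>Q. ereal (of_rat q))"
  proof eventually_elim
    case (elim x)
    show ?case
    proof (rule antisym)
      show "\<phi> x \<le> (SUP q\<in>Q. ereal (of_rat q))"
      proof (rule ccontr)
        assume "\<not> ?thesis"
        then obtain q where q: "(SUP q\<in>Q. ereal (of_rat q)) < ereal (of_rat q)" "ereal (of_rat q) < \<phi> x"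
          using ereal_dense3[of "SUP q\<in>Q. ereal (of_rat q)" "\<phi> x"] by (auto simp: not_le)
        then have "q \<in> Q" using elim by auto
        then have "ereal (of_rat q) \<le> (SUP q\<in>Q. ereal (of_rat q))" by (rule SUP_upper)
        then show False using q by auto
      qed
      show "(SUP q\<in>Q. ereal (of_rat q)) \<le> \<phi> x"
        by (rule SUP_least) (use elim in \<open>auto simp: less_imp_le\<close>)
    qed
  qed
  then show ?thesis by auto
qed

end

section \<open>Subadditive processes over an ergodic map\<close>

lemma eventually_le_bounded:
  fixes a b :: "nat \<Rightarrow> real"
  assumes "eventually (\<lambda>n. a n \<le> b n) sequentially"
  shows "\<exists>C\<ge>0. \<forall>n. a n \<le> b n + C"
proof -
  obtain N where N: "\<And>n. n \<ge> N \<Longrightarrow> a n \<le> b n" using assms by (auto simp: eventually_sequentially)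
  define C where "C = (\<Sum>n<N. \<bar>a n - b n\<bar>)"
  have C0: "0 \<le> C" by (simp add: C_def sum_nonneg)
  have "a n \<le> b n + C" for n
  proof (cases "n < N")
    case True
    then have "\<bar>a n - b n\<bar> \<le> C" unfolding C_def by (intro member_le_sum) auto
    then show ?thesis by linarith
  next
    case False then show ?thesis using N[of n] C0 by auto
  qed
  then show ?thesis using C0 by auto
qed

lemma liminf_divide_shift_le:
  fixes a b :: "nat \<Rightarrow> ereal"
  assumes ab: "\<And>n. a (Suc n) \<le> ereal r + b n"
  shows "liminf (\<lambda>n. a n / ereal (real n)) \<le> liminf (\<lambda>n. b n / ereal (real n))"
proof (rule ccontr)
  assume "\<not> ?thesis"
  then obtain q2 where q2: "liminf (\<lambda>n. b n / ereal (real n)) < ereal q2" "ereal q2 < liminf (\<lambda>n. a n / ereal (real n))"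
    using ereal_dense2 by (auto simp: not_le)
  then obtain q1 where q1: "liminf (\<lambda>n. b n / ereal (real n)) < ereal q1" "ereal q1 < ereal q2"
    using ereal_dense2 by blast
  have "eventually (\<lambda>n. ereal q2 < a n / ereal (real n)) sequentially"
    by (rule less_LiminfD[OF q2(2)])
  then have "eventually (\<lambda>n. ereal q2 < a (Suc n) / ereal (real (Suc n))) sequentially"
    by (subst eventually_sequentially_Suc)
  \<comment> \<open>This threshold makes \<open>q1 * n \<le> q2 * (n + 1) - r\<close>: the gap
    between the slopes absorbs both the constant \<open>r\<close> and the index shift.\<close>
  moreover have "eventually (\<lambda>n. real n \<ge> (r - q2) / (q2 - q1)) sequentially"
    using filterlim_real_sequentially by (auto simp: filterlim_at_top)
  moreover have "eventually (\<lambda>n. n \<ge> 1) sequentially" by (rule eventually_ge_at_top)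
  ultimately have "eventually (\<lambda>n. ereal q1 \<le> b n / ereal (real n)) sequentially"
  proof eventually_elim
    case (elim n)
    have "ereal (q2 * real (Suc n)) < a (Suc n)"
      using elim(1) by (simp add: ereal_less_divide_iff)
    also note ab[of n]
    finally have 1: "ereal (q2 * real (Suc n) - r) < b n" by (cases "b n") (auto simp: algebra_simps)
    have "r - q2 \<le> real n * (q2 - q1)" using elim(2) q1(2) by (simp add: divide_le_eq)
    then have "q1 * real n \<le> q2 * real (Suc n) - r" by (simp add: algebra_simps)
    then have "ereal (q1 * real n) \<le> b n" using 1 by (meson ereal_less_eq(3) less_imp_le order_trans)
    then show ?case using elim(3) by (simp add: ereal_le_divide_pos mult.commute)
  qed
  then have "ereal q1 \<le> liminf (\<lambda>n. b n / ereal (real n))" by (rule Liminf_bounded)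
  then show False using q1(1) by auto
qed

locale subadditive_process = ergodic_system +
  fixes f :: "nat \<Rightarrow> 'a \<Rightarrow> ereal" and g :: "'a \<Rightarrow> real"
  assumes f_measurable [measurable]: "\<And>n. f n \<in> borel_measurable M"
    and f_subadditive: "\<And>m n. AE x in M. f (m + n) x \<le> f m x + f n ((T ^^ m) x)"
    and f_zero: "AE x in M. f 0 x \<le> 0"
    and f_one: "AE x in M. f 1 x \<le> ereal (g x)"
    and g_integrable: "integrable M g"
begin

lemma g_measurable [measurable]: "g \<in> borel_measurable M"
  using g_integrable by auto

text \<open>Subadditivity with a first block of length one makes the lower limit non-decreasing
  along the orbit, so \<open>AE_const\<close> applies.\<close>

lemma liminf_const: "\<exists>c. AE x in M. liminf (\<lambda>n. f n x / ereal (real n)) = c"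
proof (rule AE_const)
  have "AE x in M. \<forall>n. f (1 + n) x \<le> f 1 x + f n ((T ^^ 1) x)"
    using f_subadditive[of 1] by (simp only: AE_all_countable) auto
  then show "AE x in M. liminf (\<lambda>n. f n x / ereal (real n)) \<le> liminf (\<lambda>n. f n (T x) / ereal (real n))"
    using f_one
  proof eventually_elim
    case (elim x)
    show ?case
    proof (rule liminf_divide_shift_le)
      fix n show "f (Suc n) x \<le> ereal (g x) + f n (T x)"
        using elim(1)[rule_format, of n] add_right_mono[OF elim(2), of "f n (T x)"] by auto
    qed
  qed
qed measurable

text \<open>A point is bad for \<open>L\<close> if no jump of length at most \<open>L\<close>
  achieves slope \<beta>. As the lower limit is below \<beta>, almost every point is good for large
  \<open>L\<close>, and dominated convergence makes the integral of
  \<open>\<bar>g\<bar> + \<bar>\<beta>\<bar>\<close> over the bad set as small as desired. The rest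
  is \<open>walk_bound\<close> along the orbit.\<close>

lemma orbit_cover:
  assumes c: "AE x in M. liminf (\<lambda>n. f n x / ereal (real n)) = c" and "c < ereal \<beta>" and "0 < \<delta>"
  obtains B L where "B \<in> sets M" "(\<integral>x. indicator B x * (\<bar>g x\<bar> + \<bar>\<beta>\<bar>) \<partial>M) < \<delta>"
    "AE x in M. \<forall>m n. m \<le> n \<longrightarrow> f (n - m) ((T ^^ m) x) \<le>
       ereal (\<beta> * real (n - m) + (\<Sum>k\<in>{m..<n}. indicator B ((T ^^ k) x) * (\<bar>g ((T ^^ k) x)\<bar> + \<bar>\<beta>\<bar>))
         + (\<Sum>k\<in>{m..<n} \<inter> {n-L..}. \<bar>g ((T ^^ k) x)\<bar> + \<bar>\<beta>\<bar>))"
proof -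
  define B where "B L = {x\<in>space M. \<forall>l\<in>{1..L}. \<not> f l x \<le> ereal (\<beta> * real l)}" for L :: nat
  have B[measurable]: "B L \<in> sets M" for L unfolding B_def by measurable
  define G where "G x = \<bar>g x\<bar> + \<bar>\<beta>\<bar>" for x
  have G: "integrable M G" unfolding G_def using g_integrable by auto
  have G0: "0 \<le> G x" for x by (simp add: G_def)
  have "AE x in M. \<exists>l\<ge>1. f l x \<le> ereal (\<beta> * real l)"
    using c
  proof eventually_elim
    case (elim x)
    show ?case
    proof (rule ccontr)
      assume *: "\<not> ?case"
      have "eventually (\<lambda>n. ereal \<beta> \<le> f n x / ereal (real n)) sequentially"
        using eventually_ge_at_top[of 1]
      proof eventually_elim
        case (elim n)
        have "ereal (\<beta> * real n) \<le> f n x" using * elim by (metis linear)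
        then show ?case using elim by (simp add: ereal_le_divide_pos mult.commute)
      qed
      then have "ereal \<beta> \<le> liminf (\<lambda>n. f n x / ereal (real n))" by (rule Liminf_bounded)
      then show False using elim \<open>c < ereal \<beta>\<close> by auto
    qed
  qed
  then have "AE x in M. (\<lambda>L. indicator (B L) x * G x) \<longlonglongrightarrow> 0"
  proof eventually_elim
    case (elim x)
    then obtain l where l: "l \<ge> 1" "f l x \<le> ereal (\<beta> * real l)" by auto
    have "eventually (\<lambda>L. indicator (B L) x * G x = 0) sequentially"
      using eventually_ge_at_top[of l] by eventually_elim (use l in \<open>auto simp: B_def indicator_def\<close>)
    then show ?case by (rule tendsto_eventually)
  qed
  then have "(\<lambda>L. \<integral>x. indicator (B L) x * G x \<partial>M) \<longlonglongrightarrow> (\<integral>x. 0 \<partial>M)"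
    using G by (intro integral_dominated_convergence[where w = G])
      (auto simp: G0 indicator_def split: if_splits intro!: AE_I2 borel_measurable_integrable)
  then have "eventually (\<lambda>L. (\<integral>x. indicator (B L) x * G x \<partial>M) < \<delta>) sequentially"
    using \<open>0 < \<delta>\<close> by (intro order_tendstoD) auto
  then obtain L where L: "(\<integral>x. indicator (B L) x * G x \<partial>M) < \<delta>"
    by (auto simp: eventually_sequentially)
  show ?thesis
  proof (rule that[of "B L" L])
    show "(\<integral>x. indicator (B L) x * (\<bar>g x\<bar> + \<bar>\<beta>\<bar>) \<partial>M) < \<delta>" using L by (simp add: G_def)
    have "AE x in M. \<forall>m n. f (m + n) x \<le> f m x + f n ((T ^^ m) x)"
      using f_subadditive by (simp only: AE_all_countable) auto
    from AE_orbit[OF this] AE_orbit[OF f_zero] AE_orbit[OF f_one] AE_orbit[OF AE_space]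
    show "AE x in M. \<forall>m n. m \<le> n \<longrightarrow> f (n - m) ((T ^^ m) x) \<le>
       ereal (\<beta> * real (n - m) + (\<Sum>k\<in>{m..<n}. indicator (B L) ((T ^^ k) x) * (\<bar>g ((T ^^ k) x)\<bar> + \<bar>\<beta>\<bar>))
         + (\<Sum>k\<in>{m..<n} \<inter> {n-L..}. \<bar>g ((T ^^ k) x)\<bar> + \<bar>\<beta>\<bar>))"
    proof eventually_elim
      case (elim x)
      define bad where "bad = {k. (T ^^ k) x \<in> B L}"
      show ?case
      proof (intro allI impI)
        fix m n :: nat assume "m \<le> n"
        have "f (n - m) ((T ^^ m) x) \<le>
          ereal (\<beta> * real (n - m) + (\<Sum>k\<in>{m..<n} \<inter> bad. G ((T ^^ k) x)) + (\<Sum>k\<in>{m..<n} \<inter> {n-L..}. G ((T ^^ k) x)))"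
        proof (rule walk_bound[where F = "\<lambda>m n. f (n - m) ((T ^^ m) x)" and G = "\<lambda>k. G ((T ^^ k) x)"])
          fix m k n :: nat assume mk: "m \<le> k" "k \<le> n"
          have "f ((k - m) + (n - k)) ((T ^^ m) x) \<le> f (k - m) ((T ^^ m) x) + f (n - k) ((T ^^ (k - m)) ((T ^^ m) x))"
            using elim(1) by blast
          moreover have "(T ^^ (k - m)) ((T ^^ m) x) = (T ^^ k) x"
            using mk by (metis comp_apply funpow_add le_add_diff_inverse2)
          ultimately show "f (n - m) ((T ^^ m) x) \<le> f (k - m) ((T ^^ m) x) + f (n - k) ((T ^^ k) x)"
            using mk by simp
        next
          fix m show "f (m - m) ((T ^^ m) x) \<le> 0" using elim(2) by simp
        next
          fix m
          have "f 1 ((T ^^ m) x) \<le> ereal (g ((T ^^ m) x))" using elim(3) by blast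
          also have "\<dots> \<le> ereal (G ((T ^^ m) x) - \<bar>\<beta>\<bar>)" by (simp add: G_def)
          finally show "f (Suc m - m) ((T ^^ m) x) \<le> ereal (G ((T ^^ m) x) - \<bar>\<beta>\<bar>)" by simp
        next
          fix m show "\<bar>\<beta>\<bar> \<le> G ((T ^^ m) x)" by (simp add: G_def)
        next
          fix m assume "m \<notin> bad"
          then show "\<exists>l\<in>{1..L}. f (m + l - m) ((T ^^ m) x) \<le> ereal (\<beta> * real l)"
            using elim(4) by (auto simp: bad_def B_def)
        qed fact
        moreover have "(\<Sum>k\<in>{m..<n} \<inter> bad. G ((T ^^ k) x)) = (\<Sum>k\<in>{m..<n}. indicator (B L) ((T ^^ k) x) * G ((T ^^ k) x))"
          unfolding sum.inter_restrict[OF finite_atLeastLessThan]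
          by (intro sum.cong refl) (auto simp: bad_def indicator_def)
        ultimately show "f (n - m) ((T ^^ m) x) \<le>
       ereal (\<beta> * real (n - m) + (\<Sum>k\<in>{m..<n}. indicator (B L) ((T ^^ k) x) * (\<bar>g ((T ^^ k) x)\<bar> + \<bar>\<beta>\<bar>))
         + (\<Sum>k\<in>{m..<n} \<inter> {n-L..}. \<bar>g ((T ^^ k) x)\<bar> + \<bar>\<beta>\<bar>))" by (simp add: G_def)
      qed
    qed
  qed (use B in auto)
qed

end

section \<open>Birkhoff's ergodic theorem\<close>

context ergodic_system
begin

text \<open>Additive sums form a subadditive process, so the lower limit is a constant
  \<open>c\<close>. If \<open>c\<close> were below the mean, integrating the estimate of
  \<open>orbit_cover\<close> with \<open>m = 0\<close> would bound \<open>n * \<delta>\<close> by a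
  number independent of \<open>n\<close>.\<close>

lemma birkhoff_lower:
  fixes u :: "'a \<Rightarrow> real"
  assumes u: "integrable M u"
  shows "AE x in M. ereal (\<integral>x. u x \<partial>M) \<le> liminf (\<lambda>n. ereal (\<Sum>k<n. u ((T ^^ k) x)) / ereal (real n))"
proof -
  have [measurable]: "u \<in> borel_measurable M" using u by auto
  interpret S: subadditive_process M T "\<lambda>n x. ereal (\<Sum>k<n. u ((T ^^ k) x))" u
  proof unfold_locales
    fix m n
    have "(T ^^ k) ((T ^^ m) x) = (T ^^ (m + k)) x" for k x
      by (metis add.commute comp_apply funpow_add)
    then have "(\<Sum>k<m+n. u ((T ^^ k) x)) = (\<Sum>k<m. u ((T ^^ k) x)) + (\<Sum>k<n. u ((T ^^ k) ((T ^^ m) x)))" for x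
      by (induction n) simp_all
    then show "AE x in M. ereal (\<Sum>k<m+n. u ((T ^^ k) x)) \<le> ereal (\<Sum>k<m. u ((T ^^ k) x)) + ereal (\<Sum>k<n. u ((T ^^ k) ((T ^^ m) x)))"
      by simp
  qed (use u in auto)
  obtain c where c: "AE x in M. liminf (\<lambda>n. ereal (\<Sum>k<n. u ((T ^^ k) x)) / ereal (real n)) = c"
    using S.liminf_const by auto
  define E where "E = (\<integral>x. u x \<partial>M)"
  have "ereal E \<le> c"
  proof (rule ccontr)
    assume "\<not> ereal E \<le> c"
    then obtain \<beta> where \<beta>: "c < ereal \<beta>" "\<beta> < E" using ereal_dense2[of c "ereal E"] by (auto simp: not_le)
    \<comment> \<open>Half of the gap between \<beta> and the mean: the bad set consumes at most one
      half, and the other half remains in each of the \<open>n\<close> time units.\<close>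
    define \<delta> where "\<delta> = (E - \<beta>) / 2"
    have \<delta>: "0 < \<delta>" "E - \<beta> - \<delta> = \<delta>" using \<beta> by (auto simp: \<delta>_def field_simps)
    define G where "G x = \<bar>u x\<bar> + \<bar>\<beta>\<bar>" for x
    have G[simp]: "integrable M G" unfolding G_def using u by auto
    have G0: "0 \<le> G x" for x by (simp add: G_def)
    obtain B L where [measurable]: "B \<in> sets M" and B: "(\<integral>x. indicator B x * (\<bar>u x\<bar> + \<bar>\<beta>\<bar>) \<partial>M) < \<delta>" and
      cover: "AE x in M. \<forall>m n. m \<le> n \<longrightarrow> ereal (\<Sum>k<n - m. u ((T ^^ k) ((T ^^ m) x))) \<le>
       ereal (\<beta> * real (n - m) + (\<Sum>k\<in>{m..<n}. indicator B ((T ^^ k) x) * (\<bar>u ((T ^^ k) x)\<bar> + \<bar>\<beta>\<bar>))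
         + (\<Sum>k\<in>{m..<n} \<inter> {n-L..}. \<bar>u ((T ^^ k) x)\<bar> + \<bar>\<beta>\<bar>))"
      by (rule S.orbit_cover[OF c \<beta>(1) \<delta>(1)]) blast
    define h where "h x = indicator B x * G x" for x
    have h[simp]: "integrable M h" unfolding h_def
      using integrable_real_mult_indicator[OF \<open>B \<in> sets M\<close> G] by (simp only: mult.commute)
    have bound: "real n * \<delta> \<le> real L * (\<integral>x. G x \<partial>M)" for n
    proof -
      let ?I = "{0..<n} \<inter> {n-L..}"
      have "AE x in M. (\<Sum>k<n. u ((T ^^ k) x)) \<le> \<beta> * real n + (\<Sum>k\<in>{0..<n}. h ((T ^^ k) x)) + (\<Sum>k\<in>?I. G ((T ^^ k) x))"
        using cover
      proof eventually_elim
        case (elim x)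
        from elim[rule_format, of 0 n] show ?case by (simp add: h_def G_def)
      qed
      then have "(\<integral>x. (\<Sum>k<n. u ((T ^^ k) x)) \<partial>M) \<le> (\<integral>x. \<beta> * real n + (\<Sum>k\<in>{0..<n}. h ((T ^^ k) x)) + (\<Sum>k\<in>?I. G ((T ^^ k) x)) \<partial>M)"
        by (intro integral_mono_AE) (auto intro!: integrable_funpow u integrable_sum Bochner_Integration.integrable_add Bochner_Integration.integrable_sum)
      also have "\<dots> = \<beta> * real n + real n * (\<integral>x. h x \<partial>M) + real (card ?I) * (\<integral>x. G x \<partial>M)"
        by (simp add: integrable_funpow integral_funpow prob_space)
      also have "(\<integral>x. (\<Sum>k<n. u ((T ^^ k) x)) \<partial>M) = real n * E"
        by (simp add: integrable_funpow integral_funpow u E_def)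
      finally have 1: "real n * E \<le> \<beta> * real n + real n * (\<integral>x. h x \<partial>M) + real (card ?I) * (\<integral>x. G x \<partial>M)" .
      have "card ?I \<le> card {n-L..<n}" by (intro card_mono) auto
      then have "card ?I \<le> L" by simp
      then have 2: "real (card ?I) * (\<integral>x. G x \<partial>M) \<le> real L * (\<integral>x. G x \<partial>M)"
        by (intro mult_right_mono) (auto simp: G0)
      have 3: "real n * (\<integral>x. h x \<partial>M) \<le> real n * \<delta>"
        using B by (intro mult_left_mono) (auto simp: h_def G_def)
      have "real n * \<delta> = real n * E - \<beta> * real n - real n * \<delta>" by (subst \<delta>(2)[symmetric]) (simp add: algebra_simps)
      then show ?thesis using 1 2 3 by linarith
    qed
    obtain n :: nat where "real L * (\<integral>x. G x \<partial>M) / \<delta> < real n" using reals_Archimedean2 by blast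
    then have "real L * (\<integral>x. G x \<partial>M) < real n * \<delta>" using \<delta> by (simp add: divide_less_eq)
    then show False using bound[of n] by auto
  qed
  then show ?thesis using c unfolding E_def by (auto elim: eventually_mono simp del: ereal_divide)
qed

lemma birkhoff_lower_linear:
  fixes u :: "'a \<Rightarrow> real"
  assumes u: "integrable M u" and "0 < \<epsilon>"
  shows "AE x in M. \<exists>C\<ge>0. \<forall>n. real n * (\<integral>x. u x \<partial>M) \<le> (\<Sum>k<n. u ((T ^^ k) x)) + \<epsilon> * real n + C"
  using birkhoff_lower[OF u]
proof eventually_elim
  case (elim x)
  have "ereal ((\<integral>x. u x \<partial>M) - \<epsilon>) < ereal (\<integral>x. u x \<partial>M)" using \<open>0 < \<epsilon>\<close> by simp
  also note elim
  finally have "eventually (\<lambda>n. ereal ((\<integral>x. u x \<partial>M) - \<epsilon>) < ereal (\<Sum>k<n. u ((T ^^ k) x)) / ereal (real n)) sequentially"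
    by (rule less_LiminfD)
  then have "eventually (\<lambda>n. real n * (\<integral>x. u x \<partial>M) \<le> (\<Sum>k<n. u ((T ^^ k) x)) + \<epsilon> * real n) sequentially"
    using eventually_ge_at_top[of 1]
  proof eventually_elim
    case (elim n)
    then have "((\<integral>x. u x \<partial>M) - \<epsilon>) * real n < (\<Sum>k<n. u ((T ^^ k) x))"
      by (simp add: less_divide_eq)
    then show ?case by (simp add: algebra_simps)
  qed
  from eventually_le_bounded[OF this] show ?case by simp
qed

text \<open>The upper half is the lower half for \<open>- u\<close>. The form with an additive
  constant, instead of a limit, gives an error bound at every time simultaneously, which is how
  \<open>kingman_uniform\<close> uses it.\<close>

lemma birkhoff_linear:
  fixes u :: "'a \<Rightarrow> real"
  assumes u: "integrable M u" and "0 < \<epsilon>"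
  shows "AE x in M. \<exists>C\<ge>0. \<forall>n. \<bar>(\<Sum>k<n. u ((T ^^ k) x)) - real n * (\<integral>x. u x \<partial>M)\<bar> \<le> \<epsilon> * real n + C"
proof -
  have "integrable M (\<lambda>x. - u x)" using u by simp
  from birkhoff_lower_linear[OF this \<open>0 < \<epsilon>\<close>] birkhoff_lower_linear[OF u \<open>0 < \<epsilon>\<close>] show ?thesis
  proof eventually_elim
    case (elim x)
    from elim(1) obtain C where C: "C \<ge> 0" "\<And>n. real n * (\<integral>x. - u x \<partial>M) \<le> (\<Sum>k<n. - u ((T ^^ k) x)) + \<epsilon> * real n + C" by auto
    from elim(2) obtain D where D: "D \<ge> 0" "\<And>n. real n * (\<integral>x. u x \<partial>M) \<le> (\<Sum>k<n. u ((T ^^ k) x)) + \<epsilon> * real n + D" by auto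
    show ?case
    proof (intro exI[of _ "C + D"] conjI allI)
      fix n show "\<bar>(\<Sum>k<n. u ((T ^^ k) x)) - real n * (\<integral>x. u x \<partial>M)\<bar> \<le> \<epsilon> * real n + (C + D)"
        using C(1) D(1) C(2)[of n] D(2)[of n] by (simp add: sum_negf abs_le_iff)
    qed (use C D in auto)
  qed
qed

theorem birkhoff:
  fixes u :: "'a \<Rightarrow> real"
  assumes u: "integrable M u"
  shows "AE x in M. (\<lambda>n. (\<Sum>k<n. u ((T ^^ k) x)) / real n) \<longlonglongrightarrow> (\<integral>x. u x \<partial>M)"
proof -
  have "AE x in M. \<forall>k. \<exists>C\<ge>0. \<forall>n. \<bar>(\<Sum>k<n. u ((T ^^ k) x)) - real n * (\<integral>x. u x \<partial>M)\<bar> \<le> (1 / real (Suc k)) * real n + C"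
    unfolding AE_all_countable by (intro allI birkhoff_linear u) simp
  then show ?thesis
  proof eventually_elim
    case (elim x)
    show ?case
    proof (rule LIMSEQ_I)
      fix r :: real assume "0 < r"
      then obtain k where k: "1 / real (Suc k) < r / 2" using reals_Archimedean[of "r / 2"] by (auto simp: inverse_eq_divide)
      obtain C where C: "0 \<le> C" "\<And>n. \<bar>(\<Sum>k<n. u ((T ^^ k) x)) - real n * (\<integral>x. u x \<partial>M)\<bar> \<le> (1 / real (Suc k)) * real n + C"
        using elim by blast
      obtain N :: nat where N: "2 * C / r < real N" using reals_Archimedean2 by blast
      have "norm ((\<Sum>k<n. u ((T ^^ k) x)) / real n - (\<integral>x. u x \<partial>M)) < r" if n: "n \<ge> Suc N" for n
      proof -
        have "real N < real n" using n by simp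
        then have "2 * C / r < real n" using N by linarith
        then have "C < r / 2 * real n" using \<open>0 < r\<close> by (simp add: field_simps)
        moreover have "(1 / real (Suc k)) * real n \<le> r / 2 * real n" using k by (intro mult_right_mono) auto
        ultimately have "\<bar>(\<Sum>k<n. u ((T ^^ k) x)) - real n * (\<integral>x. u x \<partial>M)\<bar> < r * real n"
          using C(2)[of n] by linarith
        moreover have "(\<Sum>k<n. u ((T ^^ k) x)) / real n - (\<integral>x. u x \<partial>M) = ((\<Sum>k<n. u ((T ^^ k) x)) - real n * (\<integral>x. u x \<partial>M)) / real n"
          using n by (simp add: field_simps)
        ultimately show ?thesis using n by (simp add: divide_less_eq)
      qed
      then show "\<exists>no. \<forall>n\<ge>no. norm ((\<Sum>k<n. u ((T ^^ k) x)) / real n - (\<integral>x. u x \<partial>M)) < r" by blast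
    qed
  qed
qed

text \<open>A single orbit value is the difference of two consecutive Birkhoff sums, each of which
  is known up to \<open>\<epsilon> / 2 * n + C\<close>.\<close>

lemma orbit_sublinear:
  fixes u :: "'a \<Rightarrow> real"
  assumes u: "integrable M u" and "0 < \<epsilon>"
  shows "AE x in M. \<exists>C\<ge>0. \<forall>n. u ((T ^^ n) x) \<le> \<epsilon> * real n + C"
proof -
  have "0 < \<epsilon> / 2" using \<open>0 < \<epsilon>\<close> by simp
  from birkhoff_linear[OF u this] show ?thesis
  proof eventually_elim
    case (elim x)
    then obtain C where C: "C \<ge> 0" "\<And>n. \<bar>(\<Sum>k<n. u ((T ^^ k) x)) - real n * (\<integral>x. u x \<partial>M)\<bar> \<le> \<epsilon> / 2 * real n + C" by auto
    show ?case
    proof (intro exI[of _ "2 * C + \<epsilon> + \<bar>\<integral>x. u x \<partial>M\<bar>"] conjI allI)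
      fix n
      have "u ((T ^^ n) x) = (\<Sum>k<Suc n. u ((T ^^ k) x)) - (\<Sum>k<n. u ((T ^^ k) x))" by simp
      then show "u ((T ^^ n) x) \<le> \<epsilon> * real n + (2 * C + \<epsilon> + \<bar>\<integral>x. u x \<partial>M\<bar>)"
        using abs_le_D2[OF C(2)[of n]] abs_le_D1[OF C(2)[of "Suc n"]] \<open>0 < \<epsilon>\<close>
          abs_ge_self[of "\<integral>x. u x \<partial>M"]
        by (simp add: algebra_simps add_divide_distrib)
    qed (use C \<open>0 < \<epsilon>\<close> in auto)
  qed
qed

end

text \<open>Rational slopes, so that the premise can be collected from countably many almost sure
  statements.\<close>

lemma limsup_divide_le:
  fixes a :: "nat \<Rightarrow> ereal"
  assumes "\<And>q. c < ereal (of_rat q) \<Longrightarrow> \<exists>C. \<forall>n. a n \<le> ereal (of_rat q * real n + C)"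
  shows "limsup (\<lambda>n. a n / ereal (real n)) \<le> c"
proof (rule ccontr)
  assume "\<not> ?thesis"
  then obtain q where q: "c < ereal (of_rat q)" "ereal (of_rat q) < limsup (\<lambda>n. a n / ereal (real n))"
    using ereal_dense3[of c] by (auto simp: not_le)
  obtain p where p: "c < ereal (of_rat p)" "p < q"
    using ereal_dense3[OF q(1)] by (auto simp: of_rat_less)
  define d where "d = (of_rat q - of_rat p :: real)"
  have d: "0 < d" using p(2) by (simp add: d_def of_rat_less)
  obtain C where C: "\<And>n. a n \<le> ereal (of_rat p * real n + C)" using assms[OF p(1)] by auto
  have "eventually (\<lambda>n. real n \<ge> C / d) sequentially"
    using filterlim_real_sequentially by (auto simp: filterlim_at_top)
  moreover have "eventually (\<lambda>n. n \<ge> 1) sequentially" by (rule eventually_ge_at_top)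
  ultimately have "eventually (\<lambda>n. a n / ereal (real n) \<le> ereal (of_rat q)) sequentially"
  proof eventually_elim
    case (elim n)
    have "C \<le> real n * d" using elim(1) d by (simp add: divide_le_eq)
    then have "of_rat p * real n + C \<le> of_rat q * real n" by (simp add: d_def algebra_simps)
    then have "a n \<le> ereal (of_rat q * real n)" using C[of n] by (meson ereal_less_eq(3) order_trans)
    then show ?case using elim(2) by (simp add: ereal_divide_le_pos mult.commute)
  qed
  then have "limsup (\<lambda>n. a n / ereal (real n)) \<le> ereal (of_rat q)" by (rule Limsup_bounded)
  then show False using q(2) by auto
qed

section \<open>Kingman's theorem, uniform in the starting time\<close>

context subadditive_process
begin

text \<open>The bad times in \<open>{m..<n}\<close> are among those in \<open>{..<n}\<close>, whose
  total cost Birkhoff's theorem controls for all \<open>n\<close> at once. Hence \<open>C\<close>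
  does not depend on \<open>m\<close>, at the price of an error proportional to the end time
  \<open>n\<close> instead of the length \<open>n - m\<close>. The final stretch costs at most
  \<open>L\<close> orbit values, each sublinear.\<close>

lemma kingman_uniform:
  assumes c: "AE x in M. liminf (\<lambda>n. f n x / ereal (real n)) = c"
    and "c < ereal \<beta>" and "0 < \<epsilon>"
  shows "AE x in M. \<exists>C\<ge>0. \<forall>m n. m \<le> n \<longrightarrow>
           f (n - m) ((T ^^ m) x) \<le> ereal (\<beta> * real (n - m) + \<epsilon> * real n + C)"
proof -
  define G where "G x = \<bar>g x\<bar> + \<bar>\<beta>\<bar>" for x
  have G[simp]: "integrable M G" unfolding G_def using g_integrable by auto
  have G0: "0 \<le> G x" for x by (simp add: G_def)
  have "0 < \<epsilon> / 4" using \<open>0 < \<epsilon>\<close> by simp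
  obtain B L where [measurable]: "B \<in> sets M" and B: "(\<integral>x. indicator B x * (\<bar>g x\<bar> + \<bar>\<beta>\<bar>) \<partial>M) < \<epsilon> / 4"
    and cover: "AE x in M. \<forall>m n. m \<le> n \<longrightarrow> f (n - m) ((T ^^ m) x) \<le>
       ereal (\<beta> * real (n - m) + (\<Sum>k\<in>{m..<n}. indicator B ((T ^^ k) x) * (\<bar>g ((T ^^ k) x)\<bar> + \<bar>\<beta>\<bar>))
         + (\<Sum>k\<in>{m..<n} \<inter> {n-L..}. \<bar>g ((T ^^ k) x)\<bar> + \<bar>\<beta>\<bar>))"
    by (rule orbit_cover[OF c \<open>c < ereal \<beta>\<close> \<open>0 < \<epsilon> / 4\<close>]) blast
  define h where "h x = indicator B x * G x" for x
  have h: "integrable M h" unfolding h_def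
    using integrable_real_mult_indicator[OF \<open>B \<in> sets M\<close> G] by (simp only: mult.commute)
  have h0: "0 \<le> h x" for x by (simp add: h_def G0)
  \<comment> \<open>At most \<open>L\<close> terms fall in the final stretch, so slope \<eta> for
    each keeps the slope of their sum within \<open>\<epsilon> / 2\<close>; the \<open>+ 1\<close>
    guards against \<open>L = 0\<close>.\<close>
  define \<eta> where "\<eta> = \<epsilon> / (2 * (real L + 1))"
  have \<eta>: "0 < \<eta>" "real L * \<eta> \<le> \<epsilon> / 2" using \<open>0 < \<epsilon>\<close> by (auto simp: \<eta>_def field_simps)
  from cover birkhoff_linear[OF h \<open>0 < \<epsilon> / 4\<close>] orbit_sublinear[OF G \<eta>(1)]
  show ?thesis
  proof eventually_elim
    case (elim x)
    from elim(2) obtain C where C: "C \<ge> 0" "\<And>n. \<bar>(\<Sum>k<n. h ((T ^^ k) x)) - real n * (\<integral>x. h x \<partial>M)\<bar> \<le> \<epsilon> / 4 * real n + C" by auto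
    from elim(3) obtain D where D: "D \<ge> 0" "\<And>n. G ((T ^^ n) x) \<le> \<eta> * real n + D" by auto
    show ?case
    proof (intro exI[of _ "C + real L * D"] conjI allI impI)
      fix m n :: nat assume "m \<le> n"
      have "(\<Sum>k\<in>{m..<n}. h ((T ^^ k) x)) \<le> (\<Sum>k<n. h ((T ^^ k) x))"
        by (intro sum_mono2) (auto simp: h0)
      also have "\<dots> \<le> real n * (\<integral>x. h x \<partial>M) + \<epsilon> / 4 * real n + C"
        using abs_le_D1[OF C(2)[of n]] by simp
      also have "real n * (\<integral>x. h x \<partial>M) \<le> real n * (\<epsilon> / 4)"
        using B by (intro mult_left_mono) (auto simp: h_def G_def)
      finally have 1: "(\<Sum>k\<in>{m..<n}. h ((T ^^ k) x)) \<le> \<epsilon> / 2 * real n + C" by simp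
      let ?I = "{m..<n} \<inter> {n-L..}"
      have "card ?I \<le> card {n-L..<n}" by (intro card_mono) auto
      then have cI: "real (card ?I) \<le> real L" by simp
      have "(\<Sum>k\<in>?I. G ((T ^^ k) x)) \<le> (\<Sum>k\<in>?I. \<eta> * real n + D)"
      proof (rule sum_mono)
        fix k assume "k \<in> ?I"
        then have "\<eta> * real k \<le> \<eta> * real n" using \<eta>(1) by (intro mult_left_mono) auto
        then show "G ((T ^^ k) x) \<le> \<eta> * real n + D" using D(2)[of k] by linarith
      qed
      also have "\<dots> = real (card ?I) * (\<eta> * real n + D)" by simp
      also have "\<dots> \<le> real L * (\<eta> * real n + D)"
        using D(1) \<eta>(1) by (intro mult_right_mono cI) auto
      also have "\<dots> = (real L * \<eta>) * real n + real L * D" by (simp add: algebra_simps)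
      also have "(real L * \<eta>) * real n \<le> \<epsilon> / 2 * real n" by (intro mult_right_mono \<eta>(2)) auto
      finally have 2: "(\<Sum>k\<in>?I. G ((T ^^ k) x)) \<le> \<epsilon> / 2 * real n + real L * D" by simp
      have "f (n - m) ((T ^^ m) x) \<le> ereal (\<beta> * real (n - m) + (\<Sum>k\<in>{m..<n}. h ((T ^^ k) x)) + (\<Sum>k\<in>?I. G ((T ^^ k) x)))"
        using elim(1) \<open>m \<le> n\<close> by (simp add: h_def G_def)
      also have "\<dots> \<le> ereal (\<beta> * real (n - m) + \<epsilon> * real n + (C + real L * D))"
        using 1 2 by simp
      finally show "f (n - m) ((T ^^ m) x) \<le> ereal (\<beta> * real (n - m) + \<epsilon> * real n + (C + real L * D))" .
    qed (use C D in auto)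
  qed
qed

lemma le_birkhoff_sum: "AE x in M. \<forall>n. f n x \<le> ereal (\<Sum>k<n. g ((T ^^ k) x))"
proof -
  have "AE x in M. \<forall>n. f (n + 1) x \<le> f n x + f 1 ((T ^^ n) x)"
    using f_subadditive by (simp only: AE_all_countable) auto
  from this f_zero AE_orbit[OF f_one] show ?thesis
  proof eventually_elim
    case (elim x)
    show ?case
    proof
      fix n show "f n x \<le> ereal (\<Sum>k<n. g ((T ^^ k) x))"
      proof (induction n)
        case 0 then show ?case using elim(2) by (simp add: zero_ereal_def)
      next
        case (Suc n)
        have "f (Suc n) x \<le> f n x + f 1 ((T ^^ n) x)" using elim(1) by (metis Suc_eq_plus1)
        also have "\<dots> \<le> ereal (\<Sum>k<n. g ((T ^^ k) x)) + ereal (g ((T ^^ n) x))"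
          by (intro add_mono Suc.IH) (use elim(3) in auto)
        finally show ?case by simp
      qed
    qed
  qed
qed

text \<open>No expectation of \<^term>\<open>f n\<close> occurs, so that \<^term>\<open>f n\<close> may take the value \<^term>\<open>-\<infinity>\<close> with
  positive probability.\<close>

theorem kingman:
  obtains c where "c < \<infinity>" "AE x in M. (\<lambda>n. f n x / ereal (real n)) \<longlonglongrightarrow> c"
proof -
  obtain c where c: "AE x in M. liminf (\<lambda>n. f n x / ereal (real n)) = c" using liminf_const by auto
  define E where "E = (\<integral>x. g x \<partial>M)"
  \<comment> \<open>This only excludes \<open>c = \<infinity>\<close>; \<open>E + 1\<close> leaves
    room for the slope error \<open>1 / 2\<close> in Birkhoff's theorem and for its
    constant.\<close>
  have "AE x in M. c \<le> ereal (E + 1)"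
    using c le_birkhoff_sum birkhoff_linear[OF g_integrable, of "1/2", simplified]
  proof eventually_elim
    case (elim x)
    obtain C where C: "\<And>n. \<bar>(\<Sum>k<n. g ((T ^^ k) x)) - real n * (\<integral>x. g x \<partial>M)\<bar> \<le> 1/2 * real n + C" using elim(3) by auto
    have "eventually (\<lambda>n. real n \<ge> 2 * C) sequentially"
      using filterlim_real_sequentially by (auto simp: filterlim_at_top)
    moreover have "eventually (\<lambda>n. n \<ge> 1) sequentially" by (rule eventually_ge_at_top)
    ultimately have "eventually (\<lambda>n. f n x / ereal (real n) \<le> ereal (E + 1)) sequentially"
    proof eventually_elim
      fix n assume n: "2 * C \<le> real n" "1 \<le> n"
      have "(\<Sum>k<n. g ((T ^^ k) x)) \<le> (E + 1) * real n"
        using abs_le_D1[OF C[of n]] n by (simp add: E_def algebra_simps)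
      then have "f n x \<le> ereal ((E + 1) * real n)"
        using elim(2) by (meson ereal_less_eq(3) order_trans)
      then show "f n x / ereal (real n) \<le> ereal (E + 1)" using n
        by (simp add: ereal_divide_le_pos mult.commute)
    qed
    then have "limsup (\<lambda>n. f n x / ereal (real n)) \<le> ereal (E + 1)" by (rule Limsup_bounded)
    then show ?case using elim(1) Liminf_le_Limsup[of sequentially "\<lambda>n. f n x / ereal (real n)"] by auto
  qed
  then have "c \<le> ereal (E + 1)" by simp
  then have "c < \<infinity>" by (auto simp: le_less_trans)
  have "AE x in M. c < ereal (of_rat q) \<longrightarrow> (\<exists>C. \<forall>n. f n x \<le> ereal (of_rat q * real n + C))" for q :: rat
  proof (cases "c < ereal (of_rat q)")
    case True
    then obtain \<beta> where \<beta>: "c < ereal \<beta>" "\<beta> < of_rat q" using ereal_dense2[OF True] by auto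
    \<comment> \<open>For \<open>m = 0\<close> the length and the end time coincide, so the slopes
      \<beta> and \<epsilon> add up to \<open>q\<close>.\<close>
    define \<epsilon> where "\<epsilon> = of_rat q - \<beta>"
    from kingman_uniform[OF c \<beta>(1), of \<epsilon>] have "AE x in M. \<exists>C\<ge>0. \<forall>m n. m \<le> n \<longrightarrow>
           f (n - m) ((T ^^ m) x) \<le> ereal (\<beta> * real (n - m) + \<epsilon> * real n + C)"
      using \<beta> by (simp add: \<epsilon>_def)
    then show ?thesis
    proof eventually_elim
      case (elim x)
      then obtain C where C: "\<And>m n. m \<le> n \<Longrightarrow> f (n - m) ((T ^^ m) x) \<le> ereal (\<beta> * real (n - m) + \<epsilon> * real n + C)" by auto
      have "f n x \<le> ereal (of_rat q * real n + C)" for n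
        using C[of 0 n] by (simp add: \<epsilon>_def algebra_simps)
      then show ?case by auto
    qed
  qed simp
  then have "AE x in M. \<forall>q::rat. c < ereal (of_rat q) \<longrightarrow> (\<exists>C. \<forall>n. f n x \<le> ereal (of_rat q * real n + C))"
    by (simp add: AE_all_countable)
  with c have "AE x in M. (\<lambda>n. f n x / ereal (real n)) \<longlonglongrightarrow> c"
  proof eventually_elim
    case (elim x)
    have "limsup (\<lambda>n. f n x / ereal (real n)) \<le> c" using elim(2) by (intro limsup_divide_le) auto
    moreover have "c \<le> limsup (\<lambda>n. f n x / ereal (real n))"
      using elim(1) Liminf_le_Limsup[of sequentially "\<lambda>n. f n x / ereal (real n)"] by auto
    ultimately show ?case using elim(1) by (simp add: tendsto_iff_Liminf_eq_Limsup antisym)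
  qed
  then show ?thesis using \<open>c < \<infinity>\<close> that by auto
qed

end

section \<open>Max-plus products\<close>

text \<open>The products \<open>A(-1) \<cdots> A(-n)\<close> and the transposes of \<open>A(n-1) \<cdots> A(0)\<close> are both of this form.\<close>

primrec rprod :: "'d set \<Rightarrow> (nat \<Rightarrow> 'd rmat) \<Rightarrow> nat \<Rightarrow> 'd rmat" where
  "rprod I W 0 = mp_id"
| "rprod I W (Suc n) = mp_mult I (rprod I W n) (W n)"

definition rmax_seq :: "(nat \<Rightarrow> 'd rmat) \<Rightarrow> bool" where
  "rmax_seq W \<longleftrightarrow> (\<forall>n i j. W n i j \<noteq> \<infinity>)"

definition seq_drop :: "nat \<Rightarrow> (nat \<Rightarrow> 'a) \<Rightarrow> nat \<Rightarrow> 'a" where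
  "seq_drop m W = (\<lambda>n. W (m + n))"

text \<open>For ereals \<open>\<infinity> + -\<infinity> = \<infinity>\<close>, so -\<infinity>
  absorbs only arguments other than \<infinity>. This is why \<open>rmax_seq\<close> is carried
  through the lemmas on products.\<close>

lemma add_MInfty [simp]:
  fixes x :: ereal
  shows "x \<noteq> \<infinity> \<Longrightarrow> x + -\<infinity> = -\<infinity>" "x \<noteq> \<infinity> \<Longrightarrow> -\<infinity> + x = -\<infinity>"
  by (cases x; simp)+

lemma seq_drop_apply: "seq_drop m W n = W (m + n)"
  by (simp add: seq_drop_def)

lemma seq_drop_0 [simp]: "seq_drop 0 W = W"
  by (simp add: seq_drop_def)

lemma seq_drop_seq_drop [simp]: "seq_drop k (seq_drop m W) = seq_drop (m + k) W"
  by (simp add: seq_drop_def add.assoc)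

lemma rmax_seq_drop: "rmax_seq W \<Longrightarrow> rmax_seq (seq_drop m W)"
  by (simp add: rmax_seq_def seq_drop_apply)

lemma finite_SUP_attained:
  fixes f :: "'a \<Rightarrow> 'b::complete_linorder"
  assumes "finite I" "I \<noteq> {}"
  obtains k where "k \<in> I" "(SUP k\<in>I. f k) = f k"
  using assms by (metis (no_types, lifting) Max_Sup Max_in finite_imageI image_iff image_is_empty)

lemma finite_INF_attained:
  fixes f :: "'a \<Rightarrow> 'b::complete_linorder"
  assumes "finite I" "I \<noteq> {}"
  obtains k where "k \<in> I" "(INF k\<in>I. f k) = f k"
  using assms by (metis (no_types, lifting) Min_Inf Min_in finite_imageI image_iff image_is_empty)

lemma finite_SUP_not_infty:
  fixes f :: "'a \<Rightarrow> ereal"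
  assumes "finite I" "\<And>k. k \<in> I \<Longrightarrow> f k \<noteq> \<infinity>"
  shows "(SUP k\<in>I. f k) \<noteq> \<infinity>"
proof (cases "I = {}")
  case False
  then show ?thesis using assms finite_SUP_attained[OF assms(1) False, of f] by metis
qed (auto simp: bot_ereal_def)

lemma finite_SUP_add_right:
  fixes f :: "'a \<Rightarrow> ereal"
  assumes "finite I" "I \<noteq> {}"
  shows "(SUP k\<in>I. f k) + a = (SUP k\<in>I. f k + a)"
proof (rule antisym)
  obtain k where "k \<in> I" "(SUP k\<in>I. f k) = f k" using finite_SUP_attained[OF assms] .
  then show "(SUP k\<in>I. f k) + a \<le> (SUP k\<in>I. f k + a)" by (metis (mono_tags, lifting) SUP_upper)
  show "(SUP k\<in>I. f k + a) \<le> (SUP k\<in>I. f k) + a"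
    by (intro SUP_least add_right_mono SUP_upper)
qed

context
  fixes I :: "'d::finite set" and W :: "nat \<Rightarrow> 'd rmat"
  assumes W: "rmax_seq W"
begin

lemma rprod_not_infty: "rprod I W n i j \<noteq> \<infinity>"
proof (induction n arbitrary: j)
  case (Suc n)
  have "(SUP k\<in>I. rprod I W n i k + W n k j) \<noteq> \<infinity>"
    using Suc W by (intro finite_SUP_not_infty) (auto simp: rmax_seq_def)
  then show ?case by (simp add: mp_mult_def)
qed (simp add: mp_id_def)

text \<open>For \<open>i\<close> in \<open>I\<close>, \<open>rprod I W n i j\<close> is the largest
  weight of a path of \<open>n\<close> steps from \<open>i\<close> to \<open>j\<close> whose nodes
  before the end lie in \<open>I\<close>. Two such paths are glued at \<open>k\<close> here;
  \<open>rprod_subadditive\<close> cuts an optimal path at time \<open>m\<close>.\<close>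

lemma rprod_superadditive:
  assumes "k \<in> I"
  shows "rprod I W m i k + rprod I (seq_drop m W) n k j \<le> rprod I W (m + n) i j"
proof (induction n arbitrary: j)
  case 0 then show ?case using rprod_not_infty[of m i k] by (auto simp: mp_id_def)
next
  case (Suc n)
  obtain l where l: "l \<in> I" "rprod I (seq_drop m W) (Suc n) k j = rprod I (seq_drop m W) n k l + W (m + n) l j"
    using finite_SUP_attained[of I "\<lambda>l. rprod I (seq_drop m W) n k l + W (m + n) l j"] assms
    by (auto simp: mp_mult_def seq_drop_apply)
  have "rprod I W m i k + (rprod I (seq_drop m W) n k l + W (m + n) l j)
      \<le> rprod I W (m + n) i l + W (m + n) l j"
    unfolding add.assoc[symmetric] by (intro add_right_mono Suc)
  also have "\<dots> \<le> rprod I W (m + Suc n) i j"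
    using l by (auto simp: mp_mult_def intro: SUP_upper)
  finally show ?case unfolding l(2) .
qed

lemma rprod_subadditive:
  assumes "j \<in> I"
  shows "\<exists>k\<in>I. rprod I W (m + n) i j \<le> rprod I W m i k + rprod I (seq_drop m W) n k j"
  using assms
proof (induction n arbitrary: j)
  case 0 then show ?case by (auto simp: mp_id_def intro!: bexI[of _ j])
next
  case (Suc n)
  obtain l where l: "l \<in> I" "rprod I W (m + Suc n) i j = rprod I W (m + n) i l + W (m + n) l j"
    using finite_SUP_attained[of I "\<lambda>l. rprod I W (m + n) i l + W (m + n) l j"] Suc.prems
    by (auto simp: mp_mult_def)
  obtain k where k: "k \<in> I" "rprod I W (m + n) i l \<le> rprod I W m i k + rprod I (seq_drop m W) n k l"
    using Suc.IH[OF l(1)] by auto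
  have "rprod I W (m + Suc n) i j \<le> rprod I W m i k + rprod I (seq_drop m W) n k l + W (m + n) l j"
    unfolding l(2) by (intro add_right_mono k)
  also have "\<dots> \<le> rprod I W m i k + rprod I (seq_drop m W) (Suc n) k j"
    unfolding add.assoc using l by (intro add_left_mono) (auto simp: mp_mult_def seq_drop_apply intro: SUP_upper)
  finally show ?case using k(1) by blast
qed

lemma rprod_Suc_left:
  assumes "i \<in> I" "j \<in> I"
  shows "rprod I W (Suc n) i j = (SUP k\<in>I. W 0 i k + rprod I (seq_drop 1 W) n k j)"
proof -
  have one: "rprod I W 1 i k = W 0 i k" for k
  proof -
    have "rprod I W 1 i k = (SUP l\<in>I. mp_id i l + W 0 l k)" by (simp add: mp_mult_def)
    also have "\<dots> = W 0 i k"
    proof (rule antisym)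
      show "(SUP l\<in>I. mp_id i l + W 0 l k) \<le> W 0 i k"
        using W by (intro SUP_least) (auto simp: mp_id_def rmax_seq_def)
      show "W 0 i k \<le> (SUP l\<in>I. mp_id i l + W 0 l k)"
        using assms by (intro SUP_upper2[of i]) (auto simp: mp_id_def)
    qed
    finally show ?thesis .
  qed
  show ?thesis
  proof (rule antisym)
    show "rprod I W (Suc n) i j \<le> (SUP k\<in>I. W 0 i k + rprod I (seq_drop 1 W) n k j)"
      using rprod_subadditive[OF assms(2), of 1 n i] unfolding one by (auto intro: SUP_upper2)
    show "(SUP k\<in>I. W 0 i k + rprod I (seq_drop 1 W) n k j) \<le> rprod I W (Suc n) i j"
      using rprod_superadditive[of _ 1 i n j] unfolding one by (auto intro: SUP_least)
  qed
qed

end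

definition prod_max :: "'d set \<Rightarrow> (nat \<Rightarrow> 'd rmat) \<Rightarrow> nat \<Rightarrow> ereal" where
  "prod_max I W n = (SUP i\<in>I. SUP j\<in>I. rprod I W n i j)"

lemma rprod_le_prod_max: "i \<in> I \<Longrightarrow> j \<in> I \<Longrightarrow> rprod I W n i j \<le> prod_max I W n"
  unfolding prod_max_def by (intro SUP_upper2[of i] SUP_upper2[of j]) auto

lemma prod_max_subadditive:
  fixes W :: "nat \<Rightarrow> ('d::finite) rmat"
  assumes "rmax_seq W"
  shows "prod_max I W (m + n) \<le> prod_max I W m + prod_max I (seq_drop m W) n"
  unfolding prod_max_def[of I W "m + n"]
proof (intro SUP_least)
  fix i j assume ij: "i \<in> I" "j \<in> I"
  obtain k where "k \<in> I" "rprod I W (m + n) i j \<le> rprod I W m i k + rprod I (seq_drop m W) n k j"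
    using rprod_subadditive[OF assms ij(2)] by blast
  then show "rprod I W (m + n) i j \<le> prod_max I W m + prod_max I (seq_drop m W) n"
    using ij by (blast intro: order_trans add_mono rprod_le_prod_max)
qed

lemma prod_max_0: "prod_max I W 0 \<le> 0"
  by (auto simp: prod_max_def mp_id_def intro!: SUP_least)

lemma rprod_mono:
  assumes "I \<subseteq> J" shows "rprod I W n i j \<le> rprod J W n i j"
proof (induction n arbitrary: j)
  case (Suc n)
  then show ?case using assms unfolding rprod.simps mp_mult_def
    by (intro SUP_mono) (blast intro: add_right_mono)
qed simp

lemma mp_prod_eq_rprod: "mp_prod I A n i j = rprod I (\<lambda>k i j. A k j i) n j i"
  by (induction n arbitrary: i) (auto simp: mp_mult_def mp_id_def add.commute)

lemma mp_back_prod_eq_rprod: "mp_back_prod I A n = rprod I (\<lambda>k. A (- int k - 1)) n"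
proof (induction n)
  case (Suc n)
  have "- int (Suc n) = - int n - 1" by simp
  then show ?case unfolding mp_back_prod.simps rprod.simps Suc by (simp only:)
qed simp

lemma mp_prod_cong: "(\<And>k. k < n \<Longrightarrow> A k = B k) \<Longrightarrow> mp_prod I A n = mp_prod I B n"
  by (induction n) auto

lemma rprod_eq_mp_prod_rev:
  fixes W :: "nat \<Rightarrow> ('d::finite) rmat"
  assumes "rmax_seq W" "i \<in> I" "j \<in> I"
  shows "rprod I W n i j = mp_prod I (\<lambda>k. W (n - 1 - k)) n i j"
  using assms
proof (induction n arbitrary: W i)
  case (Suc n)
  have "rprod I W (Suc n) i j = (SUP k\<in>I. W 0 i k + rprod I (seq_drop 1 W) n k j)"
    by (rule rprod_Suc_left) fact+
  also have "\<dots> = (SUP k\<in>I. W 0 i k + mp_prod I (\<lambda>k. seq_drop 1 W (n - 1 - k)) n k j)"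
    using Suc.prems Suc.IH[OF rmax_seq_drop[OF Suc.prems(1), of 1]] by (intro SUP_cong refl) (metis (no_types))
  also have "mp_prod I (\<lambda>k. seq_drop 1 W (n - 1 - k)) n = mp_prod I (\<lambda>k. W (n - k)) n"
    by (rule mp_prod_cong) (auto simp: seq_drop_apply Suc_diff_Suc)
  also have "(SUP k\<in>I. W 0 i k + mp_prod I (\<lambda>k. W (n - k)) n k j) = mp_prod I (\<lambda>k. W (Suc n - 1 - k)) (Suc n) i j"
    by (simp add: mp_mult_def)
  finally show ?case .
qed simp

lemma mp_y_eq: "mp_y I A n \<omega> i = (SUP j\<in>I. rprod I (\<lambda>k. A (- int k - 1) \<omega>) n i j)"
  by (simp add: mp_y_def mp_vec_def mp_back_prod_eq_rprod)

lemma mp_x_eq: "mp_x I A n \<omega> i = (SUP j\<in>I. mp_prod I (\<lambda>k. A k \<omega>) n i j)"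
  by (simp add: mp_x_def mp_vec_def)

text \<open>No finite entry leaves \<open>R\<close>, so a path that starts in \<open>R\<close> never
  sees the other indices.\<close>

lemma rprod_closed:
  fixes W :: "nat \<Rightarrow> ('d::finite) rmat"
  assumes W: "rmax_seq W" and cl: "\<And>n i j. i \<in> R \<Longrightarrow> j \<notin> R \<Longrightarrow> W n i j = -\<infinity>" and i: "i \<in> R"
  shows "rprod UNIV W n i j \<le> (if j \<in> R then rprod R W n i j else -\<infinity>)"
proof (induction n arbitrary: j)
  case 0 then show ?case using i by (auto simp: mp_id_def)
next
  case (Suc n)
  have "rprod UNIV W n i k + W n k j \<le> (if j \<in> R then rprod R W (Suc n) i j else -\<infinity>)" for k
  proof -
    consider "k \<notin> R" | "k \<in> R" "j \<notin> R" | "k \<in> R" "j \<in> R" by blast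
    then show ?thesis
    proof cases
      case 1
      then have "rprod UNIV W n i k = -\<infinity>" using Suc[of k] by auto
      then show ?thesis using W by (auto simp: rmax_seq_def)
    next
      case 2
      then show ?thesis using cl[of k j n] rprod_not_infty[OF W, of UNIV n i k] by auto
    next
      case 3
      have "rprod UNIV W n i k + W n k j \<le> rprod R W n i k + W n k j"
        using Suc[of k] 3 by (auto intro: add_right_mono)
      also have "\<dots> \<le> rprod R W (Suc n) i j" using 3 by (auto simp: mp_mult_def intro: SUP_upper)
      finally show ?thesis using 3 by simp
    qed
  qed
  then have "(SUP k. rprod UNIV W n i k + W n k j) \<le> (if j \<in> R then rprod R W (Suc n) i j else -\<infinity>)"
    by (rule SUP_least)
  then show ?case by (simp add: mp_mult_def)
qed

text \<open>The counterpart of \<open>rprod_closed\<close> for left products; as these grow at the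
  row side, the induction varies the row index.\<close>

lemma mp_prod_closed:
  fixes A :: "nat \<Rightarrow> ('d::finite) rmat"
  assumes A: "rmax_seq A" and cl: "\<And>n i j. i \<in> R \<Longrightarrow> j \<notin> R \<Longrightarrow> A n i j = -\<infinity>" and i: "i \<in> R"
  shows "mp_prod UNIV A n i j \<le> (if j \<in> R then mp_prod R A n i j else -\<infinity>)"
  using i
proof (induction n arbitrary: i)
  case 0 then show ?case by (auto simp: mp_id_def)
next
  case (Suc n)
  have fin: "mp_prod I A n k j \<noteq> \<infinity>" for I k
    using A unfolding mp_prod_eq_rprod by (intro rprod_not_infty) (auto simp: rmax_seq_def)
  have "A n i k + mp_prod UNIV A n k j \<le> (if j \<in> R then mp_prod R A (Suc n) i j else -\<infinity>)" for k
  proof (cases "k \<in> R")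
    case False
    then show ?thesis using cl[OF Suc.prems False] fin by auto
  next
    case True
    show ?thesis
    proof (cases "j \<in> R")
      case False
      then have "mp_prod UNIV A n k j = -\<infinity>" using Suc.IH[OF True] by auto
      then show ?thesis using A by (auto simp: rmax_seq_def)
    next
      case j: True
      have "A n i k + mp_prod UNIV A n k j \<le> A n i k + mp_prod R A n k j"
        using Suc.IH[OF True] j by (auto intro: add_left_mono)
      also have "\<dots> \<le> mp_prod R A (Suc n) i j" using True by (auto simp: mp_mult_def intro: SUP_upper)
      finally show ?thesis using j by simp
    qed
  qed
  then have "(SUP k. A n i k + mp_prod UNIV A n k j) \<le> (if j \<in> R then mp_prod R A (Suc n) i j else -\<infinity>)"
    by (rule SUP_least)
  then show ?case by (simp add: mp_mult_def)
qed

section \<open>Block triangular products\<close>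

context
  fixes U1 U2 :: "'d::finite set" and W :: "nat \<Rightarrow> 'd rmat"
  assumes W: "rmax_seq W" and tri: "\<And>n i j. i \<in> U2 \<Longrightarrow> j \<in> U1 \<Longrightarrow> W n i j = -\<infinity>"
    and disj: "U1 \<inter> U2 = {}"
begin

lemma rprod_block_lower: "i \<in> U2 \<Longrightarrow> j \<in> U1 \<Longrightarrow> rprod (U1 \<union> U2) W n i j = -\<infinity>"
proof (induction n arbitrary: j)
  case 0 then show ?case using disj by (auto simp: mp_id_def)
next
  case (Suc n)
  have "rprod (U1 \<union> U2) W n i k + W n k j \<le> -\<infinity>" if "k \<in> U1 \<union> U2" for k
  proof (cases "k \<in> U1")
    case True then show ?thesis using Suc W by (auto simp: rmax_seq_def)
  next
    case False then show ?thesis using tri[of k j n] that Suc rprod_not_infty[OF W] by auto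
  qed
  then have "(SUP k\<in>U1 \<union> U2. rprod (U1 \<union> U2) W n i k + W n k j) \<le> -\<infinity>" by (rule SUP_least)
  then show ?case by (simp add: mp_mult_def)
qed

lemma rprod_block_diag1: "i \<in> U1 \<Longrightarrow> j \<in> U1 \<Longrightarrow> rprod (U1 \<union> U2) W n i j \<le> rprod U1 W n i j"
proof (induction n arbitrary: j)
  case (Suc n)
  have "rprod (U1 \<union> U2) W n i k + W n k j \<le> rprod U1 W (Suc n) i j" if "k \<in> U1 \<union> U2" for k
  proof (cases "k \<in> U1")
    case True
    then have "rprod (U1 \<union> U2) W n i k + W n k j \<le> rprod U1 W n i k + W n k j"
      using Suc by (intro add_right_mono) auto
    also have "\<dots> \<le> rprod U1 W (Suc n) i j" using True by (auto simp: mp_mult_def intro: SUP_upper)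
    finally show ?thesis .
  next
    case False then show ?thesis using tri[of k j n] that Suc rprod_not_infty[OF W] by auto
  qed
  then have "(SUP k\<in>U1 \<union> U2. rprod (U1 \<union> U2) W n i k + W n k j) \<le> rprod U1 W (Suc n) i j" by (rule SUP_least)
  then show ?case by (simp add: mp_mult_def)
qed simp

lemma rprod_block_diag2: "i \<in> U2 \<Longrightarrow> j \<in> U2 \<Longrightarrow> rprod (U1 \<union> U2) W n i j \<le> rprod U2 W n i j"
proof (induction n arbitrary: j)
  case (Suc n)
  have "rprod (U1 \<union> U2) W n i k + W n k j \<le> rprod U2 W (Suc n) i j" if "k \<in> U1 \<union> U2" for k
  proof (cases "k \<in> U2")
    case True
    then have "rprod (U1 \<union> U2) W n i k + W n k j \<le> rprod U2 W n i k + W n k j"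
      using Suc by (intro add_right_mono) auto
    also have "\<dots> \<le> rprod U2 W (Suc n) i j" using True by (auto simp: mp_mult_def intro: SUP_upper)
    finally show ?thesis .
  next
    case False then show ?thesis using rprod_block_lower[of i k n] that Suc W by (auto simp: rmax_seq_def)
  qed
  then have "(SUP k\<in>U1 \<union> U2. rprod (U1 \<union> U2) W n i k + W n k j) \<le> rprod U2 W (Suc n) i j" by (rule SUP_least)
  then show ?case by (simp add: mp_mult_def)
qed simp

text \<open>By the last step of an optimal path: it either is the crossing itself, or it prolongs
  the part inside \<open>U2\<close> of a path that crossed before. Nothing returns from
  \<open>U2\<close> to \<open>U1\<close>, so the diagonal blocks suffice before and after the
  crossing.\<close>

lemma rprod_block_cross:
  assumes "i \<in> U1" "j \<in> U2"
  shows "rprod (U1 \<union> U2) W n i j = -\<infinity> \<or> (\<exists>q<n. \<exists>l\<in>U1. \<exists>l'\<in>U2.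
    rprod (U1 \<union> U2) W n i j \<le> rprod U1 W q i l + W q l l' + rprod U2 (seq_drop (Suc q) W) (n - Suc q) l' j)"
  using assms(2)
proof (induction n arbitrary: j)
  case 0 then show ?case using assms disj by (auto simp: mp_id_def)
next
  case (Suc n)
  obtain k where k: "k \<in> U1 \<union> U2" "rprod (U1 \<union> U2) W (Suc n) i j = rprod (U1 \<union> U2) W n i k + W n k j"
    using finite_SUP_attained[of "U1 \<union> U2" "\<lambda>k. rprod (U1 \<union> U2) W n i k + W n k j"] assms
    by (auto simp: mp_mult_def)
  show ?case
  proof (cases "k \<in> U1")
    case True
    have "rprod (U1 \<union> U2) W (Suc n) i j \<le> rprod U1 W n i k + W n k j + rprod U2 (seq_drop (Suc n) W) (Suc n - Suc n) j j"
      unfolding k(2) using rprod_block_diag1[OF assms(1) True, of n] by (auto simp: mp_id_def intro: add_right_mono)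
    then show ?thesis using True Suc.prems by blast
  next
    case False
    then have k2: "k \<in> U2" using k by auto
    show ?thesis
    proof (cases "rprod (U1 \<union> U2) W n i k = -\<infinity>")
      case True
      then show ?thesis unfolding k(2) using W by (auto simp: rmax_seq_def)
    next
      case False
      then obtain q l l' where q: "q < n" "l \<in> U1" "l' \<in> U2"
        "rprod (U1 \<union> U2) W n i k \<le> rprod U1 W q i l + W q l l' + rprod U2 (seq_drop (Suc q) W) (n - Suc q) l' k"
        using Suc.IH[OF k2] by auto
      have "rprod (U1 \<union> U2) W (Suc n) i j \<le> rprod U1 W q i l + W q l l' + rprod U2 (seq_drop (Suc q) W) (n - Suc q) l' k + W n k j"
        unfolding k(2) by (intro add_right_mono q)
      also have "\<dots> = rprod U1 W q i l + W q l l' + (rprod U2 (seq_drop (Suc q) W) (n - Suc q) l' k + seq_drop (Suc q) W (n - Suc q) k j)"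
        using q(1) by (simp add: add.assoc seq_drop_apply)
      also have "\<dots> \<le> rprod U1 W q i l + W q l l' + rprod U2 (seq_drop (Suc q) W) (Suc (n - Suc q)) l' j"
        using k2 by (intro add_left_mono) (auto simp: mp_mult_def intro: SUP_upper)
      also have "Suc (n - Suc q) = Suc n - Suc q" using q(1) by auto
      finally show ?thesis using q by (metis less_SucI)
    qed
  qed
qed

end

text \<open>The constant \<open>C\<close> is chosen before \<open>m\<close>, and the error is
  measured at the end time \<open>m + n\<close>. A product split at an arbitrary intermediate time
  then has both factors controlled by the same constants, which a limit for each fixed start would
  not give.\<close>

definition growth_le :: "'d set \<Rightarrow> (nat \<Rightarrow> 'd rmat) \<Rightarrow> real \<Rightarrow> bool" where
  "growth_le U W \<beta> \<longleftrightarrow> (\<forall>\<epsilon>>0. \<exists>C\<ge>0. \<forall>m n. \<forall>i\<in>U. \<forall>j\<in>U.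
     rprod U (seq_drop m W) n i j \<le> ereal (\<beta> * real n + \<epsilon> * real (m + n) + C))"

lemma growth_le_empty [simp]: "growth_le {} W \<beta>"
  by (auto simp: growth_le_def)

text \<open>A crossing path consists of a product in \<open>U1\<close>, one entry and a product in
  \<open>U2\<close>. All three end no later than time \<open>m + n\<close>, so each may use a third
  of the allowed error.\<close>

lemma growth_le_Un:
  fixes W :: "nat \<Rightarrow> ('d::finite) rmat"
  assumes W: "rmax_seq W" and tri: "\<And>n i j. i \<in> U2 \<Longrightarrow> j \<in> U1 \<Longrightarrow> W n i j = -\<infinity>"
    and disj: "U1 \<inter> U2 = {}"
    and small: "\<And>\<epsilon>. 0 < \<epsilon> \<Longrightarrow> \<exists>C\<ge>0. \<forall>n i j. W n i j \<le> ereal (\<epsilon> * real n + C)"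
    and g1: "growth_le U1 W \<beta>" and g2: "growth_le U2 W \<beta>"
  shows "growth_le (U1 \<union> U2) W \<beta>"
  unfolding growth_le_def
proof (intro allI impI)
  fix \<epsilon> :: real assume "0 < \<epsilon>"
  define \<eta> where "\<eta> = \<epsilon> / 3"
  have \<eta>: "0 < \<eta>" "\<epsilon> = 3 * \<eta>" using \<open>0 < \<epsilon>\<close> by (auto simp: \<eta>_def)
  obtain C1 where C1: "0 \<le> C1" "\<And>m n i j. i \<in> U1 \<Longrightarrow> j \<in> U1 \<Longrightarrow>
     rprod U1 (seq_drop m W) n i j \<le> ereal (\<beta> * real n + \<eta> * real (m + n) + C1)"
    using g1 \<eta>(1) unfolding growth_le_def by meson
  obtain C2 where C2: "0 \<le> C2" "\<And>m n i j. i \<in> U2 \<Longrightarrow> j \<in> U2 \<Longrightarrow>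
     rprod U2 (seq_drop m W) n i j \<le> ereal (\<beta> * real n + \<eta> * real (m + n) + C2)"
    using g2 \<eta>(1) unfolding growth_le_def by meson
  obtain C3 where C3: "0 \<le> C3" "\<And>n i j. W n i j \<le> ereal (\<eta> * real n + C3)"
    using small[OF \<eta>(1)] by meson
  \<comment> \<open>The crossing uses one unit of time, so the block lengths add up to
    \<open>n - 1\<close>; \<open>\<bar>\<beta>\<bar>\<close> pays for the missing \<beta>.\<close>
  define C where "C = C1 + C2 + C3 + \<bar>\<beta>\<bar>"
  have bound: "rprod (U1 \<union> U2) (seq_drop m W) n i j \<le> ereal (\<beta> * real n + \<epsilon> * real (m + n) + C)"
    if ij: "i \<in> U1 \<union> U2" "j \<in> U1 \<union> U2" for m n i j
  proof -
    define N where "N = real (m + n)"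
    have W': "rmax_seq (seq_drop m W)" using W by (rule rmax_seq_drop)
    have tri': "\<And>n i j. i \<in> U2 \<Longrightarrow> j \<in> U1 \<Longrightarrow> seq_drop m W n i j = -\<infinity>" using tri by (simp add: seq_drop_apply)
    have N0: "0 \<le> \<eta> * N" using \<eta>(1) by (simp add: N_def)
    consider "i \<in> U1" "j \<in> U1" | "i \<in> U2" "j \<in> U2" | "i \<in> U2" "j \<in> U1" | "i \<in> U1" "j \<in> U2" using ij by auto
    then show ?thesis
    proof cases
      case 1
      have "\<beta> * real n + \<eta> * real (m + n) + C1 \<le> \<beta> * real n + \<epsilon> * real (m + n) + C"
        using N0 C2(1) C3(1) unfolding \<eta>(2) C_def N_def by simp
      then show ?thesis
        using rprod_block_diag1[OF W' tri' disj 1, of n] C1(2)[OF 1, of m n] by (meson ereal_less_eq(3) order_trans)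
    next
      case 2
      have "\<beta> * real n + \<eta> * real (m + n) + C2 \<le> \<beta> * real n + \<epsilon> * real (m + n) + C"
        using N0 C1(1) C3(1) unfolding \<eta>(2) C_def N_def by simp
      then show ?thesis
        using rprod_block_diag2[OF W' tri' disj 2, of n] C2(2)[OF 2, of m n] by (meson ereal_less_eq(3) order_trans)
    next
      case 3
      then show ?thesis using rprod_block_lower[OF W' tri' disj 3, of n] by simp
    next
      case 4
      show ?thesis
      proof (cases "rprod (U1 \<union> U2) (seq_drop m W) n i j = -\<infinity>")
        case False
        then obtain q l l' where q: "q < n" "l \<in> U1" "l' \<in> U2"
          and le: "rprod (U1 \<union> U2) (seq_drop m W) n i j \<le> rprod U1 (seq_drop m W) q i l + seq_drop m W q l l' + rprod U2 (seq_drop (Suc q) (seq_drop m W)) (n - Suc q) l' j"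
          using rprod_block_cross[OF W' tri' disj 4, of n] by blast
        note le
        also have "rprod U1 (seq_drop m W) q i l + seq_drop m W q l l' + rprod U2 (seq_drop (Suc q) (seq_drop m W)) (n - Suc q) l' j
          \<le> ereal (\<beta> * real q + \<eta> * real (m + q) + C1) + ereal (\<eta> * real (m + q) + C3)
            + ereal (\<beta> * real (n - Suc q) + \<eta> * real (m + Suc q + (n - Suc q)) + C2)"
          unfolding seq_drop_seq_drop using C3(2)[of "m + q" l l']
          by (intro add_mono C1 C2 4 q) (simp add: seq_drop_apply)
        also have "\<dots> \<le> ereal (\<beta> * real n + \<epsilon> * real (m + n) + C)"
        proof -
          have 1: "\<eta> * real (m + q) \<le> \<eta> * N" "m + Suc q + (n - Suc q) = m + n"
            using q(1) \<eta>(1) by (auto simp: N_def intro!: mult_left_mono)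
          have 2: "\<beta> * real q + \<beta> * real (n - Suc q) = \<beta> * real n - \<beta>"
            using q(1) by (simp add: of_nat_diff algebra_simps)
          show ?thesis unfolding 1(2) \<eta>(2) C_def using 1(1) 2 abs_ge_minus_self[of \<beta>] by (simp add: N_def)
        qed
        finally show ?thesis .
      qed simp
    qed
  qed
  show "\<exists>C\<ge>0. \<forall>m n. \<forall>i\<in>U1 \<union> U2. \<forall>j\<in>U1 \<union> U2.
     rprod (U1 \<union> U2) (seq_drop m W) n i j \<le> ereal (\<beta> * real n + \<epsilon> * real (m + n) + C)"
    using bound C1(1) C2(1) C3(1) by (intro exI[of _ C]) (auto simp: C_def)
qed

section \<open>Stationary sequences\<close>

abbreviation (input) seq_space :: "('i \<Rightarrow> 'a::topological_space) measure" where
  "seq_space \<equiv> Pi\<^sub>M UNIV (\<lambda>_. borel)"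

lemma space_seq_space [simp]: "space seq_space = UNIV"
  by (simp add: space_PiM)

lemma reindex_measurable:
  "(\<lambda>s n. s (h n)) \<in> (seq_space :: ('i \<Rightarrow> 'a::topological_space) measure) \<rightarrow>\<^sub>M (seq_space :: ('j \<Rightarrow> 'a) measure)"
  by (rule measurable_PiM_single') auto

lemma coordinate_measurable: "(\<lambda>s. s n) \<in> seq_space \<rightarrow>\<^sub>M borel"
  by (rule measurable_component_singleton) auto

abbreviation (input) shift :: "(nat \<Rightarrow> 'a) \<Rightarrow> nat \<Rightarrow> 'a" where
  "shift s \<equiv> \<lambda>n. s (n + 1)"

abbreviation (input) back_shift :: "(int \<Rightarrow> 'a) \<Rightarrow> int \<Rightarrow> 'a" where
  "back_shift s \<equiv> \<lambda>n. s (n - 1)"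

lemma funpow_shift: "((\<lambda>s. shift s) ^^ m) s = seq_drop m s"
  by (induction m arbitrary: s) (auto simp: seq_drop_apply fun_eq_iff)

lemma funpow_back_shift: "((\<lambda>s. back_shift s) ^^ m) s = (\<lambda>n. s (n - int m))"
  by (induction m arbitrary: s) (auto simp: fun_eq_iff algebra_simps)

text \<open>An invariant event of the two-sided process is independent of every cylinder set: it is
  unchanged by the averaging of the indicator of the cylinder set along the orbit, which by
  the ergodic theorem for the one-sided process becomes constant.  Hence it is independent of itself.\<close>

lemma ergodic_two_sided:
  fixes Q :: "(int \<Rightarrow> 'a::topological_space) measure"
  assumes "prob_space Q" and sets_Q: "sets Q = sets seq_space"
    and inv: "distr Q Q (\<lambda>s n. s (n + 1)) = Q"
    and erg: "ergodic_system (distr Q seq_space (\<lambda>s (n::nat). s (int n))) (\<lambda>s. shift s)"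
  shows "ergodic_system Q (\<lambda>s. back_shift s)"
proof -
  interpret Q: prob_space Q by fact
  have space_Q[simp]: "space Q = UNIV" using sets_eq_imp_space_eq[OF sets_Q] by simp
  define P where "P = distr Q seq_space (\<lambda>s (n::nat). s (int n))"
  have sets_P: "sets P = sets seq_space" by (simp add: P_def)
  interpret P: ergodic_system P "\<lambda>s. shift s" using erg by (simp add: P_def)
  have coordP: "(\<lambda>r. r n) \<in> borel_measurable P" for n
    by (subst measurable_cong_sets[OF sets_P refl]) (rule coordinate_measurable)
  have coordQ: "(\<lambda>r. r n) \<in> borel_measurable Q" for n
    by (subst measurable_cong_sets[OF sets_Q refl]) (rule coordinate_measurable)
  have reQ: "(\<lambda>s (n::'b). s (h n)) \<in> Q \<rightarrow>\<^sub>M seq_space" for h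
    by (subst measurable_cong_sets[OF sets_Q refl]) (rule reindex_measurable)
  have reQQ: "(\<lambda>s n. s (h n)) \<in> Q \<rightarrow>\<^sub>M Q" for h
    unfolding measurable_cong_sets[OF refl sets_Q] by (rule reQ)
  have inv_n: "distr Q Q (\<lambda>s n. s (n + int m)) = Q" for m
  proof (induction m)
    case 0 then show ?case by (simp add: distr_id)
  next
    case (Suc m)
    have "distr Q Q (\<lambda>s n. s (n + int (Suc m))) = distr (distr Q Q (\<lambda>s n. s (n + int m))) Q (\<lambda>s n. s (n + 1))"
      unfolding distr_distr[OF reQQ reQQ] by (simp add: o_def algebra_simps)
    then show ?case using Suc inv by simp
  qed
  show ?thesis
  proof
    show [measurable]: "(\<lambda>s. back_shift s) \<in> Q \<rightarrow>\<^sub>M Q" by (rule reQQ)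
    have "distr Q Q (\<lambda>s. back_shift s) = distr (distr Q Q (\<lambda>s n. s (n + 1))) Q (\<lambda>s. back_shift s)"
      using inv by simp
    also have "\<dots> = Q" unfolding distr_distr[OF reQQ reQQ] by (simp add: o_def distr_id)
    finally show "distr Q Q (\<lambda>s. back_shift s) = Q" .
  next
    fix S assume S: "S \<in> sets Q" and Sinv: "(\<lambda>s. back_shift s) -` S \<inter> space Q = S"
    have S1: "(\<lambda>n. s (n - 1)) \<in> S \<longleftrightarrow> s \<in> S" for s using Sinv by auto
    have Sm: "(\<lambda>n. s (n + int m)) \<in> S \<longleftrightarrow> s \<in> S" for s m
    proof (induction m)
      case (Suc m)
      have "(\<lambda>n. s (n + int (Suc m))) \<in> S \<longleftrightarrow> (\<lambda>n. (\<lambda>n. s (n + int (Suc m))) (n - 1)) \<in> S" by (rule S1[symmetric])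
      then show ?case using Suc by simp
    qed simp
    have indep: "Q.prob (S \<inter> Z) = Q.prob S * Q.prob Z"
      if J: "finite J" and E: "\<And>j. j \<in> J \<Longrightarrow> E j \<in> sets borel" and Z: "Z = {s. \<forall>j\<in>J. s j \<in> E j}" for J E Z
    proof -
      \<comment> \<open>A shift by \<open>k\<close> makes all coordinates of the cylinder
        nonnegative, so that it becomes an event \<open>D\<close> of the one-sided process.\<close>
      define k where "k = nat (\<Sum>j\<in>J. \<bar>j\<bar>)"
      have k: "0 \<le> j + int k" if "j \<in> J" for j
      proof -
        have "\<bar>j\<bar> \<le> (\<Sum>j\<in>J. \<bar>j\<bar>)" using J that by (intro member_le_sum) auto
        then show ?thesis unfolding k_def by linarith
      qed
      define D where "D = {r::nat \<Rightarrow> 'a. \<forall>j\<in>J. r (nat (j + int k)) \<in> E j}"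
      have "D = {r\<in>space P. \<forall>j\<in>J. r (nat (j + int k)) \<in> E j}"
        using sets_eq_imp_space_eq[OF sets_P] by (auto simp: D_def)
      also have "\<dots> \<in> sets P"
      proof (rule sets.sets_Collect_finite_All[OF _ J])
        fix j assume "j \<in> J"
        have "(\<lambda>r. r (nat (j + int k))) -` E j \<inter> space P \<in> sets P"
          by (rule measurable_sets[OF coordP E[OF \<open>j \<in> J\<close>]])
        then show "{r\<in>space P. r (nat (j + int k)) \<in> E j} \<in> sets P"
          by (simp add: vimage_def Int_def conj_commute)
      qed
      finally have D: "D \<in> sets P" .
      have "Z = {s\<in>space Q. \<forall>j\<in>J. s j \<in> E j}" by (auto simp: Z)
      also have "\<dots> \<in> sets Q"
      proof (rule sets.sets_Collect_finite_All[OF _ J])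
        fix j assume "j \<in> J"
        have "(\<lambda>r. r j) -` E j \<inter> space Q \<in> sets Q"
          by (rule measurable_sets[OF coordQ E[OF \<open>j \<in> J\<close>]])
        then show "{r\<in>space Q. r j \<in> E j} \<in> sets Q"
          by (simp add: vimage_def Int_def conj_commute)
      qed
      finally have Zm: "Z \<in> sets Q" .
      have DZ: "(\<lambda>n. s (int n + int i)) \<in> D \<longleftrightarrow> (\<lambda>n. s (n + int (i + k))) \<in> Z" for s i
        using k by (auto simp: D_def Z algebra_simps)
      have prob_inv: "Q.prob {s. (\<lambda>n. s (n + int m)) \<in> B} = Q.prob B" if "B \<in> sets Q" for B m
        using measure_distr[OF reQQ that, of "\<lambda>n. n + int m"] inv_n[of m] by (simp add: vimage_def)
      have pD: "P.prob D = Q.prob Z"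
      proof -
        have "P.prob D = Q.prob {s. (\<lambda>n. s (int n)) \<in> D}"
          unfolding P_def measure_distr[OF reQ D[unfolded sets_P]] by (simp add: vimage_def)
        also have "\<dots> = Q.prob {s. (\<lambda>n. s (n + int k)) \<in> Z}" using DZ[of _ 0] by simp
        also have "\<dots> = Q.prob Z" by (rule prob_inv[OF Zm])
        finally show ?thesis .
      qed
      \<comment> \<open>These are Birkhoff averages for \<open>P\<close>, read on the nonnegative
        coordinates; hence they tend to the constant \<open>P.prob D\<close>.\<close>
      define av where "av n s = (\<Sum>i<n. indicator D (\<lambda>n. s (int n + int i)) :: real) / real n" for n s
      have "integrable P (indicator D :: _ \<Rightarrow> real)" using D by (simp add: P.emeasure_eq_measure)
      from P.birkhoff[OF this, unfolded funpow_shift] have "AE r in P. (\<lambda>n. (\<Sum>i<n. indicator D (seq_drop i r) :: real) / real n) \<longlonglongrightarrow> P.prob D"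
        using D by (simp add: sets.Int_space_eq2)
      then have "AE s in Q. (\<lambda>n. (\<Sum>i<n. indicator D (seq_drop i (\<lambda>n. s (int n))) :: real) / real n) \<longlonglongrightarrow> P.prob D"
        unfolding P_def by (rule AE_distrD[OF reQ])
      then have lim: "AE s in Q. (\<lambda>n. av n s) \<longlonglongrightarrow> Q.prob Z"
        unfolding av_def pD seq_drop_def by (simp add: add.commute)
      have Dm: "(\<lambda>s. indicator D (\<lambda>n. s (int n + int i)) :: real) \<in> borel_measurable Q" for i
      proof -
        have "(\<lambda>s. (\<lambda>n. s (int n + int i))) \<in> Q \<rightarrow>\<^sub>M P" unfolding measurable_cong_sets[OF refl sets_P] by (rule reQ)
        from measurable_compose[OF this borel_measurable_indicator[OF D]] show ?thesis .
      qed
      have av_m: "av n \<in> borel_measurable Q" for n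
        unfolding av_def by (intro borel_measurable_divide borel_measurable_sum Dm borel_measurable_const)
      have av_le: "0 \<le> av n s" "av n s \<le> 1" for n s
      proof -
        show "0 \<le> av n s" by (auto simp: av_def intro!: divide_nonneg_nonneg sum_nonneg)
        have "(\<Sum>i<n. indicator D (\<lambda>n. s (int n + int i)) :: real) \<le> (\<Sum>i<n. 1)"
          by (intro sum_mono) (auto simp: indicator_def)
        then show "av n s \<le> 1" by (auto simp: av_def divide_le_eq)
      qed
      have "(\<lambda>n. \<integral>s. indicator S s * av n s \<partial>Q) \<longlonglongrightarrow> (\<integral>s. indicator S s * Q.prob Z \<partial>Q)"
      proof (rule integral_dominated_convergence[where w = "\<lambda>_. 1"])
        show "AE s in Q. (\<lambda>n. indicator S s * av n s) \<longlonglongrightarrow> indicator S s * Q.prob Z"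
          using lim by eventually_elim (intro tendsto_intros)
        show "(\<lambda>s. indicator S s * Q.prob Z) \<in> borel_measurable Q"
          by (intro borel_measurable_times borel_measurable_indicator S borel_measurable_const)
        show "(\<lambda>s. indicator S s * av n s) \<in> borel_measurable Q" for n
          by (intro borel_measurable_times borel_measurable_indicator S av_m)
      qed (use av_le in \<open>simp_all add: indicator_def\<close>)
      also have "(\<integral>s. indicator S s * Q.prob Z \<partial>Q) = Q.prob S * Q.prob Z"
        using S by (simp add: sets.Int_space_eq2)
      finally have L: "(\<lambda>n. \<integral>s. indicator S s * av n s \<partial>Q) \<longlonglongrightarrow> Q.prob S * Q.prob Z" .
      \<comment> \<open>Both \<open>S\<close> and the measure are shift invariant, so every term of
        the average contributes exactly \<open>Q.prob (S \<inter> Z)\<close>.\<close>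
      have eq: "(\<integral>s. indicator S s * av n s \<partial>Q) = Q.prob (S \<inter> Z)" if "n \<ge> 1" for n
      proof -
        have term1: "(\<integral>s. indicator S s * indicator D (\<lambda>n. s (int n + int i)) \<partial>Q) = Q.prob (S \<inter> Z)" for i
        proof -
          have "(indicator S s * indicator D (\<lambda>n. s (int n + int i)) :: real)
              = indicator {s. (\<lambda>n. s (n + int (i + k))) \<in> S \<inter> Z} s" for s
            using Sm[of s "i + k"] DZ[of s i] by (auto simp: indicator_def)
          then have "(\<integral>s. indicator S s * indicator D (\<lambda>n. s (int n + int i)) \<partial>Q)
              = Q.prob {s. (\<lambda>n. s (n + int (i + k))) \<in> S \<inter> Z}" by simp
          also have "\<dots> = Q.prob (S \<inter> Z)" by (rule prob_inv[OF sets.Int[OF S Zm]])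
          finally show ?thesis .
        qed
        have "(\<integral>s. indicator S s * av n s \<partial>Q) = (\<integral>s. (\<Sum>i<n. indicator S s * indicator D (\<lambda>n. s (int n + int i))) / real n \<partial>Q)"
          by (simp add: av_def sum_distrib_left)
        also have "\<dots> = (\<Sum>i<n. (\<integral>s. indicator S s * indicator D (\<lambda>n. s (int n + int i)) \<partial>Q)) / real n"
        proof -
          have "integrable Q (\<lambda>s. indicator S s * indicator D (\<lambda>n. s (int n + int i)) :: real)" for i
            by (intro Q.integrable_const_bound[where B = 1] borel_measurable_times borel_measurable_indicator S Dm)
              (simp add: indicator_def)
          then show ?thesis by (subst integral_divide_zero, subst Bochner_Integration.integral_sum) (blast | rule refl)+
        qed
        also have "\<dots> = Q.prob (S \<inter> Z)" using that by (simp add: term1)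
        finally show ?thesis .
      qed
      have "(\<lambda>n. \<integral>s. indicator S s * av n s \<partial>Q) \<longlonglongrightarrow> Q.prob (S \<inter> Z)"
        by (rule tendsto_eventually, rule eventually_mono[OF eventually_ge_at_top[of 1]], rule eq)
      then show ?thesis using L LIMSEQ_unique by blast
    qed
    show "Q.prob S = 0 \<or> Q.prob S = 1"
    proof (cases "Q.prob S = 0")
      case False
      then have S0: "emeasure Q S \<noteq> 0" "emeasure Q S \<noteq> \<infinity>" by (auto simp: Q.emeasure_eq_measure)
      interpret U: prob_space "uniform_measure Q S" by (rule prob_space_uniform_measure[OF S0])
      \<comment> \<open>Conditioning on \<open>S\<close> does not change cylinder probabilities, and
        these determine the measure; the conditional law gives \<open>S\<close> itself probability
        1.\<close>
      have "Q = uniform_measure Q S"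
      proof (rule measure_eqI_PiM_infinite)
        fix E and J :: "int set" assume J: "finite J" "J \<subseteq> UNIV" "\<And>i. i \<in> J \<Longrightarrow> E i \<in> sets (borel :: 'a measure)"
        define Z where "Z = prod_emb UNIV (\<lambda>_. borel :: 'a measure) J (Pi\<^sub>E J E)"
        have Z: "Z = {s. \<forall>j\<in>J. s j \<in> E j}"
          unfolding Z_def by (auto simp: prod_emb_def PiE_def Pi_def extensional_def restrict_def)
        have Zm: "Z \<in> sets Q" unfolding Z_def sets_Q using J by (intro sets_PiM_I) auto
        have "Q.prob Z = Q.prob (S \<inter> Z) / Q.prob S" using indep[OF J(1) J(3) Z] False by simp
        then have "measure Q Z = measure (uniform_measure Q S) Z"
          using S0 Zm by (subst measure_uniform_measure) auto
        then show "emeasure Q Z = emeasure (uniform_measure Q S) Z"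
          by (simp only: Q.emeasure_eq_measure U.emeasure_eq_measure)
      qed (auto simp: sets_Q Q.finite_measure_axioms)
      then have "emeasure Q S = emeasure (uniform_measure Q S) S" by simp
      also have "\<dots> = 1" using S0 by (intro emeasure_uniform_measure_1)
      finally show ?thesis by (simp add: Q.emeasure_eq_measure)
    qed simp
  qed
qed

section \<open>Growth rates of random products\<close>

text \<open>Common frame for the two time directions: the transposed sequence under the forward
  shift and the reversed sequence under the backward shift.\<close>

locale matrix_cocycle = ergodic_system M T for M :: "'a measure" and T +
  fixes W :: "'a \<Rightarrow> nat \<Rightarrow> ('d::finite) rmat" and g :: "'a \<Rightarrow> real"
  assumes W_shift: "W (T x) = seq_drop 1 (W x)"
    and W_measurable [measurable]: "\<And>n i j. (\<lambda>x. W x n i j) \<in> borel_measurable M"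
    and W_rmax: "AE x in M. rmax_seq (W x)"
    and W_le: "AE x in M. \<forall>i j. W x 0 i j \<le> ereal (g x)"
    and g_integrable: "integrable M g"
begin

lemma W_funpow: "W ((T ^^ m) x) = seq_drop m (W x)"
  by (induction m) (simp_all add: W_shift)

lemma rprod_measurable [measurable]: "(\<lambda>x. rprod I (W x) n i j) \<in> borel_measurable M"
  by (induction n arbitrary: j) (simp_all add: mp_mult_def)

lemma prod_max_measurable [measurable]: "(\<lambda>x. prod_max I (W x) n) \<in> borel_measurable M"
  unfolding prod_max_def by measurable

lemma prod_max_process: "subadditive_process M T (\<lambda>n x. prod_max I (W x) n) g"
proof
  show "AE x in M. prod_max I (W x) (m + n) \<le> prod_max I (W x) m + prod_max I (W ((T ^^ m) x)) n" for m n
    using W_rmax by eventually_elim (simp add: W_funpow prod_max_subadditive)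
  show "AE x in M. prod_max I (W x) 0 \<le> 0" by (simp add: prod_max_0)
  show "AE x in M. prod_max I (W x) 1 \<le> ereal (g x)"
    using W_rmax W_le
  proof eventually_elim
    case (elim x)
    have "mp_id i k + W x 0 k j \<le> ereal (g x)" for i j k
      using elim by (auto simp: mp_id_def rmax_seq_def)
    then show ?case by (auto simp: prod_max_def mp_mult_def intro!: SUP_least)
  qed
qed (use g_integrable in auto)

definition exponent :: "'d set \<Rightarrow> ereal" where
  "exponent I = (THE c. AE x in M. (\<lambda>n. prod_max I (W x) n / ereal (real n)) \<longlonglongrightarrow> c)"

lemma AE_limit_unique:
  assumes "AE x in M. f x \<longlonglongrightarrow> (c :: ereal)" "AE x in M. f x \<longlonglongrightarrow> d" shows "c = d"
proof -
  have "AE x in M. c = d" using assms by eventually_elim (rule LIMSEQ_unique)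
  then show ?thesis by simp
qed

lemma exponent_lim: "AE x in M. (\<lambda>n. prod_max I (W x) n / ereal (real n)) \<longlonglongrightarrow> exponent I"
  and exponent_less_infty: "exponent I < \<infinity>"
proof -
  interpret subadditive_process M T "\<lambda>n x. prod_max I (W x) n" g by (rule prod_max_process)
  obtain c where c: "c < \<infinity>" "AE x in M. (\<lambda>n. prod_max I (W x) n / ereal (real n)) \<longlonglongrightarrow> c"
    by (rule kingman)
  then have "exponent I = c"
    unfolding exponent_def by (intro the_equality) (auto intro: AE_limit_unique)
  then show "AE x in M. (\<lambda>n. prod_max I (W x) n / ereal (real n)) \<longlonglongrightarrow> exponent I" "exponent I < \<infinity>"
    using c by auto
qed

text \<open>\<open>kingman_uniform\<close> for the largest entry, over the countable family of
  errors \<open>1 / (k + 1)\<close>.\<close>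

lemma exponent_growth:
  assumes "exponent I < ereal \<beta>" shows "AE x in M. growth_le I (W x) \<beta>"
proof -
  interpret subadditive_process M T "\<lambda>n x. prod_max I (W x) n" g by (rule prod_max_process)
  have lim: "AE x in M. liminf (\<lambda>n. prod_max I (W x) n / ereal (real n)) = exponent I"
    using exponent_lim[of I] by eventually_elim (simp add: lim_imp_Liminf)
  have "AE x in M. \<forall>k. \<exists>C\<ge>0. \<forall>m n. m \<le> n \<longrightarrow>
      prod_max I (W ((T ^^ m) x)) (n - m) \<le> ereal (\<beta> * real (n - m) + (1 / real (Suc k)) * real n + C)"
    unfolding AE_all_countable by (intro allI kingman_uniform[OF lim assms]) simp
  then show ?thesis
  proof eventually_elim
    case (elim x)
    show ?case
      unfolding growth_le_def
    proof (intro allI impI)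
      fix \<epsilon> :: real assume "0 < \<epsilon>"
      then obtain k where k: "1 / real (Suc k) < \<epsilon>" using reals_Archimedean[of \<epsilon>] by (auto simp: inverse_eq_divide)
      obtain C where C: "0 \<le> C" "\<And>m n. m \<le> n \<Longrightarrow>
         prod_max I (W ((T ^^ m) x)) (n - m) \<le> ereal (\<beta> * real (n - m) + (1 / real (Suc k)) * real n + C)"
        using elim by blast
      have "rprod I (seq_drop m (W x)) n i j \<le> ereal (\<beta> * real n + \<epsilon> * real (m + n) + C)"
        if "i \<in> I" "j \<in> I" for m n i j
      proof -
        have "rprod I (seq_drop m (W x)) n i j \<le> prod_max I (W ((T ^^ m) x)) n"
          unfolding W_funpow using that by (rule rprod_le_prod_max)
        also have "\<dots> \<le> ereal (\<beta> * real n + (1 / real (Suc k)) * real (m + n) + C)"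
          using C(2)[of m "m + n"] by simp
        also have "\<dots> \<le> ereal (\<beta> * real n + \<epsilon> * real (m + n) + C)"
          using mult_right_mono[of "1 / real (Suc k)" \<epsilon> "real (m + n)"] k by simp
        finally show ?thesis .
      qed
      then show "\<exists>C\<ge>0. \<forall>m n. \<forall>i\<in>I. \<forall>j\<in>I. rprod I (seq_drop m (W x)) n i j \<le> ereal (\<beta> * real n + \<epsilon> * real (m + n) + C)"
        using C(1) by blast
    qed
  qed
qed

text \<open>The entry at time \<open>n\<close> is the entry at time 0 seen from the
  \<open>n\<close>-th orbit point, so \<open>orbit_sublinear\<close> for \<open>g\<close> applies.
  This controls the crossing entry in \<open>growth_le_Un\<close>.\<close>

lemma entries_sublinear:
  "AE x in M. \<forall>\<epsilon>>0. \<exists>C\<ge>0. \<forall>n i j. W x n i j \<le> ereal (\<epsilon> * real n + C)"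
proof -
  have "AE x in M. \<forall>k. \<exists>C\<ge>0. \<forall>n. g ((T ^^ n) x) \<le> (1 / real (Suc k)) * real n + C"
    unfolding AE_all_countable by (intro allI orbit_sublinear g_integrable) simp
  then show ?thesis using AE_orbit[OF W_le]
  proof eventually_elim
    case (elim x)
    show ?case
    proof (intro allI impI)
      fix \<epsilon> :: real assume "0 < \<epsilon>"
      then obtain k where k: "1 / real (Suc k) < \<epsilon>" using reals_Archimedean[of \<epsilon>] by (auto simp: inverse_eq_divide)
      obtain C where C: "0 \<le> C" "\<And>n. g ((T ^^ n) x) \<le> (1 / real (Suc k)) * real n + C"
        using elim(1) by blast
      have "W x n i j \<le> ereal (\<epsilon> * real n + C)" for n i j
      proof -
        have "W x n i j = W ((T ^^ n) x) 0 i j" by (simp add: W_funpow seq_drop_apply)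
        also have "\<dots> \<le> ereal (g ((T ^^ n) x))" using elim(2) by blast
        also have "\<dots> \<le> ereal (\<epsilon> * real n + C)"
          using C(2)[of n] mult_right_mono[of "1 / real (Suc k)" \<epsilon> "real n"] k by simp
        finally show ?thesis .
      qed
      then show "\<exists>C\<ge>0. \<forall>n i j. W x n i j \<le> ereal (\<epsilon> * real n + C)" using C(1) by blast
    qed
  qed
qed

text \<open>The triangular structure is encoded by a rank function: an entry from one block to another
  can only be finite if the rank drops.\<close>

lemma growth_blocks:
  fixes rank :: "'d set \<Rightarrow> nat"
  assumes "finite C" and "pairwise disjnt C"
    and tri: "\<And>c c'. c \<in> C \<Longrightarrow> c' \<in> C \<Longrightarrow> c \<noteq> c' \<Longrightarrow> rank c \<le> rank c' \<Longrightarrow>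
           AE x in M. \<forall>n. \<forall>i\<in>c. \<forall>j\<in>c'. W x n i j = -\<infinity>"
    and exps: "\<And>c. c \<in> C \<Longrightarrow> exponent c < ereal \<beta>"
  shows "AE x in M. growth_le (\<Union>C) (W x) \<beta>"
  using assms
proof (induction "card C" arbitrary: C)
  case 0
  then show ?case by simp
next
  case (Suc n)
  have "C \<noteq> {}" using Suc by auto
  \<comment> \<open>No finite entry leads from a block of minimal rank to another block, so it
    serves as the lower block \<open>U2\<close>.\<close>
  then obtain c where c: "c \<in> C" "\<And>c'. c' \<in> C \<Longrightarrow> rank c \<le> rank c'"
    using ex_min_if_finite[of "rank ` C"] Suc.prems(1) by (metis (mono_tags, lifting) arg_min_if_finite(1) arg_min_least)
  have "AE x in M. growth_le (\<Union>(C - {c})) (W x) \<beta>"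
    using Suc c by (intro Suc.hyps) (auto intro: pairwise_subset)
  moreover have "AE x in M. \<forall>c'\<in>C - {c}. \<forall>n. \<forall>i\<in>c. \<forall>j\<in>c'. W x n i j = -\<infinity>"
    using Suc.prems(1) c Suc.prems(3) by (intro AE_finite_allI) auto
  moreover have "AE x in M. growth_le c (W x) \<beta>" using exponent_growth Suc.prems(4) c(1) by blast
  ultimately show ?case using W_rmax entries_sublinear
  proof eventually_elim
    case (elim x)
    have "growth_le (\<Union>(C - {c}) \<union> c) (W x) \<beta>"
    proof (rule growth_le_Un)
      show "\<Union>(C - {c}) \<inter> c = {}" using Suc.prems(2) c(1) by (auto simp: pairwise_def disjnt_def)
    qed (use elim in auto)
    moreover have "\<Union>(C - {c}) \<union> c = \<Union>C" using c(1) by auto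
    ultimately show ?case by simp
  qed
qed

lemma AE_growth_limsup:
  assumes "\<And>q::rat. \<gamma> < ereal (of_rat q) \<Longrightarrow> AE x in M. growth_le U (W x) (of_rat q)"
  shows "AE x in M. \<forall>i\<in>U. limsup (\<lambda>n. (SUP j\<in>U. rprod U (W x) n i j) / ereal (real n)) \<le> \<gamma>
                         \<and> limsup (\<lambda>n. (SUP j\<in>U. rprod U (W x) n j i) / ereal (real n)) \<le> \<gamma>"
proof -
  have "AE x in M. \<gamma> < ereal (of_rat q) \<longrightarrow> growth_le U (W x) (of_rat q)" for q :: rat
    using assms[of q] by (cases "\<gamma> < ereal (of_rat q)") auto
  then have "AE x in M. \<forall>q::rat. \<gamma> < ereal (of_rat q) \<longrightarrow> growth_le U (W x) (of_rat q)"
    by (simp add: AE_all_countable)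
  then show ?thesis
  proof eventually_elim
    case (elim x)
    have "\<exists>C. \<forall>n. \<forall>i\<in>U. \<forall>j\<in>U. rprod U (W x) n i j \<le> ereal (of_rat q * real n + C)"
      if q: "\<gamma> < ereal (of_rat q)" for q
    proof -
      obtain p where p: "\<gamma> < ereal (of_rat p)" "p < q"
        using ereal_dense3[OF q] by (auto simp: of_rat_less)
      \<comment> \<open>The surplus slope \<open>d\<close> pays for the error term of
        \<open>growth_le\<close> at \<open>m = 0\<close>.\<close>
      define d where "d = (of_rat q - of_rat p :: real)"
      have d: "0 < d" using p(2) by (simp add: d_def of_rat_less)
      have "growth_le U (W x) (of_rat p)" using elim p(1) by blast
      then obtain C where "\<forall>m n. \<forall>i\<in>U. \<forall>j\<in>U.
         rprod U (seq_drop m (W x)) n i j \<le> ereal (of_rat p * real n + d * real (m + n) + C)"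
        unfolding growth_le_def using d by blast
      from spec[OF this, of 0] have "\<forall>n. \<forall>i\<in>U. \<forall>j\<in>U. rprod U (W x) n i j \<le> ereal (of_rat q * real n + C)"
        by (simp add: d_def algebra_simps)
      then show ?thesis by blast
    qed
    then show ?case
      by (intro ballI conjI limsup_divide_le) (meson SUP_least)+
  qed
qed

end

lemma prob_less_tendsto:
  fixes X :: "nat \<Rightarrow> 'a \<Rightarrow> ereal"
  assumes "prob_space M" and [measurable]: "\<And>n. X n \<in> borel_measurable M"
    and X: "AE x in M. (\<lambda>n. X n x) \<longlonglongrightarrow> c" and "c \<noteq> r"
  shows "(\<lambda>n. measure M {x\<in>space M. X n x < r}) \<longlonglongrightarrow> (if c < r then 1 else 0)"
proof -
  interpret prob_space M by fact
  have "(\<lambda>n. \<integral>x. indicator {x\<in>space M. X n x < r} x \<partial>M) \<longlonglongrightarrow> (\<integral>x. (if c < r then 1 else 0 :: real) \<partial>M)"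
  proof (rule integral_dominated_convergence[where w = "\<lambda>_. 1"])
    show "AE x in M. (\<lambda>n. indicator {x\<in>space M. X n x < r} x :: real) \<longlonglongrightarrow> (if c < r then 1 else 0)"
      using X AE_space
    proof eventually_elim
      case (elim x)
      show ?case
      proof (rule tendsto_eventually)
        show "eventually (\<lambda>n. indicator {x\<in>space M. X n x < r} x = (if c < r then 1 else 0 :: real)) sequentially"
        proof (cases "c < r")
          case True
          then show ?thesis using order_tendstoD(2)[OF elim(1) True] elim(2) by (auto elim: eventually_mono)
        next
          case False
          then have "r < c" using \<open>c \<noteq> r\<close> by auto
          then show ?thesis using order_tendstoD(1)[OF elim(1), of r] False by (auto elim!: eventually_mono simp: indicator_def)
        qed
      qed
    qed
  qed (auto simp: indicator_def)
  then show ?thesis by (simp add: prob_space)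
qed

text \<open>Only the law of each single \<open>X n\<close> enters, not the joint law: for
  \<open>r\<close> strictly between two different constants the probability of
  \<open>X n < r\<close> would tend to both 0 and 1. This is how limits pass between forward and
  backward products.\<close>

lemma AE_limits_eq_of_law:
  fixes X :: "nat \<Rightarrow> 'a \<Rightarrow> ereal" and Y :: "nat \<Rightarrow> 'b \<Rightarrow> ereal"
  assumes "prob_space M" "prob_space N"
    and [measurable]: "\<And>n. X n \<in> borel_measurable M" "\<And>n. Y n \<in> borel_measurable N"
    and law: "\<And>n. distr M borel (X n) = distr N borel (Y n)"
    and X: "AE x in M. (\<lambda>n. X n x) \<longlonglongrightarrow> c" and Y: "AE x in N. (\<lambda>n. Y n x) \<longlonglongrightarrow> d"
  shows "c = d"
proof -
  have eq: "measure M {x\<in>space M. X n x < r} = measure N {x\<in>space N. Y n x < r}" for n r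
  proof -
    have "measure (distr M borel (X n)) {..<r} = measure (distr N borel (Y n)) {..<r}" by (simp add: law)
    then show ?thesis by (simp add: measure_distr vimage_def Int_def conj_commute)
  qed
  have False if r: "c < r \<and> r < d \<or> d < r \<and> r < c" for r
  proof -
    have "(\<lambda>n. measure M {x\<in>space M. X n x < r}) \<longlonglongrightarrow> (if c < r then 1 else 0)"
      using r by (intro prob_less_tendsto X assms) auto
    moreover have "(\<lambda>n. measure M {x\<in>space M. X n x < r}) \<longlonglongrightarrow> (if d < r then 1 else 0)"
      unfolding eq using r by (intro prob_less_tendsto Y assms) auto
    ultimately have "(if c < r then 1 else 0 :: real) = (if d < r then 1 else 0)" by (rule LIMSEQ_unique)
    then show False using r by (auto split: if_splits)
  qed
  then show ?thesis using dense[of c d] dense[of d c] by (metis linorder_neqE)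
qed

lemma entry_measurable: "(\<lambda>s. s n i j) \<in> borel_measurable (seq_space :: ('i \<Rightarrow> ('d::finite) rmat) measure)"
proof -
  have "(\<lambda>r. r i) \<in> borel_measurable (borel :: ('a \<Rightarrow> 'b::topological_space) measure)" for i
    by (intro borel_measurable_continuous_onI continuous_on_product_coordinates)
  from measurable_compose[OF measurable_compose[OF coordinate_measurable this] this]
  show ?thesis .
qed

definition entry_bound :: "('d::finite) rmat \<Rightarrow> real" where
  "entry_bound r = real_of_ereal (SUP i. SUP j. max (r i j) 0)"

lemma entry_le_bound:
  assumes "\<And>i j. r i j \<noteq> \<infinity>" shows "r i j \<le> ereal (entry_bound r)"
proof -
  let ?s = "SUP i. SUP j. max (r i j) 0"
  have "?s \<noteq> \<infinity>" using assms by (intro finite_SUP_not_infty) (auto simp: max_def)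
  moreover have le: "max (r i j) 0 \<le> ?s" by (intro SUP_upper2[of i] SUP_upper2[of j]) auto
  ultimately have "ereal (entry_bound r) = ?s" unfolding entry_bound_def
    by (cases ?s) auto
  then show ?thesis using le by simp
qed

section \<open>The forward and backward processes on path space\<close>

locale matrix_process =
  fixes M :: "'w measure" and A :: "nat \<Rightarrow> 'w \<Rightarrow> ('d::finite) rmat"
    and M' :: "'v measure" and A' :: "int \<Rightarrow> 'v \<Rightarrow> 'd rmat"
  assumes prob_M: "prob_space M"
    and rmax_A: "rmax_valued M A" and stat_A: "stationary M A" and erg_A: "ergodic M A"
    and int_A: "integrable M (\<lambda>\<omega>. entry_bound (A 0 \<omega>))"
    and ext: "two_sided_extension M A M' A'"
begin

text \<open>No transformation is given on \<open>M\<close> or \<open>M'\<close>; the shifts act on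
  paths. The limit theorems are therefore proved for the laws \<open>P\<close> and \<open>P'\<close>
  and then pulled back.\<close>

definition "P = path_law M A"
definition "P' = path_law M' A'"

lemma sets_P: "sets P = sets seq_space" and sets_P': "sets P' = sets seq_space"
  by (simp_all add: P_def P'_def path_law_def)

lemma space_P [simp]: "space P = UNIV" and space_P' [simp]: "space P' = UNIV"
  using sets_eq_imp_space_eq[OF sets_P] sets_eq_imp_space_eq[OF sets_P'] by simp_all

lemma prob_M': "prob_space M'" and rmax_A': "rmax_valued M' A'" and stat_A': "stationary M' A'"
  and law_A': "path_law M' (\<lambda>n. A' (int n)) = P"
  using ext by (auto simp: two_sided_extension_def P_def)

lemma path_measurable: "(\<lambda>\<omega> n. A n \<omega>) \<in> M \<rightarrow>\<^sub>M seq_space" and path_measurable': "(\<lambda>\<omega> n. A' n \<omega>) \<in> M' \<rightarrow>\<^sub>M seq_space"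
  using stat_A stat_A' by (auto simp: stationary_def intro!: measurable_PiM_single')

lemma reindex_P: "(\<lambda>s n. s (h n)) \<in> P \<rightarrow>\<^sub>M seq_space" and reindex_P': "(\<lambda>s n. s (h' n)) \<in> P' \<rightarrow>\<^sub>M seq_space"
  by (subst measurable_cong_sets[OF sets_P refl] measurable_cong_sets[OF sets_P' refl], rule reindex_measurable)+

lemma entry_P [measurable]: "(\<lambda>s. s n i j) \<in> borel_measurable P" and entry_P' [measurable]: "(\<lambda>s. s m i j) \<in> borel_measurable P'"
  by (subst measurable_cong_sets[OF sets_P refl] measurable_cong_sets[OF sets_P' refl], rule entry_measurable)+

lemma entry_A [measurable]: "(\<lambda>\<omega>. A n \<omega> i j) \<in> borel_measurable M" and entry_A' [measurable]: "(\<lambda>\<omega>. A' m \<omega> i j) \<in> borel_measurable M'"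
  using measurable_compose[OF path_measurable entry_measurable] measurable_compose[OF path_measurable' entry_measurable] by auto

lemma AE_PD: "AE s in P. Q s \<Longrightarrow> AE \<omega> in M. Q (\<lambda>n. A n \<omega>)"
  unfolding P_def path_law_def by (rule AE_distrD[OF path_measurable])

lemma AE_P'D: "AE s in P'. Q s \<Longrightarrow> AE \<omega> in M'. Q (\<lambda>n. A' n \<omega>)"
  unfolding P'_def path_law_def by (rule AE_distrD[OF path_measurable'])

text \<open>Passing from the process to its law requires that the event be measurable in path space,
  unlike the opposite direction \<open>AE_PD\<close>.\<close>

lemma AE_PI: "{s\<in>space P. Q s} \<in> sets P \<Longrightarrow> AE \<omega> in M. Q (\<lambda>n. A n \<omega>) \<Longrightarrow> AE s in P. Q s"
  unfolding P_def path_law_def by (subst AE_distr_iff[OF path_measurable]) simp_all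

lemma AE_P'I: "{s\<in>space P'. Q s} \<in> sets P' \<Longrightarrow> AE \<omega> in M'. Q (\<lambda>n. A' n \<omega>) \<Longrightarrow> AE s in P'. Q s"
  unfolding P'_def path_law_def by (subst AE_distr_iff[OF path_measurable']) simp_all

lemma P'_inv: "distr P' P' (\<lambda>s n. s (n + 1)) = P'"
proof -
  have "distr P' P' (\<lambda>s n. s (n + 1)) = distr P' seq_space (\<lambda>s n. s (n + 1))"
    by (rule distr_cong) (auto simp: sets_P')
  also have "\<dots> = path_law M' (\<lambda>n. A' (n + 1))"
    unfolding P'_def path_law_def by (subst distr_distr[OF reindex_measurable path_measurable']) (simp add: o_def)
  also have "\<dots> = P'" using stat_A' by (simp add: stationary_def P'_def)
  finally show ?thesis .
qed

lemma P_restrict: "distr P' seq_space (\<lambda>s (n::nat). s (int n)) = P"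
  unfolding law_A'[symmetric] unfolding P'_def path_law_def
  by (subst distr_distr[OF reindex_measurable path_measurable']) (simp add: o_def)

sublocale P: ergodic_system P "\<lambda>s. shift s"
proof -
  interpret prob_space P unfolding P_def path_law_def
    by (rule prob_space.prob_space_distr[OF prob_M path_measurable])
  show "ergodic_system P (\<lambda>s. shift s)"
  proof
    show "(\<lambda>s. shift s) \<in> P \<rightarrow>\<^sub>M P" unfolding measurable_cong_sets[OF refl sets_P] by (rule reindex_P)
    have "distr P P (\<lambda>s. shift s) = distr P seq_space (\<lambda>s. shift s)"
      by (rule distr_cong) (auto simp: sets_P)
    also have "\<dots> = path_law M (\<lambda>n. A (n + 1))"
      unfolding P_def path_law_def by (subst distr_distr[OF reindex_measurable path_measurable]) (simp add: o_def)
    also have "\<dots> = P" using stat_A by (simp add: stationary_def P_def)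
    finally show "distr P P (\<lambda>s. shift s) = P" .
    fix S assume S: "S \<in> sets P" "(\<lambda>s. shift s) -` S \<inter> space P = S"
    then show "prob S = 0 \<or> prob S = 1"
      using erg_A unfolding ergodic_def P_def[symmetric] sets_P by (simp add: vimage_def)
  qed
qed

sublocale P': ergodic_system P' "\<lambda>s. back_shift s"
proof (rule ergodic_two_sided)
  show "prob_space P'" unfolding P'_def path_law_def
    by (rule prob_space.prob_space_distr[OF prob_M' path_measurable'])
  show "ergodic_system (distr P' seq_space (\<lambda>s (n::nat). s (int n))) (\<lambda>s. shift s)"
    unfolding P_restrict by (rule P.ergodic_system_axioms)
qed (simp_all add: sets_P' P'_inv)

declare P.T_measurable [measurable del] P.funpow_measurable [measurable del]
  P'.T_measurable [measurable del] P'.funpow_measurable [measurable del]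

text \<open>By shift invariance the window that starts at time \<open>-k\<close> has the same law
  for all \<open>k\<close>. With \<open>k = 1\<close> it begins at time -1; with
  \<open>k = n\<close> it contains all factors of the backward product of length
  \<open>n\<close>.\<close>

lemma P_restrict_back: "distr P' seq_space (\<lambda>s (n::nat). s (int n - int k)) = P"
proof -
  have m: "(\<lambda>s n. s (n - int k)) \<in> P' \<rightarrow>\<^sub>M P'" unfolding measurable_cong_sets[OF refl sets_P'] by (rule reindex_P')
  have "P' = distr P' P' (\<lambda>s n. s (n - int k))"
    using P'.funpow_distr[of k, unfolded funpow_back_shift[abs_def]] by simp
  then have "distr P' seq_space (\<lambda>s (n::nat). s (int n)) = distr (distr P' P' (\<lambda>s n. s (n - int k))) seq_space (\<lambda>s (n::nat). s (int n))"
    by simp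
  also have "\<dots> = distr P' seq_space (\<lambda>s (n::nat). s (int n - int k))"
    by (subst distr_distr[OF reindex_P' m]) (simp add: o_def)
  finally show ?thesis by (simp add: P_restrict)
qed

lemma AE_P_back: "AE s in P. Q s \<Longrightarrow> AE s in P'. Q (\<lambda>n. s (int n - int k))"
  by (rule AE_distrD[OF reindex_P'[where h' = "\<lambda>n. int n - int k"]]) (simp only: P_restrict_back)

lemma rmax_P: "AE s in P. rmax_seq s"
proof (rule AE_PI)
  have "AE \<omega> in M. \<forall>n i j. A n \<omega> i j \<noteq> \<infinity>"
    using rmax_A AE_space by (auto simp: rmax_valued_def)
  then show "AE \<omega> in M. rmax_seq (\<lambda>n. A n \<omega>)" by (simp add: rmax_seq_def)
  show "{s \<in> space P. rmax_seq s} \<in> sets P" unfolding rmax_seq_def by measurable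
qed

lemma rmax_P': "AE s in P'. \<forall>n i j. s n i j \<noteq> \<infinity>"
proof (rule AE_P'I)
  show "AE \<omega> in M'. \<forall>n i j. A' n \<omega> i j \<noteq> \<infinity>"
    using rmax_A' AE_space by (auto simp: rmax_valued_def)
  show "{s \<in> space P'. \<forall>n i j. s n i j \<noteq> \<infinity>} \<in> sets P'" by measurable
qed

lemma entry_bound_measurable: "(\<lambda>s. entry_bound (s 0)) \<in> borel_measurable P"
  unfolding entry_bound_def by measurable

lemma entry_bound_integrable_P: "integrable P (\<lambda>s. entry_bound (s 0))"
  unfolding P_def path_law_def
  using int_A by (subst integrable_distr_eq[OF path_measurable entry_bound_measurable[unfolded measurable_cong_sets[OF sets_P refl]]])

lemma entry_bound_integrable_P': "integrable P' (\<lambda>s. entry_bound (s (- 1)))"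
  using entry_bound_integrable_P integrable_distr_eq[OF reindex_P'[where h' = "\<lambda>n. int n - int 1"] entry_bound_measurable[unfolded measurable_cong_sets[OF sets_P refl]]]
  unfolding P_restrict_back by simp

text \<open>Transposition turns a factor added on the left of the forward product into one added on
  the right. As a consequence \<open>x\<close> is a column maximum of an \<open>rprod\<close>, while
  \<open>y\<close> is a row maximum. Index \<open>n\<close> of \<open>bw\<close> stands for time
  \<open>-n - 1\<close>.\<close>

definition fw :: "(nat \<Rightarrow> 'd rmat) \<Rightarrow> nat \<Rightarrow> 'd rmat" where "fw s = (\<lambda>n i j. s n j i)"
definition bw :: "(int \<Rightarrow> 'd rmat) \<Rightarrow> nat \<Rightarrow> 'd rmat" where "bw s = (\<lambda>n. s (- int n - 1))"

sublocale F: matrix_cocycle P "\<lambda>s. shift s" fw "\<lambda>s. entry_bound (s 0)"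
proof
  show "fw (shift s) = seq_drop 1 (fw s)" for s by (simp add: fw_def seq_drop_def)
  show "(\<lambda>s. fw s n i j) \<in> borel_measurable P" for n i j unfolding fw_def by (rule entry_P)
  show "AE s in P. rmax_seq (fw s)" using rmax_P by eventually_elim (simp add: rmax_seq_def fw_def)
  show "AE s in P. \<forall>i j. fw s 0 i j \<le> ereal (entry_bound (s 0))"
    using rmax_P by eventually_elim (auto simp: rmax_seq_def fw_def intro!: entry_le_bound)
qed (rule entry_bound_integrable_P)

sublocale B: matrix_cocycle P' "\<lambda>s. back_shift s" bw "\<lambda>s. entry_bound (s (- 1))"
proof
  show "bw (back_shift s) = seq_drop 1 (bw s)" for s by (simp add: bw_def seq_drop_def)
  show "(\<lambda>s. bw s n i j) \<in> borel_measurable P'" for n i j unfolding bw_def by (rule entry_P')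
  show "AE s in P'. rmax_seq (bw s)" using rmax_P' by eventually_elim (simp add: rmax_seq_def bw_def)
  show "AE s in P'. \<forall>i j. bw s 0 i j \<le> ereal (entry_bound (s (- 1)))"
    using rmax_P' by eventually_elim (auto simp: rmax_seq_def bw_def intro!: entry_le_bound)
qed (rule entry_bound_integrable_P')

lemma mp_prod_fw: "mp_prod I s n i j = rprod I (fw s) n j i"
  by (simp add: mp_prod_eq_rprod fw_def)

lemma lyap_eq: "lyap M A I = F.exponent I"
proof -
  interpret M: prob_space M by (rule prob_M)
  have eq: "(SUP i\<in>I. SUP j\<in>I. mp_prod I (\<lambda>k. A k \<omega>) n i j) = prod_max I (fw (\<lambda>k. A k \<omega>)) n" for n \<omega>
    unfolding mp_prod_fw prod_max_def by (rule SUP_commute)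
  have lim: "AE \<omega> in M. (\<lambda>n. prod_max I (fw (\<lambda>k. A k \<omega>)) n / ereal (real n)) \<longlonglongrightarrow> F.exponent I"
    by (rule AE_PD[OF F.exponent_lim])
  show ?thesis
    unfolding lyap_def eq
  proof (rule the_equality)
    fix g assume "AE \<omega> in M. (\<lambda>n. prod_max I (fw (\<lambda>k. A k \<omega>)) n / ereal (real n)) \<longlonglongrightarrow> g"
    with lim have "AE \<omega> in M. g = F.exponent I" by eventually_elim (rule LIMSEQ_unique)
    then show "g = F.exponent I" by simp
  qed (rule lim)
qed

lemma back_prod_reindex:
  assumes "rmax_seq (bw s)" "i \<in> I" "j \<in> I"
  shows "rprod I (bw s) n i j = mp_prod I (\<lambda>k. s (int k - int n)) n i j"
proof -
  have "rprod I (bw s) n i j = mp_prod I (\<lambda>k. bw s (n - 1 - k)) n i j"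
    using assms by (rule rprod_eq_mp_prod_rev)
  also have "mp_prod I (\<lambda>k. bw s (n - 1 - k)) n = mp_prod I (\<lambda>k. s (int k - int n)) n"
    by (rule mp_prod_cong) (auto simp: bw_def of_nat_diff intro!: arg_cong[where f = s])
  finally show ?thesis .
qed

text \<open>For each fixed \<open>n\<close>, \<open>A(-1) \<cdots> A(-n)\<close> and \<open>A(n-1) \<cdots> A(0)\<close> have the same law.\<close>

lemma law_back:
  assumes f: "f \<in> borel_measurable P" and X: "X \<in> borel_measurable P'" and "AE s in P'. X s = f (\<lambda>k. s (int k - int n))"
  shows "distr P borel f = distr P' borel X"
proof -
  have f': "f \<in> borel_measurable seq_space" using f unfolding measurable_cong_sets[OF sets_P refl] .
  have "distr P borel f = distr (distr P' seq_space (\<lambda>s (k::nat). s (int k - int n))) borel f"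
    by (simp only: P_restrict_back)
  also have "\<dots> = distr P' borel (\<lambda>s. f (\<lambda>k. s (int k - int n)))"
    by (subst distr_distr[OF f' reindex_P'[where h' = "\<lambda>k. int k - int n"]]) (simp add: o_def)
  also have "\<dots> = distr P' borel X"
  proof (rule distr_cong_AE)
    show "AE s in P'. f (\<lambda>k. s (int k - int n)) = X s" using assms(3) by eventually_elim simp
    show "(\<lambda>s. f (\<lambda>k. s (int k - int n))) \<in> borel_measurable P'"
      by (rule measurable_compose[OF reindex_P'[where h' = "\<lambda>k. int k - int n"] f'])
  qed (use X in auto)
  finally show ?thesis .
qed

text \<open>\<open>lyap\<close> is defined by forward products, while the upper bound for
  \<open>y\<close> needs the rate of the backward ones. Both rates are constant limits, and for each
  \<open>n\<close> the maxima have the same law.\<close>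

lemma B_exponent: "B.exponent I = F.exponent I"
proof (rule AE_limits_eq_of_law[OF P'.prob_space_axioms P.prob_space_axioms _ _ _ B.exponent_lim F.exponent_lim])
  fix n
  show "distr P' borel (\<lambda>x. prod_max I (bw x) n / ereal (real n)) = distr P borel (\<lambda>x. prod_max I (fw x) n / ereal (real n))"
  proof (rule law_back[symmetric])
    show "AE s in P'. prod_max I (bw s) n / ereal (real n) = prod_max I (fw (\<lambda>k. s (int k - int n))) n / ereal (real n)"
      using B.W_rmax
    proof eventually_elim
      case (elim s)
      have "prod_max I (bw s) n = (SUP i\<in>I. SUP j\<in>I. mp_prod I (\<lambda>k. s (int k - int n)) n i j)"
        unfolding prod_max_def using back_prod_reindex[OF elim] by (intro SUP_cong) auto
      also have "\<dots> = prod_max I (fw (\<lambda>k. s (int k - int n))) n"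
        unfolding mp_prod_fw prod_max_def by (rule SUP_commute)
      finally show ?case by simp
    qed
  qed measurable
qed measurable

end

section \<open>Row and column maxima\<close>

abbreviation (input) row_max :: "'d set \<Rightarrow> (nat \<Rightarrow> 'd rmat) \<Rightarrow> nat \<Rightarrow> 'd \<Rightarrow> ereal" where
  "row_max I W n i \<equiv> SUP j\<in>I. rprod I W n i j"

abbreviation (input) col_max :: "'d set \<Rightarrow> (nat \<Rightarrow> 'd rmat) \<Rightarrow> nat \<Rightarrow> 'd \<Rightarrow> ereal" where
  "col_max I W n i \<equiv> SUP j\<in>I. rprod I W n j i"

lemma row_max_mono: "I \<subseteq> J \<Longrightarrow> row_max I W n i \<le> row_max J W n i"
  by (intro SUP_mono) (blast intro: rprod_mono)

lemma col_max_mono: "I \<subseteq> J \<Longrightarrow> col_max I W n i \<le> col_max J W n i"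
  by (intro SUP_mono) (blast intro: rprod_mono)

lemma row_max_superadditive:
  fixes W :: "nat \<Rightarrow> ('d::finite) rmat"
  assumes "rmax_seq W" "k \<in> I"
  shows "rprod I W m i k + row_max I (seq_drop m W) n k \<le> row_max I W (m + n) i"
proof -
  have "row_max I (seq_drop m W) n k + rprod I W m i k = (SUP j\<in>I. rprod I (seq_drop m W) n k j + rprod I W m i k)"
    using assms(2) by (intro finite_SUP_add_right) auto
  also have "\<dots> \<le> row_max I W (m + n) i"
    using rprod_superadditive[OF assms] by (intro SUP_mono) (metis add.commute)
  finally show ?thesis by (simp add: add.commute)
qed

text \<open>In \<open>x(m + n)\<close> the later factors select the node \<open>k\<close> at which
  \<open>x(m)\<close> is read, so \<open>x(m)\<close> can only be bounded by its minimum. Minimizing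
  over \<open>i\<close> as well makes the minimum itself superadditive.\<close>

lemma col_max_superadditive:
  fixes W :: "nat \<Rightarrow> ('d::finite) rmat"
  assumes W: "rmax_seq W" and i: "i \<in> I"
  shows "(INF k\<in>I. col_max I W m k) + col_max I (seq_drop m W) n i \<le> col_max I W (m + n) i"
proof -
  obtain k where k: "k \<in> I" "col_max I (seq_drop m W) n i = rprod I (seq_drop m W) n k i"
    using finite_SUP_attained[of I "\<lambda>j. rprod I (seq_drop m W) n j i"] i by auto
  obtain j where j: "j \<in> I" "col_max I W m k = rprod I W m j k"
    using finite_SUP_attained[of I "\<lambda>j. rprod I W m j k"] i by auto
  have "(INF k\<in>I. col_max I W m k) + col_max I (seq_drop m W) n i \<le> rprod I W m j k + rprod I (seq_drop m W) n k i"
    unfolding k(2) j(2)[symmetric] using k(1) by (intro add_right_mono INF_lower)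
  also have "\<dots> \<le> rprod I W (m + n) j i" by (rule rprod_superadditive[OF W k(1)])
  also have "\<dots> \<le> col_max I W (m + n) i" using j(1) by (rule SUP_upper)
  finally show ?thesis .
qed

text \<open>A finite additive constant and a delay of \<open>m\<close> steps disappear after
  division by \<open>n\<close>. With \<open>row_max_superadditive\<close> this carries a lower bound
  from \<open>k\<close> back to \<open>i\<close>.\<close>

lemma le_liminf_divide_shift:
  fixes b d :: "nat \<Rightarrow> ereal"
  assumes bd: "\<And>n. ereal a + d n \<le> b (m + n)" and d: "\<gamma> \<le> liminf (\<lambda>n. d n / ereal (real n))"
  shows "\<gamma> \<le> liminf (\<lambda>n. b n / ereal (real n))"
proof (rule ccontr)
  assume "\<not> ?thesis"
  then obtain r where r: "liminf (\<lambda>n. b n / ereal (real n)) < ereal r" "ereal r < \<gamma>"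
    using ereal_dense2 by (auto simp: not_le)
  then obtain r' where r': "ereal r < ereal r'" "ereal r' < \<gamma>"
    using ereal_dense2 by blast
  have "eventually (\<lambda>n. ereal r' < d n / ereal (real n)) sequentially"
    by (rule less_LiminfD[OF less_le_trans[OF r'(2) d]])
  moreover have "eventually (\<lambda>n. real n \<ge> (r * real m - a) / (r' - r)) sequentially"
    using filterlim_real_sequentially by (auto simp: filterlim_at_top)
  moreover have "eventually (\<lambda>n. n \<ge> 1) sequentially" by (rule eventually_ge_at_top)
  ultimately have "eventually (\<lambda>n. ereal r \<le> b (n + m) / ereal (real (n + m))) sequentially"
  proof eventually_elim
    case (elim n)
    have 1: "ereal (r' * real n) < d n"
      using elim(1,3) by (simp add: ereal_less_divide_iff)
    have "r * real m - a \<le> real n * (r' - r)" using elim(2) r'(1) by (simp add: divide_le_eq)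
    then have "ereal (r * real (n + m)) \<le> ereal a + ereal (r' * real n)" by (simp add: algebra_simps)
    also have "\<dots> \<le> ereal a + d n" using 1 by (intro add_left_mono) auto
    also have "\<dots> \<le> b (n + m)" using bd[of n] by (simp add: add.commute)
    finally show ?case using elim(3) by (simp add: ereal_le_divide_pos mult.commute)
  qed
  then have "eventually (\<lambda>n. ereal r \<le> b n / ereal (real n)) sequentially"
    by (simp only: eventually_sequentially_seg[of "\<lambda>n. ereal r \<le> b n / ereal (real n)"])
  then have "ereal r \<le> liminf (\<lambda>n. b n / ereal (real n))" by (rule Liminf_bounded)
  then show False using r(1) by auto
qed

lemma tendsto_finite_INF_divide:
  fixes f :: "nat \<Rightarrow> 'd \<Rightarrow> ereal"
  assumes "finite H" "H \<noteq> {}" and lim: "\<And>i. i \<in> H \<Longrightarrow> (\<lambda>n. f n i / ereal (real n)) \<longlonglongrightarrow> \<gamma>"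
  shows "(\<lambda>n. (INF i\<in>H. f n i) / ereal (real n)) \<longlonglongrightarrow> \<gamma>"
proof -
  have att: "\<exists>i\<in>H. (INF i\<in>H. f n i) / ereal (real n) = f n i / ereal (real n)" for n
    using finite_INF_attained[OF assms(1,2), of "f n"] by metis
  show ?thesis
  proof (rule order_tendstoI)
    fix a assume "a < \<gamma>"
    then have "eventually (\<lambda>n. \<forall>i\<in>H. a < f n i / ereal (real n)) sequentially"
      using lim assms(1) by (intro eventually_ball_finite) (auto dest: order_tendstoD)
    then show "eventually (\<lambda>n. a < (INF i\<in>H. f n i) / ereal (real n)) sequentially"
      by eventually_elim (use att in metis)
  next
    fix a assume "\<gamma> < a"
    then have "eventually (\<lambda>n. \<forall>i\<in>H. f n i / ereal (real n) < a) sequentially"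
      using lim assms(1) by (intro eventually_ball_finite) (auto dest: order_tendstoD)
    then show "eventually (\<lambda>n. (INF i\<in>H. f n i) / ereal (real n) < a) sequentially"
      by eventually_elim (use att in metis)
  qed
qed

lemma rtrancl_exit:
  assumes "(i, j) \<in> R\<^sup>*" "i \<in> S" "j \<notin> S"
  obtains u v where "(u, v) \<in> R" "u \<in> S" "v \<notin> S" "(i, u) \<in> R\<^sup>*" "(v, j) \<in> R\<^sup>*"
proof -
  have "\<exists>u v. (u, v) \<in> R \<and> u \<in> S \<and> v \<notin> S \<and> (i, u) \<in> R\<^sup>* \<and> (v, j) \<in> R\<^sup>*"
    using assms
  proof (induction rule: converse_rtrancl_induct)
    case (step y z)
    then show ?case by (cases "z \<in> S") (blast intro: converse_rtrancl_into_rtrancl)+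
  qed auto
  then show ?thesis using that by blast
qed

section \<open>Components\<close>

context
  fixes M :: "'w measure" and A :: "nat \<Rightarrow> 'w \<Rightarrow> ('d::finite) rmat"
begin

abbreviation (input) reach :: "'d \<Rightarrow> 'd \<Rightarrow> bool" where
  "reach i j \<equiv> (i, j) \<in> (arcs_on M A UNIV)\<^sup>*"

lemma components_of_iff: "c \<in> components_of M A \<longleftrightarrow> (\<exists>i. c = {j. reach i j \<and> reach j i})"
  unfolding components_of_def quotient_def by (auto simp: Image_def)

lemma component_eq: "c \<in> components_of M A \<Longrightarrow> i \<in> c \<Longrightarrow> c = {j. reach i j \<and> reach j i}"
proof -
  assume "c \<in> components_of M A" "i \<in> c"
  then obtain k where k: "c = {j. reach k j \<and> reach j k}" and "reach k i" "reach i k"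
    unfolding components_of_iff by auto
  then have "reach k j \<longleftrightarrow> reach i j" "reach j k \<longleftrightarrow> reach j i" for j by (meson rtrancl_trans)+
  then show ?thesis unfolding k by simp
qed

lemma component_of: obtains c where "c \<in> components_of M A" "i \<in> c"
  using components_of_iff[of "{j. reach i j \<and> reach j i}"] by blast

lemma component_nonempty: "c \<in> components_of M A \<Longrightarrow> c \<noteq> {}"
  unfolding components_of_iff by auto

lemma component_disjoint: "c \<in> components_of M A \<Longrightarrow> c' \<in> components_of M A \<Longrightarrow> c \<noteq> c' \<Longrightarrow> c \<inter> c' = {}"
  using component_eq by blast

lemma leads_to_iff:
  assumes "c \<in> components_of M A" "c' \<in> components_of M A" "i \<in> c" "j \<in> c'"
  shows "leads_to M A c c' \<longleftrightarrow> reach i j"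
proof
  assume "leads_to M A c c'"
  then consider "c = c'" | u v where "u \<in> c" "v \<in> c'" "reach u v"
    unfolding leads_to_def by (auto dest: trancl_into_rtrancl)
  then show "reach i j"
  proof cases
    case 1 then show ?thesis using component_eq[OF assms(1,3)] assms(4) by auto
  next
    case 2
    have "reach i u" "reach v j" using component_eq[OF assms(1,3)] component_eq[OF assms(2,4)] 2 by auto
    then show ?thesis using 2 by (meson rtrancl_trans)
  qed
next
  assume "reach i j"
  then have "i = j \<or> (i, j) \<in> (arcs_on M A UNIV)\<^sup>+" by (auto simp: rtrancl_eq_or_trancl)
  then show "leads_to M A c c'"
    using component_disjoint[OF assms(1,2)] assms(3,4) unfolding leads_to_def by auto
qed

lemma leads_to_refl: "leads_to M A c c"
  by (simp add: leads_to_def)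

lemma leads_to_trans:
  assumes "c \<in> components_of M A" "c' \<in> components_of M A" "c'' \<in> components_of M A"
    "leads_to M A c c'" "leads_to M A c' c''"
  shows "leads_to M A c c''"
proof -
  obtain i j k where ijk: "i \<in> c" "j \<in> c'" "k \<in> c''" using component_nonempty[OF assms(1)] component_nonempty[OF assms(2)] component_nonempty[OF assms(3)] by blast
  have "reach i j" "reach j k"
    using leads_to_iff[OF assms(1,2) ijk(1,2)] leads_to_iff[OF assms(2,3) ijk(2,3)] assms(4,5) by simp_all
  then show ?thesis using leads_to_iff[OF assms(1,3) ijk(1,3)] by (blast intro: rtrancl_trans[of i j])
qed

lemma leads_to_antisym:
  assumes "c \<in> components_of M A" "c' \<in> components_of M A" "leads_to M A c c'" "leads_to M A c' c"
  shows "c = c'"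
proof -
  obtain i j where ij: "i \<in> c" "j \<in> c'" using component_nonempty[OF assms(1)] component_nonempty[OF assms(2)] by blast
  then have "reach i j" "reach j i"
    using leads_to_iff[OF assms(1,2) ij] leads_to_iff[OF assms(2,1) ij(2,1)] assms(3,4) by simp_all
  then have "j \<in> c" using component_eq[OF assms(1) ij(1)] by auto
  then show ?thesis using component_disjoint[OF assms(1,2)] ij(2) by blast
qed

lemma comp_E_self: "c \<in> components_of M A \<Longrightarrow> c \<in> comp_E M A c"
  by (simp add: comp_E_def leads_to_refl)

lemma comp_E_subset:
  assumes "c \<in> components_of M A" "l \<in> comp_E M A c" shows "comp_E M A l \<subseteq> comp_E M A c"
  using assms leads_to_trans[of c l] by (auto simp: comp_E_def)

text \<open>Mutually reachable components coincide, so \<open>c\<close> itself is lost on the way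
  down. This cardinality yields the ranks for \<open>growth_blocks\<close> and is the induction
  measure for the lower bound.\<close>

lemma comp_E_card_less:
  assumes "c \<in> components_of M A" "l \<in> comp_E M A c" "l \<noteq> c"
  shows "card (comp_E M A l) < card (comp_E M A c)"
proof (rule psubset_card_mono)
  have "c \<notin> comp_E M A l" using assms leads_to_antisym by (auto simp: comp_E_def)
  then show "comp_E M A l \<subset> comp_E M A c" using comp_E_subset comp_E_self assms by blast
qed simp

lemma lyap_le_comp_gamma: "l \<in> comp_E M A c \<Longrightarrow> lyap M A l \<le> comp_gamma M A c"
  unfolding comp_gamma_def by (intro Max_ge) auto

lemma comp_gamma_attained:
  assumes "c \<in> components_of M A"
  obtains p where "p \<in> comp_E M A c" "lyap M A p = comp_gamma M A c"
proof -
  have "comp_gamma M A c \<in> lyap M A ` comp_E M A c"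
    unfolding comp_gamma_def using comp_E_self[OF assms] by (intro Max_in) auto
  then show ?thesis using that by auto
qed

lemma comp_G_iff: "l \<in> comp_G M A c \<longleftrightarrow> l \<in> comp_E M A c \<and> (\<exists>p\<in>comp_E M A l. lyap M A p = comp_gamma M A c)"
  by (auto simp: comp_G_def comp_E_def)

lemma comp_G_self: "c \<in> components_of M A \<Longrightarrow> c \<in> comp_G M A c"
  using comp_gamma_attained comp_E_self unfolding comp_G_iff by metis

text \<open>Members of \<open>G\<close> still reach a component with the maximal exponent, so
  descending within \<open>G\<close> keeps the target rate.\<close>

lemma comp_G_gamma:
  assumes "c \<in> components_of M A" "l \<in> comp_G M A c"
  shows "comp_gamma M A l = comp_gamma M A c"
proof (rule antisym)
  have l: "l \<in> components_of M A" "l \<in> comp_E M A c" using assms by (auto simp: comp_G_iff comp_E_def)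
  obtain p where "p \<in> comp_E M A l" "lyap M A p = comp_gamma M A l" using comp_gamma_attained[OF l(1)] .
  then show "comp_gamma M A l \<le> comp_gamma M A c"
    using comp_E_subset[OF assms(1) l(2)] lyap_le_comp_gamma[of p c] by auto
  obtain p where "p \<in> comp_E M A l" "lyap M A p = comp_gamma M A c" using assms(2) by (auto simp: comp_G_iff)
  then show "comp_gamma M A c \<le> comp_gamma M A l" using lyap_le_comp_gamma[of p l] by auto
qed

lemma comp_G_subset:
  assumes "c \<in> components_of M A" "l \<in> comp_G M A c" shows "comp_G M A l \<subseteq> comp_G M A c"
  using comp_G_gamma[OF assms] comp_E_subset[OF assms(1), of l] assms(2) by (auto simp: comp_G_iff)

lemma comp_H_subset:
  assumes "c \<in> components_of M A" "l \<in> comp_G M A c" shows "comp_H M A l \<subseteq> comp_H M A c"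
  unfolding comp_H_def by (rule Union_mono[OF comp_G_subset[OF assms]])

text \<open>A component below \<open>c\<close> that attains the maximum belongs to \<open>G\<close>;
  when \<open>G\<close> is \<open>{c}\<close> it can only be \<open>c\<close>.\<close>

lemma dominating_gamma:
  assumes "c \<in> components_of M A" "dominating M A c"
  shows "comp_gamma M A c = lyap M A c" "comp_H M A c = c"
proof -
  show "comp_H M A c = c" using assms(2) by (simp add: comp_H_def dominating_def)
  obtain p where p: "p \<in> comp_E M A c" "lyap M A p = comp_gamma M A c" using comp_gamma_attained[OF assms(1)] .
  then have "p \<in> comp_G M A c" unfolding comp_G_iff using comp_E_self[of p] by (auto simp: comp_E_def)
  then have "p = c" using assms(2) by (simp add: dominating_def)
  then show "comp_gamma M A c = lyap M A c" using p by simp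
qed

lemma comp_E_closed:
  assumes "c \<in> components_of M A" "i \<in> \<Union>(comp_E M A c)" "(i, j) \<in> arcs_on M A UNIV"
  shows "j \<in> \<Union>(comp_E M A c)"
proof -
  obtain l where l: "l \<in> comp_E M A c" "i \<in> l" using assms(2) by auto
  obtain l' where l': "l' \<in> components_of M A" "j \<in> l'" by (rule component_of)
  have lc: "l \<in> components_of M A" "leads_to M A c l" using l by (auto simp: comp_E_def)
  have "leads_to M A l l'" using leads_to_iff[OF lc(1) l'(1) l(2) l'(2)] assms(3) by blast
  then have "leads_to M A c l'" using leads_to_trans lc l' assms(1) by blast
  then show ?thesis using l' by (auto simp: comp_E_def)
qed

lemma arc_card_less:
  assumes "l \<in> components_of M A" "l' \<in> components_of M A" "l \<noteq> l'" "i \<in> l" "j \<in> l'"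
    and "(i, j) \<in> arcs_on M A UNIV"
  shows "card (comp_E M A l') < card (comp_E M A l)"
  using assms leads_to_iff[OF assms(1,2,4,5)] by (intro comp_E_card_less) (auto simp: comp_E_def)

text \<open>Take another member \<open>l\<close> of \<open>G\<close> and a path from
  \<open>c\<close> to it. At an arc where the path leaves \<open>c\<close>, the new node lies in a
  component that still leads to \<open>l\<close>, hence to the maximal exponent, so this component
  is in \<open>G\<close> too.\<close>

lemma not_dominating_arc:
  assumes c: "c \<in> components_of M A" and "\<not> dominating M A c"
  obtains u v where "u \<in> c" "v \<in> comp_H M A c - c" "(u, v) \<in> arcs_on M A UNIV"
proof -
  obtain l where l: "l \<in> comp_G M A c" "l \<noteq> c"
    using assms comp_G_self by (auto simp: dominating_def)
  then have lc: "l \<in> components_of M A" "leads_to M A c l" by (auto simp: comp_G_iff comp_E_def)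
  obtain i j where ij: "i \<in> c" "j \<in> l" using component_nonempty[OF c] component_nonempty[OF lc(1)] by blast
  have "j \<notin> c" using component_disjoint[OF c lc(1)] l ij by blast
  have "reach i j" using leads_to_iff[OF c lc(1) ij] lc by simp
  then obtain u v where uv: "(u, v) \<in> arcs_on M A UNIV" "u \<in> c" "v \<notin> c" "reach i u" "reach v j"
    by (rule rtrancl_exit[OF _ ij(1) \<open>j \<notin> c\<close>])
  obtain l' where l': "l' \<in> components_of M A" "v \<in> l'" by (rule component_of)
  have "leads_to M A c l'" using leads_to_iff[OF c l'(1) uv(2) l'(2)] uv(1) by blast
  moreover have "leads_to M A l' l" using leads_to_iff[OF l'(1) lc(1) l'(2) ij(2)] uv by blast
  ultimately have "l' \<in> comp_G M A c"
    using l l' lc comp_E_subset[of l' l] unfolding comp_G_iff by (auto simp: comp_E_def)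
  then show ?thesis using that uv l' by (auto simp: comp_H_def)
qed

text \<open>A path between two nodes of a component stays inside it, so strong connectivity can fail
  only through the demand for paths of positive length.\<close>

lemma strongly_connected_component:
  assumes c: "c \<in> components_of M A" and "\<not> strongly_connected_on M A c"
  shows "\<exists>i. c = {i} \<and> (i, i) \<notin> arcs_on M A UNIV"
proof -
  have path: "(i, j) \<in> (arcs_on M A c)\<^sup>+" if "i \<in> c" "j \<in> c" "(i, j) \<in> (arcs_on M A UNIV)\<^sup>+" for i j
    using that(3,1,2)
  proof (induction rule: converse_trancl_induct)
    case (base y)
    then show ?case by (auto simp: arcs_on_def)
  next
    case (step y z)
    have "reach z y" using step component_eq[OF c \<open>j \<in> c\<close>] by (auto intro: rtrancl_trans dest: trancl_into_rtrancl)
    then have "z \<in> c" using component_eq[OF c \<open>y \<in> c\<close>] step.hyps(1) by auto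
    then have "(y, z) \<in> arcs_on M A c" using step by (auto simp: arcs_on_def)
    then show ?case using step \<open>z \<in> c\<close> by (auto intro: trancl_into_trancl2)
  qed
  obtain i j where ij: "i \<in> c" "j \<in> c" "(i, j) \<notin> (arcs_on M A UNIV)\<^sup>+"
    using assms(2) path unfolding strongly_connected_on_def by blast
  have "reach i j" using component_eq[OF c ij(1)] ij(2) by auto
  then have [simp]: "j = i" using ij(3) by (auto simp: rtrancl_eq_or_trancl)
  have "k = i" if "k \<in> c" for k
  proof (rule ccontr)
    assume "k \<noteq> i"
    moreover have "reach i k" "reach k i" using component_eq[OF c ij(1)] that by auto
    ultimately have "(i, k) \<in> (arcs_on M A UNIV)\<^sup>+" "(k, i) \<in> (arcs_on M A UNIV)\<^sup>+" by (auto simp: rtrancl_eq_or_trancl)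
    from trancl_trans[OF this] show False using ij(3) by simp
  qed
  then have "c = {i}" using ij(1) by blast
  moreover have "(i, i) \<notin> arcs_on M A UNIV" using ij(3) by auto
  ultimately show ?thesis by blast
qed

end

section \<open>Cycle times\<close>

lemma ereal_divide_nat_mono: "x \<le> y \<Longrightarrow> x / ereal (real n) \<le> y / ereal (real n)"
  unfolding divide_ereal_def by (intro ereal_mult_right_mono) (auto simp: inverse_ereal_ge0I)

lemma tendsto_divide_of_liminf_limsup:
  fixes a b :: "nat \<Rightarrow> ereal"
  assumes "\<gamma> \<le> liminf (\<lambda>n. a n / ereal (real n))" "limsup (\<lambda>n. b n / ereal (real n)) \<le> \<gamma>" "\<And>n. a n \<le> b n"
  shows "(\<lambda>n. a n / ereal (real n)) \<longlonglongrightarrow> \<gamma>" "(\<lambda>n. b n / ereal (real n)) \<longlonglongrightarrow> \<gamma>"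
proof -
  let ?a = "\<lambda>n. a n / ereal (real n)" and ?b = "\<lambda>n. b n / ereal (real n)"
  have le: "\<forall>\<^sub>F n in sequentially. ?a n \<le> ?b n"
    using assms(3) by (intro always_eventually allI ereal_divide_nat_mono)
  have "liminf ?a \<le> liminf ?b" "limsup ?a \<le> limsup ?b" by (rule Liminf_mono[OF le], rule Limsup_mono[OF le])
  moreover have "liminf ?a \<le> limsup ?a" "liminf ?b \<le> limsup ?b" by (simp_all add: Liminf_le_Limsup)
  ultimately have "liminf ?a = \<gamma>" "limsup ?a = \<gamma>" "liminf ?b = \<gamma>" "limsup ?b = \<gamma>"
    using assms(1,2) by (auto intro!: antisym elim: order_trans)
  then show "?a \<longlonglongrightarrow> \<gamma>" "?b \<longlonglongrightarrow> \<gamma>" by (simp_all add: tendsto_iff_Liminf_eq_Limsup)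
qed

context matrix_process
begin

section \<open>Arcs and upper bounds\<close>

lemma AE_entry_P_iff: "(AE s in P. s n i j = -\<infinity>) \<longleftrightarrow> (AE \<omega> in M. A n \<omega> i j = -\<infinity>)"
proof -
  have "{s\<in>space P. s n i j = -\<infinity>} \<in> sets P" by measurable
  from AE_PI[OF this] AE_PD[of "\<lambda>s. s n i j = -\<infinity>"] show ?thesis by blast
qed

lemma AE_M_iff_prob: "measure M {\<omega>\<in>space M. A n \<omega> i j \<noteq> -\<infinity>} = 0 \<longleftrightarrow> (AE \<omega> in M. A n \<omega> i j = -\<infinity>)"
proof -
  interpret M: prob_space M by (rule prob_M)
  have "{\<omega>\<in>space M. A n \<omega> i j \<noteq> -\<infinity>} \<in> sets M" by measurable
  from M.prob_eq_0[OF this] show ?thesis by (auto elim!: AE_mp)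
qed

lemma arcs_iff: "(i, j) \<in> arcs_on M A UNIV \<longleftrightarrow> \<not> (AE \<omega> in M. A 0 \<omega> i j = -\<infinity>)"
  unfolding AE_M_iff_prob[symmetric] arcs_on_def using measure_nonneg[of M "{\<omega>\<in>space M. A 0 \<omega> i j \<noteq> -\<infinity>}"]
  by (auto simp: less_le)

lemma AE_entry_iff: "(AE \<omega> in M. A n \<omega> i j = -\<infinity>) \<longleftrightarrow> (AE \<omega> in M. A 0 \<omega> i j = -\<infinity>)"
proof -
  have "(AE s in distr P P ((\<lambda>s. shift s) ^^ n). s 0 i j = -\<infinity>) \<longleftrightarrow> (AE s in P. ((\<lambda>s. shift s) ^^ n) s 0 i j = -\<infinity>)"
    by (rule AE_distr_iff[OF P.funpow_measurable]) measurable
  then show ?thesis unfolding AE_entry_P_iff[symmetric] by (simp only: P.funpow_distr funpow_shift seq_drop_apply add_0_right)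
qed

lemma no_arc_P: "AE s in P. \<forall>i j. (i, j) \<notin> arcs_on M A UNIV \<longrightarrow> (\<forall>n. s n i j = -\<infinity>)"
proof -
  have "AE s in P. (i, j) \<notin> arcs_on M A UNIV \<longrightarrow> s n i j = -\<infinity>" for i j n
    using AE_entry_iff[of n i j] by (cases "(i, j) \<in> arcs_on M A UNIV") (simp_all add: arcs_iff AE_entry_P_iff)
  then have "AE s in P. \<forall>i j n. (i, j) \<notin> arcs_on M A UNIV \<longrightarrow> s n i j = -\<infinity>"
    by (simp add: AE_all_countable)
  then show ?thesis by (auto elim!: eventually_mono)
qed

lemma no_arc_P': "AE s in P'. \<forall>i j. (i, j) \<notin> arcs_on M A UNIV \<longrightarrow> (\<forall>n. bw s n i j = -\<infinity>)"
proof -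
  have "AE s in P. \<forall>i j. (i, j) \<notin> arcs_on M A UNIV \<longrightarrow> s 0 i j = -\<infinity>"
    using no_arc_P by eventually_elim auto
  from P'.AE_orbit[OF AE_P_back[OF this, of 1]] show ?thesis
  proof eventually_elim
    case (elim s)
    have "- int n - 1 = - 1 - int n" for n by simp
    then show ?case unfolding bw_def using elim by (simp only: funpow_back_shift) simp
  qed
qed

text \<open>No arc leaves the union of the components in \<open>E\<close>, so from there the full
  products are bounded by the restricted ones, whose diagonal blocks all have exponent at most
  \<open>comp_gamma\<close>.\<close>

lemma limsup_row_max_le:
  assumes c: "c \<in> components_of M A"
  shows "AE s in P'. \<forall>i\<in>\<Union>(comp_E M A c). limsup (\<lambda>n. row_max UNIV (bw s) n i / ereal (real n)) \<le> comp_gamma M A c"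
proof -
  let ?U = "\<Union>(comp_E M A c)"
  have "AE s in P'. growth_le ?U (bw s) (of_rat q)" if q: "comp_gamma M A c < ereal (of_rat q)" for q :: rat
  proof (rule B.growth_blocks[where rank = "\<lambda>l. card (comp_E M A l)"])
    show "pairwise disjnt (comp_E M A c)"
      unfolding pairwise_def disjnt_def comp_E_def by (intro ballI impI component_disjoint) auto
    show "B.exponent l < ereal (of_rat q)" if "l \<in> comp_E M A c" for l
      using lyap_le_comp_gamma[OF that] q by (simp add: B_exponent lyap_eq)
    fix l l' assume l: "l \<in> comp_E M A c" "l' \<in> comp_E M A c" "l \<noteq> l'" "card (comp_E M A l) \<le> card (comp_E M A l')"
    have "(i, j) \<notin> arcs_on M A UNIV" if "i \<in> l" "j \<in> l'" for i j
      using arc_card_less[of l M A l' i j] l that by (auto simp: comp_E_def)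
    then show "AE s in P'. \<forall>n. \<forall>i\<in>l. \<forall>j\<in>l'. bw s n i j = -\<infinity>"
      using no_arc_P' by (auto elim!: eventually_mono)
  qed simp
  then have "AE s in P'. \<forall>i\<in>?U. limsup (\<lambda>n. row_max ?U (bw s) n i / ereal (real n)) \<le> comp_gamma M A c
       \<and> limsup (\<lambda>n. col_max ?U (bw s) n i / ereal (real n)) \<le> comp_gamma M A c"
    by (rule B.AE_growth_limsup)
  from this B.W_rmax no_arc_P'
  show ?thesis
  proof eventually_elim
    case (elim s)
    show ?case
    proof
      fix i assume i: "i \<in> ?U"
      have cl: "bw s n i j = -\<infinity>" if "i \<in> ?U" "j \<notin> ?U" for n i j
        using comp_E_closed[OF c that(1)] that(2) elim(3) by blast
      have "row_max UNIV (bw s) n i \<le> row_max ?U (bw s) n i" for n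
      proof (rule SUP_least)
        fix j
        have "rprod UNIV (bw s) n i j \<le> (if j \<in> ?U then rprod ?U (bw s) n i j else -\<infinity>)"
          by (rule rprod_closed[OF elim(2) cl i])
        also have "\<dots> \<le> row_max ?U (bw s) n i" by (cases "j \<in> ?U") (auto intro!: SUP_upper simp del: Union_iff)
        finally show "rprod UNIV (bw s) n i j \<le> row_max ?U (bw s) n i" .
      qed
      then have "limsup (\<lambda>n. row_max UNIV (bw s) n i / ereal (real n)) \<le> limsup (\<lambda>n. row_max ?U (bw s) n i / ereal (real n))"
        by (intro Limsup_mono always_eventually allI ereal_divide_nat_mono) auto
      also have "\<dots> \<le> comp_gamma M A c" using elim(1) i by blast
      finally show "limsup (\<lambda>n. row_max UNIV (bw s) n i / ereal (real n)) \<le> comp_gamma M A c" .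
    qed
  qed
qed

lemma limsup_col_max_le:
  assumes c: "c \<in> components_of M A"
  shows "AE s in P. \<forall>i\<in>\<Union>(comp_E M A c). limsup (\<lambda>n. col_max UNIV (fw s) n i / ereal (real n)) \<le> comp_gamma M A c"
proof -
  let ?U = "\<Union>(comp_E M A c)"
  have "AE s in P. growth_le ?U (fw s) (of_rat q)" if q: "comp_gamma M A c < ereal (of_rat q)" for q :: rat
  \<comment> \<open>Transposition reverses the arcs, so the rank is reversed by subtraction from the
    number of components.\<close>
  proof (rule F.growth_blocks[where rank = "\<lambda>l. card (components_of M A) - card (comp_E M A l)"])
    show "pairwise disjnt (comp_E M A c)"
      unfolding pairwise_def disjnt_def comp_E_def by (intro ballI impI component_disjoint) auto
    show "F.exponent l < ereal (of_rat q)" if "l \<in> comp_E M A c" for l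
      using lyap_le_comp_gamma[OF that] q by (simp add: lyap_eq)
    fix l l' assume l: "l \<in> comp_E M A c" "l' \<in> comp_E M A c" "l \<noteq> l'"
      "card (components_of M A) - card (comp_E M A l) \<le> card (components_of M A) - card (comp_E M A l')"
    have "card (comp_E M A l') \<le> card (components_of M A)"
      by (intro card_mono) (auto simp: comp_E_def)
    then have "(j, i) \<notin> arcs_on M A UNIV" if "i \<in> l" "j \<in> l'" for i j
      using arc_card_less[of l' M A l j i] l that by (auto simp: comp_E_def)
    then show "AE s in P. \<forall>n. \<forall>i\<in>l. \<forall>j\<in>l'. fw s n i j = -\<infinity>"
      using no_arc_P by (auto elim!: eventually_mono simp: fw_def)
  qed simp
  then have "AE s in P. \<forall>i\<in>?U. limsup (\<lambda>n. row_max ?U (fw s) n i / ereal (real n)) \<le> comp_gamma M A c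
       \<and> limsup (\<lambda>n. col_max ?U (fw s) n i / ereal (real n)) \<le> comp_gamma M A c"
    by (rule F.AE_growth_limsup)
  from this rmax_P no_arc_P
  show ?thesis
  proof eventually_elim
    case (elim s)
    show ?case
    proof
      fix i assume i: "i \<in> ?U"
      have cl: "s n i j = -\<infinity>" if "i \<in> ?U" "j \<notin> ?U" for n i j
        using comp_E_closed[OF c that(1)] that(2) elim(3) by blast
      have "col_max UNIV (fw s) n i \<le> col_max ?U (fw s) n i" for n
      proof (rule SUP_least)
        fix j
        have "rprod UNIV (fw s) n j i \<le> (if j \<in> ?U then rprod ?U (fw s) n j i else -\<infinity>)"
          unfolding mp_prod_fw[symmetric] by (rule mp_prod_closed[OF elim(2) cl i])
        also have "\<dots> \<le> col_max ?U (fw s) n i" by (cases "j \<in> ?U") (auto intro!: SUP_upper simp del: Union_iff)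
        finally show "rprod UNIV (fw s) n j i \<le> col_max ?U (fw s) n i" .
      qed
      then have "limsup (\<lambda>n. col_max UNIV (fw s) n i / ereal (real n)) \<le> limsup (\<lambda>n. col_max ?U (fw s) n i / ereal (real n))"
        by (intro Limsup_mono always_eventually allI ereal_divide_nat_mono) auto
      also have "\<dots> \<le> comp_gamma M A c" using elim(1) i by blast
      finally show "limsup (\<lambda>n. col_max UNIV (fw s) n i / ereal (real n)) \<le> comp_gamma M A c" .
    qed
  qed
qed

section \<open>Lower bounds\<close>

lemma mp_y_bw: "mp_y I A' n \<omega> i = row_max I (bw (\<lambda>k. A' k \<omega>)) n i"
  by (simp add: mp_y_eq bw_def)

lemma mp_x_fw: "mp_x I A n \<omega> i = col_max I (fw (\<lambda>k. A k \<omega>)) n i"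
  by (simp add: mp_x_eq mp_prod_fw)

lemma no_line_shift:
  assumes "no_line M H (A 0)" shows "no_line M H (A n)" and "AE s in P'. \<forall>i\<in>H. \<exists>j\<in>H. bw s 0 i j \<noteq> -\<infinity>"
proof -
  have P0: "AE s in P. \<forall>i\<in>H. \<exists>j\<in>H. s 0 i j \<noteq> -\<infinity>"
    using assms unfolding no_line_def by (intro AE_PI) measurable
  have "AE s in P. \<forall>i\<in>H. \<exists>j\<in>H. s n i j \<noteq> -\<infinity>"
    using P.AE_funpow[OF P0, of n] unfolding funpow_shift seq_drop_apply by simp
  then show "no_line M H (A n)" unfolding no_line_def by (rule AE_PD)
  show "AE s in P'. \<forall>i\<in>H. \<exists>j\<in>H. bw s 0 i j \<noteq> -\<infinity>"
    using AE_P_back[OF P0, of 1] by (simp add: bw_def)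
qed

text \<open>With \<open>I = c\<close>, the event of Hypothesis 3 says that from some node no finite
  path inside \<open>c\<close> ends with a step into \<open>J\<close>. For a node without loop, the
  finite entry in its row within \<open>H\<close> cannot be the diagonal one, so it points into
  \<open>J\<close> and the exit is immediate, at \<open>n = 0\<close>.\<close>

lemma AE_leaves_component:
  assumes c: "c \<in> components_of M A" and nd: "\<not> dominating M A c" and J: "J = comp_H M A c - c"
    and hyp1: "no_line M (comp_H M A c) (A 0)"
    and hyp3: "\<forall>I J. I \<inter> J = {} \<longrightarrow> I \<noteq> {} \<longrightarrow> J \<noteq> {} \<longrightarrow>
          (\<forall>n. no_line M (I \<union> J) (A n)) \<longrightarrow>
          (\<forall>n. AE \<omega> in M. \<forall>i\<in>J. \<forall>j\<in>I. A n \<omega> i j = -\<infinity>) \<longrightarrow>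
          strongly_connected_on M A I \<longrightarrow>
          (\<forall>n. \<not> (AE \<omega> in M. \<forall>i\<in>I. \<forall>j\<in>J. A n \<omega> i j = -\<infinity>)) \<longrightarrow>
          measure M' {\<omega> \<in> space M'. \<exists>i\<in>I. \<forall>n::nat.
              mp_vec I (mp_back_prod I (\<lambda>k. A' k \<omega>) n)
                (mp_vec J (A' (- int n - 1) \<omega>) (\<lambda>_. 0)) i = -\<infinity>} = 0"
  shows "AE s in P'. \<forall>i\<in>c. \<exists>n. \<exists>l\<in>c. \<exists>k\<in>J. rprod c (bw s) n i l \<noteq> -\<infinity> \<and> bw s n l k \<noteq> -\<infinity>"
proof -
  have cH: "c \<subseteq> comp_H M A c" using comp_G_self[OF c] by (auto simp: comp_H_def)
  show ?thesis
  proof (cases "strongly_connected_on M A c")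
    case False
    then obtain i0 where i0: "c = {i0}" "(i0, i0) \<notin> arcs_on M A UNIV"
      using strongly_connected_component[OF c] by blast
    from no_line_shift(2)[OF hyp1] no_arc_P' show ?thesis
    proof eventually_elim
      case (elim s)
      then obtain k where k: "k \<in> comp_H M A c" "bw s 0 i0 k \<noteq> -\<infinity>" using i0(1) cH by blast
      then have "k \<noteq> i0" using elim(2) i0(2) by auto
      then have "k \<in> J" using k(1) J i0(1) by auto
      moreover have "rprod c (bw s) 0 i0 i0 \<noteq> -\<infinity>" by (simp add: mp_id_def)
      ultimately show ?case using k(2) i0(1) by blast
    qed
  next
    case True
    define Q where "Q s \<longleftrightarrow> (\<exists>i\<in>c. \<forall>n. (SUP l\<in>c. rprod c (bw s) n i l + (SUP k\<in>J. bw s n l k + 0)) = -\<infinity>)" for s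
    have Qm: "{s\<in>space P'. Q s} \<in> sets P'" unfolding Q_def by measurable
    obtain u v where uv: "u \<in> c" "v \<in> J" "(u, v) \<in> arcs_on M A UNIV"
      using not_dominating_arc[OF c nd] J by auto
    have "measure M' {\<omega> \<in> space M'. \<exists>i\<in>c. \<forall>n::nat.
              mp_vec c (mp_back_prod c (\<lambda>k. A' k \<omega>) n)
                (mp_vec J (A' (- int n - 1) \<omega>) (\<lambda>_. 0)) i = -\<infinity>} = 0"
    proof (rule hyp3[rule_format])
      show "c \<inter> J = {}" using J by auto
      show "c \<noteq> {}" "J \<noteq> {}" using uv by auto
      have "c \<union> J = comp_H M A c" using J cH by auto
      then show "no_line M (c \<union> J) (A n)" for n using no_line_shift(1)[OF hyp1] by simp
      show "strongly_connected_on M A c" by fact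
      show "\<not> (AE \<omega> in M. \<forall>i\<in>c. \<forall>j\<in>J. A n \<omega> i j = -\<infinity>)" for n
      proof
        assume "AE \<omega> in M. \<forall>i\<in>c. \<forall>j\<in>J. A n \<omega> i j = -\<infinity>"
        then have "AE \<omega> in M. A n \<omega> u v = -\<infinity>" by eventually_elim (use uv in auto)
        then show False using uv(3) AE_entry_iff[of n u v] by (simp add: arcs_iff)
      qed
      show "AE \<omega> in M. \<forall>i\<in>J. \<forall>j\<in>c. A n \<omega> i j = -\<infinity>" for n
      proof -
        have na: "(i, j) \<notin> arcs_on M A UNIV" if i: "i \<in> J" and j: "j \<in> c" for i j
        proof
          assume arc: "(i, j) \<in> arcs_on M A UNIV"
          obtain l where l: "l \<in> comp_G M A c" "i \<in> l" using i J by (auto simp: comp_H_def)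
          then have lE: "l \<in> comp_E M A c" "l \<in> components_of M A" by (auto simp: comp_G_iff comp_E_def)
          have "l \<noteq> c" using i l J by auto
          from comp_E_card_less[OF c lE(1) this] arc_card_less[OF lE(2) c this l(2) j arc] show False by simp
        qed
        show ?thesis using AE_PD[OF no_arc_P] by eventually_elim (use na in blast)
      qed
    qed
    moreover have Q_eq: "(\<exists>i\<in>c. \<forall>n::nat. mp_vec c (mp_back_prod c (\<lambda>k. A' k \<omega>) n)
                (mp_vec J (A' (- int n - 1) \<omega>) (\<lambda>_. 0)) i = -\<infinity>) \<longleftrightarrow> Q (\<lambda>n. A' n \<omega>)" for \<omega>
      by (simp add: Q_def mp_vec_def mp_back_prod_eq_rprod bw_def)
    ultimately have 0: "measure M' {\<omega>\<in>space M'. Q (\<lambda>n. A' n \<omega>)} = 0" by simp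
    interpret M': prob_space M' by (rule prob_M')
    \<comment> \<open>\<open>measure\<close> is 0 also on non-measurable sets, so the hypothesis
      gives an almost sure statement only after the event is shown to be measurable.\<close>
    have "{\<omega>\<in>space M'. Q (\<lambda>n. A' n \<omega>)} \<in> sets M'"
      using measurable_sets[OF path_measurable' Qm[unfolded sets_P']] by (simp add: vimage_def Int_def conj_commute)
    from M'.prob_eq_0[OF this] 0 have "AE \<omega> in M'. \<not> Q (\<lambda>n. A' n \<omega>)" by (auto elim!: AE_mp)
    moreover have "{s\<in>space P'. \<not> Q s} \<in> sets P'" using Qm by (rule sets.sets_Collect_neg)
    ultimately have "AE s in P'. \<not> Q s" by (intro AE_P'I)
    then show ?thesis using B.W_rmax
    proof eventually_elim
      case (elim s)
      show ?case
      proof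
        fix i assume "i \<in> c"
        then obtain n where n: "(SUP l\<in>c. rprod c (bw s) n i l + (SUP k\<in>J. bw s n l k + 0)) \<noteq> -\<infinity>"
          using elim(1) by (auto simp: Q_def)
        then obtain l where l: "l \<in> c" "rprod c (bw s) n i l + (SUP k\<in>J. bw s n l k + 0) \<noteq> -\<infinity>"
          using SUP_least[of c "\<lambda>l. rprod c (bw s) n i l + (SUP k\<in>J. bw s n l k + 0)" "-\<infinity>"] by auto
        have fin: "(SUP k\<in>J. bw s n l k + 0) \<noteq> \<infinity>" using elim(2) by (intro finite_SUP_not_infty) (auto simp: rmax_seq_def)
        have r: "rprod c (bw s) n i l \<noteq> -\<infinity>" using l(2) fin by auto
        have "(SUP k\<in>J. bw s n l k + 0) \<noteq> -\<infinity>" using l(2) rprod_not_infty[OF elim(2)] by auto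
        moreover have "(SUP k\<in>J. bw s n l k + 0) \<le> -\<infinity>" if "\<forall>k\<in>J. bw s n l k = -\<infinity>"
          using that by (intro SUP_least) auto
        ultimately have "\<not> (\<forall>k\<in>J. bw s n l k = -\<infinity>)" by (metis ereal_infty_less_eq(2))
        then obtain k where "k \<in> J" "bw s n l k \<noteq> -\<infinity>" by blast
        then show "\<exists>n. \<exists>l\<in>c. \<exists>k\<in>J. rprod c (bw s) n i l \<noteq> -\<infinity> \<and> bw s n l k \<noteq> -\<infinity>" using r l(1) by blast
      qed
    qed
  qed
qed

text \<open>The products are restricted to \<open>H\<close>, which makes the bound stronger and fits
  the later comparison in law with \<open>x\<close> on \<open>H\<close>. For the other components in
  \<open>G\<close> the induction hypothesis has the same rate and an index set contained in
  \<open>H\<close>, so it carries over by monotonicity.\<close>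

lemma liminf_row_max_ge:
  assumes hyp1: "\<forall>c \<in> components_of M A. no_line M (comp_H M A c) (A 0)"
    and hyp2: "\<forall>c \<in> components_of M A. dominating M A c \<longrightarrow>
          (AE \<omega> in M'. \<forall>i\<in>c. (\<lambda>n. mp_y c A' n \<omega> i / ereal (real n)) \<longlonglongrightarrow> lyap M A c)"
    and hyp3: "\<forall>I J. I \<inter> J = {} \<longrightarrow> I \<noteq> {} \<longrightarrow> J \<noteq> {} \<longrightarrow>
          (\<forall>n. no_line M (I \<union> J) (A n)) \<longrightarrow>
          (\<forall>n. AE \<omega> in M. \<forall>i\<in>J. \<forall>j\<in>I. A n \<omega> i j = -\<infinity>) \<longrightarrow>
          strongly_connected_on M A I \<longrightarrow>
          (\<forall>n. \<not> (AE \<omega> in M. \<forall>i\<in>I. \<forall>j\<in>J. A n \<omega> i j = -\<infinity>)) \<longrightarrow>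
          measure M' {\<omega> \<in> space M'. \<exists>i\<in>I. \<forall>n::nat.
              mp_vec I (mp_back_prod I (\<lambda>k. A' k \<omega>) n)
                (mp_vec J (A' (- int n - 1) \<omega>) (\<lambda>_. 0)) i = -\<infinity>} = 0"
    and "c \<in> components_of M A"
  shows "AE s in P'. \<forall>i\<in>comp_H M A c. comp_gamma M A c \<le> liminf (\<lambda>n. row_max (comp_H M A c) (bw s) n i / ereal (real n))"
  using assms(4)
proof (induction "card (comp_E M A c)" arbitrary: c rule: less_induct)
  case less
  note c = less.prems
  define H where "H = comp_H M A c"
  define \<gamma> where "\<gamma> = comp_gamma M A c"
  define low where "low s i \<longleftrightarrow> \<gamma> \<le> liminf (\<lambda>n. row_max H (bw s) n i / ereal (real n))" for s i
  have cH: "c \<subseteq> H" using comp_G_self[OF c] by (auto simp: comp_H_def H_def)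
  have low_l: "AE s in P'. \<forall>i\<in>l. low s i" if l: "l \<in> comp_G M A c" "l \<noteq> c" for l
  proof -
    have lE: "l \<in> comp_E M A c" "l \<in> components_of M A" using l by (auto simp: comp_G_iff comp_E_def)
    have "l \<subseteq> comp_H M A l" using comp_G_self[OF lE(2)] by (auto simp: comp_H_def)
    with less.hyps[OF comp_E_card_less[OF c lE(1) l(2)] lE(2)]
    have "AE s in P'. \<forall>i\<in>l. \<gamma> \<le> liminf (\<lambda>n. row_max (comp_H M A l) (bw s) n i / ereal (real n))"
      unfolding comp_G_gamma[OF c l(1)] \<gamma>_def by (auto elim!: eventually_mono)
    then show ?thesis
    proof eventually_elim
      case (elim s)
      have "liminf (\<lambda>n. row_max (comp_H M A l) (bw s) n i / ereal (real n)) \<le> liminf (\<lambda>n. row_max H (bw s) n i / ereal (real n))" for i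
        using comp_H_subset[OF c l(1)] unfolding H_def
        by (intro Liminf_mono always_eventually allI ereal_divide_nat_mono row_max_mono) auto
      then show ?case using elim unfolding low_def by (blast intro: order_trans)
    qed
  qed
  have "AE s in P'. \<forall>l\<in>comp_G M A c - {c}. \<forall>i\<in>l. low s i"
    by (rule AE_finite_allI) (simp, use low_l in blast)
  then have J: "AE s in P'. \<forall>i\<in>H - c. low s i"
    by eventually_elim (auto simp: H_def comp_H_def)
  have "AE s in P'. \<forall>i\<in>c. low s i"
  proof (cases "dominating M A c")
    case True
    have "AE \<omega> in M'. \<forall>i\<in>c. \<gamma> \<le> liminf (\<lambda>n. row_max H (bw (\<lambda>k. A' k \<omega>)) n i / ereal (real n))"
      using hyp2[rule_format, OF c True]
    proof eventually_elim
      case (elim \<omega>)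
      then show ?case unfolding mp_y_bw \<gamma>_def H_def dominating_gamma[OF c True]
        by (auto simp: lim_imp_Liminf)
    qed
    then show ?thesis unfolding low_def by (intro AE_P'I) measurable
  next
    case False
    \<comment> \<open>The exit time \<open>n\<close> is random, so the bound on \<open>H - c\<close>
      is needed from every starting time along the orbit.\<close>
    have orbit: "AE s in P'. \<forall>m. \<forall>i\<in>H - c. \<gamma> \<le> liminf (\<lambda>n. row_max H (seq_drop m (bw s)) n i / ereal (real n))"
      using P'.AE_orbit[OF J] unfolding low_def B.W_funpow .
    from AE_leaves_component[OF c False refl hyp1[rule_format, OF c] hyp3] orbit B.W_rmax
    show ?thesis
    proof eventually_elim
      case (elim s)
      show ?case
      proof
        fix i assume "i \<in> c"
        then obtain n l k where nlk: "l \<in> c" "k \<in> H - c" "rprod c (bw s) n i l \<noteq> -\<infinity>" "bw s n l k \<noteq> -\<infinity>"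
          using elim(1) unfolding H_def by blast
        have "rprod c (bw s) n i l + bw s n l k \<le> rprod H (bw s) n i l + bw s n l k"
          by (intro add_right_mono rprod_mono cH)
        also have "\<dots> \<le> rprod H (bw s) (Suc n) i k"
          unfolding rprod.simps mp_mult_def using nlk(1) cH by (intro SUP_upper) auto
        finally have "rprod H (bw s) (Suc n) i k \<noteq> -\<infinity>" using nlk(3,4) by auto
        then obtain a where a: "rprod H (bw s) (Suc n) i k = ereal a"
          using rprod_not_infty[OF elim(3), of H "Suc n" i k] by (metis ereal_cases)
        have "ereal a + row_max H (seq_drop (Suc n) (bw s)) m k \<le> row_max H (bw s) (Suc n + m) i" for m
          unfolding a[symmetric] using nlk(2) by (intro row_max_superadditive elim(3)) auto
        moreover have "\<gamma> \<le> liminf (\<lambda>m. row_max H (seq_drop (Suc n) (bw s)) m k / ereal (real m))"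
          using elim(2) nlk(2) by blast
        ultimately show "low s i" unfolding low_def by (rule le_liminf_divide_shift)
      qed
    qed
  qed
  with J show ?case
    by eventually_elim (auto simp: low_def H_def \<gamma>_def)
qed

text \<open>Kingman's theorem supplies an almost sure constant for \<open>f\<close>, and only then
  can equality of laws at each \<open>n\<close> decide its value. The minimum lies below each
  coordinate, which gives the bound at every node.\<close>

lemma liminf_col_max_ge:
  assumes c: "c \<in> components_of M A"
    and int: "integrable_vec M (comp_H M A c) (\<lambda>\<omega>. mp_vec (comp_H M A c) (A 0 \<omega>) (\<lambda>_. 0))"
    and lim: "AE s in P'. \<forall>i\<in>comp_H M A c. (\<lambda>n. row_max (comp_H M A c) (bw s) n i / ereal (real n)) \<longlonglongrightarrow> \<gamma>"
  shows "AE s in P. \<forall>i\<in>comp_H M A c. \<gamma> \<le> liminf (\<lambda>n. col_max (comp_H M A c) (fw s) n i / ereal (real n))"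
proof -
  define H where "H = comp_H M A c"
  have H0: "H \<noteq> {}" using comp_G_self[OF c] component_nonempty[OF c] by (auto simp: comp_H_def H_def)
  define v where "v i s = (SUP j\<in>H. s 0 i j + 0 :: ereal)" for i and s :: "nat \<Rightarrow> 'd rmat"
  \<comment> \<open>\<open>f 1\<close> is at most minus the least of the \<open>v i\<close>, hence
    at most the sum of their absolute values; this is where integrability of \<open>A(0) 0\<close>
    on \<open>H\<close> enters.\<close>
  define g where "g s = (\<Sum>i\<in>H. \<bar>real_of_ereal (v i s)\<bar>)" for s
  have vm: "v i \<in> borel_measurable P" for i unfolding v_def by measurable
  have v_int: "integrable P (\<lambda>s. real_of_ereal (v i s))" if "i \<in> H" for i
  proof -
    have m: "(\<lambda>s. real_of_ereal (v i s)) \<in> borel_measurable P" using vm by measurable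
    have "integrable M (\<lambda>\<omega>. real_of_ereal (v i (\<lambda>n. A n \<omega>)))"
      using int that by (simp add: integrable_vec_def mp_vec_def v_def H_def)
    then show ?thesis unfolding P_def path_law_def
      by (subst integrable_distr_eq[OF path_measurable m[unfolded measurable_cong_sets[OF sets_P refl]]])
  qed
  have v_fin: "AE s in P. \<forall>i\<in>H. \<bar>v i s\<bar> \<noteq> \<infinity>"
  proof (rule AE_PI)
    have "AE \<omega> in M. \<bar>v i (\<lambda>n. A n \<omega>)\<bar> \<noteq> \<infinity>" if "i \<in> H" for i
      using int that by (simp add: integrable_vec_def mp_vec_def v_def H_def)
    then show "AE \<omega> in M. \<forall>i\<in>H. \<bar>v i (\<lambda>n. A n \<omega>)\<bar> \<noteq> \<infinity>" by (intro AE_finite_allI) auto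
    show "{s \<in> space P. \<forall>i\<in>H. \<bar>v i s\<bar> \<noteq> \<infinity>} \<in> sets P" using vm by measurable
  qed
  define f where "f n s = - (INF i\<in>H. col_max H (fw s) n i)" for n s
  interpret S: subadditive_process P "\<lambda>s. shift s" f g
  proof
    show "f n \<in> borel_measurable P" for n unfolding f_def by measurable
    show "integrable P g" unfolding g_def using v_int by (intro Bochner_Integration.integrable_sum integrable_abs)
    show "AE s in P. f 0 s \<le> 0"
    proof (rule AE_I2)
      fix s
      have "0 \<le> (INF i\<in>H. col_max H (fw s) 0 i)"
      proof (rule INF_greatest)
        fix i assume "i \<in> H"
        then show "0 \<le> col_max H (fw s) 0 i" by (intro SUP_upper2[of i]) (auto simp: mp_id_def)
      qed
      then show "f 0 s \<le> 0" by (simp add: f_def)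
    qed
    show "AE s in P. f 1 s \<le> ereal (g s)"
      using v_fin rmax_P
    proof eventually_elim
      case (elim s)
      have "ereal (- g s) \<le> (INF i\<in>H. col_max H (fw s) 1 i)"
      proof (rule INF_greatest)
        fix i assume i: "i \<in> H"
        have "\<bar>real_of_ereal (v i s)\<bar> \<le> g s" unfolding g_def by (intro member_le_sum i abs_ge_zero finite)
        then have "- g s \<le> real_of_ereal (v i s)" by linarith
        then have "ereal (- g s) \<le> ereal (real_of_ereal (v i s))" by (simp only: ereal_less_eq)
        also have "\<dots> = v i s" using elim(1) i by (simp add: ereal_real)
        also have "\<dots> \<le> col_max H (fw s) 1 i"
          unfolding v_def
        proof (rule SUP_mono)
          fix j assume j: "j \<in> H"
          have "s 0 i j + 0 \<le> rprod H (fw s) 1 j i"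
            using j by (auto simp: mp_mult_def fw_def mp_id_def intro!: SUP_upper2[of j])
          then show "\<exists>j'\<in>H. s 0 i j + 0 \<le> rprod H (fw s) 1 j' i" using j by blast
        qed
        finally show "ereal (- g s) \<le> col_max H (fw s) 1 i" .
      qed
      then show ?case unfolding f_def using ereal_uminus_le_reorder by fastforce
    qed
    fix m n
    show "AE s in P. f (m + n) s \<le> f m s + f n (((\<lambda>s. shift s) ^^ m) s)"
      using F.W_rmax
    proof eventually_elim
      case (elim s)
      let ?a = "INF i\<in>H. col_max H (fw s) m i" and ?b = "INF i\<in>H. col_max H (seq_drop m (fw s)) n i"
      have "?a + ?b \<le> (INF i\<in>H. col_max H (fw s) (m + n) i)"
      proof (rule INF_greatest)
        fix i assume i: "i \<in> H"
        have "?a + ?b \<le> ?a + col_max H (seq_drop m (fw s)) n i" using i by (intro add_left_mono INF_lower)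
        also have "\<dots> \<le> col_max H (fw s) (m + n) i" by (rule col_max_superadditive[OF elim i])
        finally show "?a + ?b \<le> col_max H (fw s) (m + n) i" .
      qed
      \<comment> \<open>Negation is not additive on opposite infinities; neither minimum is
        \<infinity>, as \<open>H\<close> is nonempty and the products never take this value.\<close>
      moreover have "- (?a + ?b) = - ?a + - ?b"
      proof -
        have ninf: "(INF i\<in>H. col_max H W n i) \<noteq> \<infinity>" if "rmax_seq W" for W n
        proof -
          obtain i where "i \<in> H" using H0 by auto
          then have "(INF i\<in>H. col_max H W n i) \<le> col_max H W n i" by (rule INF_lower)
          moreover have "col_max H W n i \<noteq> \<infinity>" by (intro finite_SUP_not_infty rprod_not_infty that) auto
          ultimately show ?thesis by auto
        qed
        have "?a \<noteq> \<infinity>" "?b \<noteq> \<infinity>" using ninf elim rmax_seq_drop[OF elim] by auto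
        then show ?thesis by (cases ?a; cases ?b) auto
      qed
      ultimately show ?case unfolding f_def F.W_funpow by (metis ereal_minus_le_minus)
    qed
  qed
  obtain d where d: "AE s in P. (\<lambda>n. f n s / ereal (real n)) \<longlonglongrightarrow> d" by (rule S.kingman)
  have "AE s in P'. (\<lambda>n. - ((INF i\<in>H. row_max H (bw s) n i) / ereal (real n))) \<longlonglongrightarrow> - \<gamma>"
    using lim unfolding H_def[symmetric]
    by eventually_elim (intro tendsto_uminus_ereal tendsto_finite_INF_divide H0, auto)
  then have lim': "AE s in P'. (\<lambda>n. - (INF i\<in>H. row_max H (bw s) n i) / ereal (real n)) \<longlonglongrightarrow> - \<gamma>"
    by (simp add: divide_ereal_def)
  have "d = - \<gamma>"
  proof (rule AE_limits_eq_of_law[OF P.prob_space_axioms P'.prob_space_axioms _ _ _ d lim'])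
    fix n
    show m1: "(\<lambda>s. f n s / ereal (real n)) \<in> borel_measurable P" by measurable
    show m2: "(\<lambda>s. - (INF i\<in>H. row_max H (bw s) n i) / ereal (real n)) \<in> borel_measurable P'" by measurable
    show "distr P borel (\<lambda>s. f n s / ereal (real n)) = distr P' borel (\<lambda>s. - (INF i\<in>H. row_max H (bw s) n i) / ereal (real n))"
    proof (rule law_back[OF m1 m2])
      show "AE s in P'. - (INF i\<in>H. row_max H (bw s) n i) / ereal (real n) = f n (\<lambda>k. s (int k - int n)) / ereal (real n)"
        using B.W_rmax
      proof eventually_elim
        case (elim s)
        have "row_max H (bw s) n i = col_max H (fw (\<lambda>k. s (int k - int n))) n i" if "i \<in> H" for i
          unfolding mp_prod_fw[symmetric] using back_prod_reindex[OF elim that] by (intro SUP_cong) auto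
        then show ?case unfolding f_def by (simp cong: INF_cong_simp)
      qed
    qed
  qed
  with d have "AE s in P. (\<lambda>n. f n s / ereal (real n)) \<longlonglongrightarrow> - \<gamma>" by simp
  then show ?thesis unfolding H_def[symmetric]
  proof eventually_elim
    case (elim s)
    have "(\<lambda>n. - (f n s / ereal (real n))) \<longlonglongrightarrow> - (- \<gamma>)" by (intro tendsto_uminus_ereal elim)
    then have "(\<lambda>n. (INF i\<in>H. col_max H (fw s) n i) / ereal (real n)) \<longlonglongrightarrow> \<gamma>"
      by (simp add: f_def divide_ereal_def)
    then have eq: "\<gamma> = liminf (\<lambda>n. (INF i\<in>H. col_max H (fw s) n i) / ereal (real n))" by (simp add: lim_imp_Liminf)
    show ?case
    proof
      fix i assume "i \<in> H"
      then show "\<gamma> \<le> liminf (\<lambda>n. col_max H (fw s) n i / ereal (real n))"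
        unfolding eq by (intro Liminf_mono always_eventually allI ereal_divide_nat_mono INF_lower)
    qed
  qed
qed

lemma comp_gamma_less_infty:
  assumes "c \<in> components_of M A" shows "comp_gamma M A c < \<infinity>"
proof -
  obtain p where "lyap M A p = comp_gamma M A c" using comp_gamma_attained[OF assms] by metis
  then show ?thesis using F.exponent_less_infty[of p] by (simp add: lyap_eq)
qed

lemma comp_H_subset_comp_E: "comp_H M A c \<subseteq> \<Union>(comp_E M A c)"
  by (auto simp: comp_H_def comp_G_iff)

text \<open>The lower bound holds on \<open>H\<close>, the upper bound for all indices, and row
  maxima increase with the index set, so both are squeezed to one limit. The first conclusion feeds
  the comparison in law, the second is the claim about \<open>y\<close>.\<close>

lemma row_max_limits:
  assumes c: "c \<in> components_of M A"
    and low: "AE s in P'. \<forall>i\<in>comp_H M A c. comp_gamma M A c \<le> liminf (\<lambda>n. row_max (comp_H M A c) (bw s) n i / ereal (real n))"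
  shows "AE s in P'. \<forall>i\<in>comp_H M A c. (\<lambda>n. row_max (comp_H M A c) (bw s) n i / ereal (real n)) \<longlonglongrightarrow> comp_gamma M A c"
    and "AE s in P'. \<forall>i\<in>comp_H M A c. (\<lambda>n. row_max UNIV (bw s) n i / ereal (real n)) \<longlonglongrightarrow> comp_gamma M A c"
proof -
  have "AE s in P'. \<forall>i\<in>comp_H M A c. (\<lambda>n. row_max (comp_H M A c) (bw s) n i / ereal (real n)) \<longlonglongrightarrow> comp_gamma M A c
      \<and> (\<lambda>n. row_max UNIV (bw s) n i / ereal (real n)) \<longlonglongrightarrow> comp_gamma M A c"
    using low limsup_row_max_le[OF c]
  proof eventually_elim
    case (elim s)
    show ?case
    proof
      fix i assume i: "i \<in> comp_H M A c"
      have "limsup (\<lambda>n. row_max UNIV (bw s) n i / ereal (real n)) \<le> comp_gamma M A c"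
        using elim(2) i comp_H_subset_comp_E[of c] by blast
      from tendsto_divide_of_liminf_limsup[OF bspec[OF elim(1) i] this row_max_mono[OF subset_UNIV]]
      show "(\<lambda>n. row_max (comp_H M A c) (bw s) n i / ereal (real n)) \<longlonglongrightarrow> comp_gamma M A c
      \<and> (\<lambda>n. row_max UNIV (bw s) n i / ereal (real n)) \<longlonglongrightarrow> comp_gamma M A c" by blast
    qed
  qed
  then show "AE s in P'. \<forall>i\<in>comp_H M A c. (\<lambda>n. row_max (comp_H M A c) (bw s) n i / ereal (real n)) \<longlonglongrightarrow> comp_gamma M A c"
    "AE s in P'. \<forall>i\<in>comp_H M A c. (\<lambda>n. row_max UNIV (bw s) n i / ereal (real n)) \<longlonglongrightarrow> comp_gamma M A c"
    by (auto elim!: eventually_mono)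
qed

lemma col_max_limits:
  assumes c: "c \<in> components_of M A"
    and low: "AE s in P. \<forall>i\<in>comp_H M A c. comp_gamma M A c \<le> liminf (\<lambda>n. col_max (comp_H M A c) (fw s) n i / ereal (real n))"
  shows "AE s in P. \<forall>i\<in>comp_H M A c. (\<lambda>n. col_max UNIV (fw s) n i / ereal (real n)) \<longlonglongrightarrow> comp_gamma M A c"
proof -
  have "AE s in P. \<forall>i\<in>comp_H M A c. (\<lambda>n. col_max (comp_H M A c) (fw s) n i / ereal (real n)) \<longlonglongrightarrow> comp_gamma M A c
      \<and> (\<lambda>n. col_max UNIV (fw s) n i / ereal (real n)) \<longlonglongrightarrow> comp_gamma M A c"
    using low limsup_col_max_le[OF c]
  proof eventually_elim
    case (elim s)
    show ?case
    proof
      fix i assume i: "i \<in> comp_H M A c"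
      have "limsup (\<lambda>n. col_max UNIV (fw s) n i / ereal (real n)) \<le> comp_gamma M A c"
        using elim(2) i comp_H_subset_comp_E[of c] by blast
      from tendsto_divide_of_liminf_limsup[OF bspec[OF elim(1) i] this col_max_mono[OF subset_UNIV]]
      show "(\<lambda>n. col_max (comp_H M A c) (fw s) n i / ereal (real n)) \<longlonglongrightarrow> comp_gamma M A c
      \<and> (\<lambda>n. col_max UNIV (fw s) n i / ereal (real n)) \<longlonglongrightarrow> comp_gamma M A c" by blast
    qed
  qed
  then show "AE s in P. \<forall>i\<in>comp_H M A c. (\<lambda>n. col_max UNIV (fw s) n i / ereal (real n)) \<longlonglongrightarrow> comp_gamma M A c"
    by (auto elim!: eventually_mono)
qed

end

theorem theorem2p4:
  fixes M :: "'w measure" and A :: "nat \<Rightarrow> 'w \<Rightarrow> ('d::finite) rmat"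
    and M' :: "'v measure" and A' :: "int \<Rightarrow> 'v \<Rightarrow> 'd rmat"
  assumes "prob_space M"
    and "rmax_valued M A" and "stationary M A" and "ergodic M A"
    and "integrable M (\<lambda>\<omega>. real_of_ereal (SUP i. SUP j. max (A 0 \<omega> i j) 0))"
    and "two_sided_extension M A M' A'"
    and hyp1: "\<forall>c \<in> components_of M A. no_line M (comp_H M A c) (A 0)"
    and hyp2: "\<forall>c \<in> components_of M A. dominating M A c \<longrightarrow>
          (AE \<omega> in M'. \<forall>i\<in>c. (\<lambda>n. mp_y c A' n \<omega> i / ereal (real n)) \<longlonglongrightarrow> lyap M A c)"
    and hyp3: "\<forall>I J. I \<inter> J = {} \<longrightarrow> I \<noteq> {} \<longrightarrow> J \<noteq> {} \<longrightarrow>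
          (\<forall>n. no_line M (I \<union> J) (A n)) \<longrightarrow>
          (\<forall>n. AE \<omega> in M. \<forall>i\<in>J. \<forall>j\<in>I. A n \<omega> i j = -\<infinity>) \<longrightarrow>
          strongly_connected_on M A I \<longrightarrow>
          (\<forall>n. \<not> (AE \<omega> in M. \<forall>i\<in>I. \<forall>j\<in>J. A n \<omega> i j = -\<infinity>)) \<longrightarrow>
          measure M' {\<omega> \<in> space M'. \<exists>i\<in>I. \<forall>n::nat.
              mp_vec I (mp_back_prod I (\<lambda>k. A' k \<omega>) n)
                (mp_vec J (A' (- int n - 1) \<omega>) (\<lambda>_. 0)) i = -\<infinity>} = 0"
  shows "(\<forall>c \<in> components_of M A. AE \<omega> in M'. \<forall>i\<in>c.
             (\<lambda>n. mp_y UNIV A' n \<omega> i / ereal (real n)) \<longlonglongrightarrow> comp_gamma M A c)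
       \<and> ((\<forall>c \<in> components_of M A.
              integrable_vec M (comp_H M A c) (\<lambda>\<omega>. mp_vec (comp_H M A c) (A 0 \<omega>) (\<lambda>_. 0)))
          \<longrightarrow>
            (AE \<omega> in M. \<exists>l. (\<forall>i. l i \<noteq> \<infinity>) \<and>
               (\<forall>i. (\<lambda>n. mp_x UNIV A n \<omega> i / ereal (real n)) \<longlonglongrightarrow> l i)) \<and>
            (\<forall>c \<in> components_of M A. AE \<omega> in M. \<forall>i\<in>c.
               (\<lambda>n. mp_x UNIV A n \<omega> i / ereal (real n)) \<longlonglongrightarrow> comp_gamma M A c))"
proof -
  interpret matrix_process M A M' A'
    using assms(1-6) by (intro matrix_process.intro) (simp_all add: entry_bound_def)
  have cH: "c \<subseteq> comp_H M A c" if "c \<in> components_of M A" for c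
    using comp_G_self[OF that] by (auto simp: comp_H_def)
  note low = liminf_row_max_ge[OF hyp1 hyp2 hyp3]
  have "AE \<omega> in M'. \<forall>i\<in>c. (\<lambda>n. mp_y UNIV A' n \<omega> i / ereal (real n)) \<longlonglongrightarrow> comp_gamma M A c"
    if c: "c \<in> components_of M A" for c
    using AE_P'D[OF row_max_limits(2)[OF c low[OF c]]] unfolding mp_y_bw
    by eventually_elim (use cH[OF c] in blast)
  moreover
  { assume int: "\<forall>c \<in> components_of M A.
              integrable_vec M (comp_H M A c) (\<lambda>\<omega>. mp_vec (comp_H M A c) (A 0 \<omega>) (\<lambda>_. 0))"
    have lim: "AE \<omega> in M. \<forall>i\<in>c. (\<lambda>n. mp_x UNIV A n \<omega> i / ereal (real n)) \<longlonglongrightarrow> comp_gamma M A c"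
      if c: "c \<in> components_of M A" for c
    proof -
      have "AE s in P. \<forall>i\<in>comp_H M A c. (\<lambda>n. col_max UNIV (fw s) n i / ereal (real n)) \<longlonglongrightarrow> comp_gamma M A c"
        by (intro col_max_limits liminf_col_max_ge row_max_limits low c int[rule_format])
      from AE_PD[OF this] show ?thesis unfolding mp_x_fw
        by eventually_elim (use cH[OF c] in blast)
    qed
    \<comment> \<open>The components cover all nodes, so the limit vector assigns to each node the
      rate of its component; the finitely many nodes share one null set.\<close>
    have "\<forall>i. \<exists>c. c \<in> components_of M A \<and> i \<in> c" using component_of by metis
    then obtain comp where comp: "\<And>i. comp i \<in> components_of M A" "\<And>i. i \<in> comp i" by metis
    have "AE \<omega> in M. \<forall>i. (\<lambda>n. mp_x UNIV A n \<omega> i / ereal (real n)) \<longlonglongrightarrow> comp_gamma M A (comp i)"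
      unfolding AE_all_countable
    proof
      fix i
      show "AE \<omega> in M. (\<lambda>n. mp_x UNIV A n \<omega> i / ereal (real n)) \<longlonglongrightarrow> comp_gamma M A (comp i)"
        using lim[OF comp(1)[of i]] by eventually_elim (use comp(2) in blast)
    qed
    then have "AE \<omega> in M. \<exists>l. (\<forall>i. l i \<noteq> \<infinity>) \<and> (\<forall>i. (\<lambda>n. mp_x UNIV A n \<omega> i / ereal (real n)) \<longlonglongrightarrow> l i)"
    proof eventually_elim
      case (elim \<omega>)
      have "comp_gamma M A (comp i) \<noteq> \<infinity>" for i using comp_gamma_less_infty[OF comp(1)[of i]] by auto
      then show ?case using elim by (intro exI[of _ "\<lambda>i. comp_gamma M A (comp i)"]) blast
    qed
    note this lim }
  ultimately show ?thesis by blast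
qed

end
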